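(* There exist a finite set of colors $C$ with a distinguished color $c_0\in C$ and a tiling system $T\subseteq C^4$ over $C$ such that the following zero tiling sum problem is undecidable: given a finitely supported mapping $f_0:\mathscr E\times C\to\mathbb Z$, decide whether there exists a tiling sum $f$ over $T$ with $f_0+f=0$.
   Context: Let $\mathscr E=\{\{(p,q),(r,s)\}: p,q,r,s\in\mathbb Z,\ |p-r|+|q-s|=1\}$ be the set of edges of the Cayley graph of $\mathbb Z\times\mathbb Z$ (the unit grid), with translation $e+(a,b)$ defined by translating both endpoints. A tiling system over $C$ is a set $T\subseteq C^4$ of tiles $t=(c_N,c_E,c_S,c_W)$ (north, east, south, west colors). With $\delta$ the Kronecker delta, each tile $t$ defines $[\![t]\!]:\mathscr E\times C\to\mathbb Z$ by $[\![t]\!](\{(0,0),(1,0)\},c_S)=-(1-\delta_{c_S,c_0})$, $[\![t]\!](\{(1,0),(1,1)\},c_E)=1-\delta_{c_E,c_0}$, $[\![t]\!](\{(1,1),(0,1)\},c_N)=1-\delta_{c_N,c_0}$, $[\![t]\!](\{(0,1),(0,0)\},c_W)=-(1-\delta_{c_W,c_0})$, and $[\![t]\!](e,c)=0$ in all other cases. For $f:\mathscr E\times C\to\mathbb Z$ and $(a,b)\in\mathbb Z^2$, the translate is $\tau_{a,b}f(e,c)=f(e-(a,b),c)$; sums of such maps are pointwise. A map has finite support if it is nonzero at only finitely many arguments. A tiling sum over $T$ is a sum $\sum_{i=1}^n\tau_{x_i,y_i}[\![t_i]\!]$ with $n\ge 0$, $x_i,y_i\in\mathbb Z$, $t_i\in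 T$ (repetitions of positions and tiles allowed). *)

theory Defs
  imports Main "HOL-Library.Nat_Bijection"
begin

datatype recf = Z | S | Proj nat | Cn recf "recf list" | Pr recf recf | Mn recf

inductive eval :: "recf \<Rightarrow> nat list \<Rightarrow> nat \<Rightarrow> bool" where
  eval_Z: "eval Z xs 0"
| eval_S: "eval S (x # xs) (Suc x)"
| eval_Proj: "i < length xs \<Longrightarrow> eval (Proj i) xs (xs ! i)"
| eval_Cn: "length ys = length gs \<Longrightarrow> (\<forall>i < length gs. eval (gs ! i) xs (ys ! i))
             \<Longrightarrow> eval f ys y \<Longrightarrow> eval (Cn f gs) xs y"
| eval_Pr0: "eval f xs y \<Longrightarrow> eval (Pr f g) (0 # xs) y"
| eval_PrS: "eval (Pr f g) (n # xs) y \<Longrightarrow> eval g (n # y # xs) z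
             \<Longrightarrow> eval (Pr f g) (Suc n # xs) z"
| eval_Mn: "eval f (n # xs) 0 \<Longrightarrow> (\<forall>m < n. \<exists>y. eval f (m # xs) (Suc y))
             \<Longrightarrow> eval (Mn f) xs n"

definition decidable :: "nat set \<Rightarrow> bool" where
  "decidable A \<longleftrightarrow> (\<exists>f. \<forall>n. eval f [n] (if n \<in> A then 0 else 1))"

type_synonym edge = "(int \<times> int) set"
type_synonym color = nat
type_synonym tile = "color \<times> color \<times> color \<times> color"  \<comment> \<open>(N, E, S, W)\<close>

definition grid_edges :: "edge set" where
  "grid_edges = {{(p, q), (r, s)} | p q r s. \<bar>p - r\<bar> + \<bar>q - s\<bar> = 1}"

definition edge_shift :: "edge \<Rightarrow> int \<Rightarrow> int \<Rightarrow> edge" where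
  "edge_shift e a b = (\<lambda>(x, y). (x + a, y + b)) ` e"

definition kdelta :: "color \<Rightarrow> color \<Rightarrow> int" where
  "kdelta a b = (if a = b then 1 else 0)"

fun tile_map :: "color \<Rightarrow> tile \<Rightarrow> edge \<Rightarrow> color \<Rightarrow> int" where
  "tile_map c0 (cN, cE, cS, cW) e c =
     (if e = {(0, 0), (1, 0)} \<and> c = cS then - (1 - kdelta cS c0) else 0)
   + (if e = {(1, 0), (1, 1)} \<and> c = cE then 1 - kdelta cE c0 else 0)
   + (if e = {(1, 1), (0, 1)} \<and> c = cN then 1 - kdelta cN c0 else 0)
   + (if e = {(0, 1), (0, 0)} \<and> c = cW then - (1 - kdelta cW c0) else 0)"

definition translate :: "int \<Rightarrow> int \<Rightarrow> (edge \<Rightarrow> color \<Rightarrow> int) \<Rightarrow> edge \<Rightarrow> color \<Rightarrow> int" where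
  "translate a b f e c = f (edge_shift e (- a) (- b)) c"

definition is_tiling_sum :: "color \<Rightarrow> tile set \<Rightarrow> (edge \<Rightarrow> color \<Rightarrow> int) \<Rightarrow> bool" where
  "is_tiling_sum c0 T f \<longleftrightarrow>
     (\<exists>ts :: (int \<times> int \<times> tile) list. (\<forall>(x, y, t) \<in> set ts. t \<in> T) \<and>
        f = (\<lambda>e c. \<Sum>(x, y, t) \<leftarrow> ts. translate x y (tile_map c0 t) e c))"

text \<open>An instance is a finite list of entries ((p,q,r,s), c, v) contributing value v
  at the edge {(p,q),(r,s)} and color c; it denotes the finitely supported map
  obtained by summing the entries.  Every finitely supported map on grid_edges \<times> C
  arises from a valid list.\<close>
type_synonym entry = "(int \<times> int \<times> int \<times> int) \<times> color \<times> int"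

definition valid_instance :: "color set \<Rightarrow> entry list \<Rightarrow> bool" where
  "valid_instance C xs \<longleftrightarrow>
     (\<forall>((p, q, r, s), c, v) \<in> set xs. \<bar>p - r\<bar> + \<bar>q - s\<bar> = 1 \<and> c \<in> C)"

definition instance_map :: "entry list \<Rightarrow> edge \<Rightarrow> color \<Rightarrow> int" where
  "instance_map xs e c =
     (\<Sum>((p, q, r, s), c', v) \<leftarrow> xs. if e = {(p, q), (r, s)} \<and> c = c' then v else 0)"

definition encode_entry :: "entry \<Rightarrow> nat" where
  "encode_entry ent = (case ent of ((p, q, r, s), c, v) \<Rightarrow>
     prod_encode (prod_encode (prod_encode (int_encode p, int_encode q),
                               prod_encode (int_encode r, int_encode s)),
                  prod_encode (c, int_encode v)))"

definition encode_instance :: "entry list \<Rightarrow> nat" where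
  "encode_instance xs = list_encode (map encode_entry xs)"

definition zero_tiling_sum_problem :: "color set \<Rightarrow> color \<Rightarrow> tile set \<Rightarrow> nat set" where
  "zero_tiling_sum_problem C c0 T =
     {encode_instance xs | xs. valid_instance C xs \<and>
        (\<exists>f. is_tiling_sum c0 T f \<and> (\<lambda>e c. instance_map xs e c + f e c) = (\<lambda>e c. 0))}"

end

(* A tile takes a token from its south and its west edge and passes one on to the north and the
   east, c0 standing for the absence of a token. Everything moves north and east, so a tiling sum
   that cancels f0 is a run in which the tokens of f0 are all consumed. If f0 puts at most one token
   on each edge of a horizontal line, the tokens of the consecutive lines form words, and each row of
   tiles is one pass of a fixed nondeterministic transducer over such a word. These passes execute a
   program: its text stands at the left end of the word, and the values of its (finitely many)
   counters are kept in unary behind it. Every recursive function h is computed by such a program.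
   The input n is given by the position of a single token, the program by the other tokens xs of f0,
   so that solvability of the instance n # xs means h(n) = 1. If the problem were decidable, there
   would be an h for which this fails when n is the code of xs itself. *)
theory Submission
  imports Defs "HOL-Library.Countable" "HOL-Library.Infinite_Set" "HOL-Library.Multiset"
    "HOL-Computational_Algebra.Primes"
begin

section \<open>Recursive functions\<close>

text \<open>A sum of tiles may pile several tiles on one cell, and the color \<open>c0\<close>
  leaves no trace in it; it describes a run only if such piling is made impossible. Hence two
  restrictions on the tiles: none lacks both inputs, and a tile without west input must stand on the
  left end marker. Then each cell holds at most one tile (\<open>cell_tiles\<close>). Signals travel
  east only, so a row has to announce the next instruction before it has seen the current one. The
  guess is free and may leave no star or several; such a row simply has no successor. As T is fixed,
  a data symbol can name only finitely many counters, whereas recursive functions need arbitrarily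
  many registers; Goedel numbers bring these down to three counters, and a fourth one holds the
  control state. Runs are treated throughout as sets of outcomes, so that divergence and a wrong
  guess both count as the absence of a result. The input is the position of a token because the
  diagonal argument then has to compute hardly more than one \<open>Cons\<close> of an encoded
  list.\<close>

lemma eval_deterministic: "eval f xs y \<Longrightarrow> eval f xs z \<Longrightarrow> y = z"
proof (induction arbitrary: z rule: eval.induct)
  case (eval_Z xs)
  then show ?case by (cases rule: eval.cases) auto
next
  case (eval_S x xs)
  then show ?case by (cases rule: eval.cases) auto
next
  case (eval_Proj i xs)
  from eval_Proj.prems show ?case by (cases rule: eval.cases) auto
next
  case (eval_Pr0 f xs y g)
  from eval_Pr0.prems have "eval f xs z" by (cases rule: eval.cases) auto
  then show ?case by (rule eval_Pr0.IH)
next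
  case (eval_Cn ys gs xs f y)
  from eval_Cn.prems obtain zs where zs: "length zs = length gs"
    "\<forall>i<length gs. eval (gs ! i) xs (zs ! i)" "eval f zs z"
    by (cases rule: eval.cases) auto
  have "ys = zs" using eval_Cn zs by (intro nth_equalityI) auto
  with eval_Cn.IH zs show ?case by auto
next
  case (eval_PrS f g n xs y z w)
  from eval_PrS.prems obtain y' where "eval (Pr f g) (n # xs) y'" "eval g (n # y' # xs) w"
    by (cases rule: eval.cases) auto
  with eval_PrS.IH show ?case by blast
next
  case (eval_Mn f n xs)
  from eval_Mn.prems have z: "eval f (z # xs) 0" "\<forall>m<z. \<exists>y. eval f (m # xs) (Suc y)"
    by (cases rule: eval.cases; simp)+
  \<comment> \<open>The smaller of two distinct candidates would need both the value 0 and a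
    positive value.\<close>
  show ?case
  proof (cases n z rule: linorder_cases)
    case less
    with z obtain y where "eval f (n # xs) (Suc y)" by blast
    with eval_Mn.IH(1) show ?thesis by force
  next
    case greater
    with eval_Mn.IH(2) z(1) show ?thesis by force
  qed
qed

text \<open>Total functions of one and two arguments are enough: all that has to be computed is the
  code of an instance from the code of its tail, in \<open>computable_cons_input\<close>.\<close>

definition computable1 :: "(nat \<Rightarrow> nat) \<Rightarrow> bool" where
  "computable1 F \<longleftrightarrow> (\<exists>f. \<forall>x. eval f [x] (F x))"

definition computable2 :: "(nat \<Rightarrow> nat \<Rightarrow> nat) \<Rightarrow> bool" where
  "computable2 F \<longleftrightarrow> (\<exists>f. \<forall>x y. eval f [x, y] (F x y))"

lemma computable1_comp:
  assumes "computable1 F" "computable1 G" shows "computable1 (\<lambda>x. F (G x))"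
proof -
  from assms obtain f g where "\<forall>x. eval f [x] (F x)" "\<forall>x. eval g [x] (G x)"
    unfolding computable1_def by blast
  then have "eval (Cn f [g]) [x] (F (G x))" for x
    by (intro eval_Cn[where ys = "[G x]"]) auto
  then show ?thesis unfolding computable1_def by blast
qed

lemma computable1_comp2:
  assumes "computable2 F" "computable1 G" "computable1 H"
  shows "computable1 (\<lambda>x. F (G x) (H x))"
proof -
  from assms obtain f g h where "\<forall>x y. eval f [x, y] (F x y)" "\<forall>x. eval g [x] (G x)"
    "\<forall>x. eval h [x] (H x)"
    unfolding computable1_def computable2_def by blast
  then have "eval (Cn f [g, h]) [x] (F (G x) (H x))" for x
    by (intro eval_Cn[where ys = "[G x, H x]"]) (auto simp: less_Suc_eq)
  then show ?thesis unfolding computable1_def by blast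
qed

lemma computable2_comp2:
  assumes "computable2 F" "computable2 G" "computable2 H"
  shows "computable2 (\<lambda>x y. F (G x y) (H x y))"
proof -
  from assms obtain f g h where "\<forall>x y. eval f [x, y] (F x y)" "\<forall>x y. eval g [x, y] (G x y)"
    "\<forall>x y. eval h [x, y] (H x y)"
    unfolding computable2_def by blast
  then have "eval (Cn f [g, h]) [x, y] (F (G x y) (H x y))" for x y
    by (intro eval_Cn[where ys = "[G x y, H x y]"]) (auto simp: less_Suc_eq)
  then show ?thesis unfolding computable2_def by blast
qed

lemma computable2_comp1:
  assumes "computable1 F" "computable2 G"
  shows "computable2 (\<lambda>x y. F (G x y))"
proof -
  from assms obtain f g where "\<forall>x. eval f [x] (F x)" "\<forall>x y. eval g [x, y] (G x y)"
    unfolding computable1_def computable2_def by blast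
  then have "eval (Cn f [g]) [x, y] (F (G x y))" for x y
    by (intro eval_Cn[where ys = "[G x y]"]) auto
  then show ?thesis unfolding computable2_def by blast
qed

lemma computable1_Suc: "computable1 Suc"
  unfolding computable1_def using eval_S by blast

lemma computable1_id: "computable1 (\<lambda>x. x)"
  unfolding computable1_def using eval_Proj[of 0 "[x]" for x] by auto

lemma computable1_const: "computable1 (\<lambda>_. k)"
proof (induction k)
  case 0
  show ?case unfolding computable1_def using eval_Z by blast
next
  case (Suc k)
  from computable1_comp[OF computable1_Suc Suc] show ?case .
qed

lemma computable2_fst: "computable2 (\<lambda>x y. x)"
  unfolding computable2_def using eval_Proj[of 0 "[x, y]" for x y] by auto

lemma computable2_snd: "computable2 (\<lambda>x y. y)"
  unfolding computable2_def using eval_Proj[of 1 "[x, y]" for x y] by auto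

lemma computable2_add: "computable2 (+)"
proof -
  have "eval (Pr (Proj 0) (Cn S [Proj 1])) [x, y] (x + y)" for x y
  proof (induction x)
    case 0
    show ?case using eval_Proj[of 0 "[y]"] by (auto intro: eval_Pr0)
  next
    case (Suc x)
    have "eval (Cn S [Proj 1]) [x, x + y, y] (Suc (x + y))"
      using eval_Proj[of 1 "[x, x + y, y]"]
      by (intro eval_Cn[where ys = "[x + y]"]) (auto intro: eval_S)
    with Suc show ?case by (auto intro: eval_PrS)
  qed
  then show ?thesis unfolding computable2_def by blast
qed

text \<open>\<open>prod_encode (m, n)\<close> is \<open>triangle (m + n) + m\<close>; besides
  addition this is the one ingredient of the pairing that takes a recursion.\<close>

lemma computable1_triangle: "computable1 triangle"
proof -
  obtain g where g: "\<And>x y. eval g [x, y] (y + Suc x)"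
    using computable2_comp2[OF computable2_add computable2_snd
        computable2_comp1[OF computable1_Suc computable2_fst]]
    unfolding computable2_def by blast
  have "eval (Pr Z g) [x] (triangle x)" for x
  proof (induction x)
    case 0
    show ?case by (auto intro: eval_Pr0 eval_Z)
  next
    case (Suc x)
    with g[of x "triangle x"] show ?case by (auto intro: eval_PrS)
  qed
  then show ?thesis unfolding computable1_def by blast
qed

lemma computable2_prod_encode: "computable2 (\<lambda>x y. prod_encode (x, y))"
  unfolding prod_encode_def split
  by (intro computable2_comp2[OF computable2_add] computable2_comp1[OF computable1_triangle]
      computable2_add computable2_fst)

text \<open>Nonnegative integers have the even codes, so a doubling suffices.\<close>

lemma computable1_int_encode: "computable1 (\<lambda>x. int_encode (int x))"
proof -
  have "int_encode (int x) = x + x" for x by (simp add: int_encode_def sum_encode_def)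
  then show ?thesis
    by (simp add: computable1_comp2[OF computable2_add computable1_id computable1_id])
qed

section \<open>Regular expressions over counter operations\<close>

text \<open>Control is nondeterministic: \<open>Star\<close> guesses the number of iterations, and
  later tests discard the wrong guesses. The outcomes form a set, which is empty if every run
  fails.\<close>

datatype 'a rx = Fail | One | Atom 'a | Seq "'a rx" "'a rx" | Alt "'a rx" "'a rx" | Star "'a rx"

fun run :: "('a \<Rightarrow> 's \<Rightarrow> 's set) \<Rightarrow> 'a rx \<Rightarrow> 's \<Rightarrow> 's set" where
  "run \<alpha> Fail s = {}"
| "run \<alpha> One s = {s}"
| "run \<alpha> (Atom a) s = \<alpha> a s"
| "run \<alpha> (Seq e f) s = (\<Union>t\<in>run \<alpha> e s. run \<alpha> f t)"
| "run \<alpha> (Alt e f) s = run \<alpha> e s \<union> run \<alpha> f s"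
| "run \<alpha> (Star e) s = {t. (\<lambda>x y. y \<in> run \<alpha> e x)\<^sup>*\<^sup>* s t}"

primrec seqs :: "'a rx list \<Rightarrow> 'a rx" where
  "seqs [] = One"
| "seqs (e # es) = Seq e (seqs es)"

primrec alts :: "'a rx list \<Rightarrow> 'a rx" where
  "alts [] = Fail"
| "alts (e # es) = Alt e (alts es)"

lemma run_alts: "run \<alpha> (alts es) s = (\<Union>e\<in>set es. run \<alpha> e s)"
  by (induction es) auto

lemma run_seqs_append: "run \<alpha> (seqs (es @ fs)) s = (\<Union>t\<in>run \<alpha> (seqs es) s. run \<alpha> (seqs fs) t)"
  by (induction es arbitrary: s) auto

datatype 'c action = Inc 'c | Dec 'c | Chk 'c

fun act :: "'c action \<Rightarrow> ('c \<Rightarrow> nat) \<Rightarrow> ('c \<Rightarrow> nat) set" where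
  "act (Inc c) v = {v(c := Suc (v c))}"
| "act (Dec c) v = (if v c = 0 then {} else {v(c := v c - 1)})"
| "act (Chk c) v = (if v c = 0 then {v} else {})"

abbreviation inc :: "'c \<Rightarrow> 'c action rx" where "inc c \<equiv> Atom (Inc c)"
abbreviation dec :: "'c \<Rightarrow> 'c action rx" where "dec c \<equiv> Atom (Dec c)"
abbreviation chk :: "'c \<Rightarrow> 'c action rx" where "chk c \<equiv> Atom (Chk c)"

text \<open>Every loop in the programs repeats a fixed exchange: remove \<open>d\<close>, then add \<open>e\<close>.\<close>

definition exchange :: "('c \<Rightarrow> nat) \<Rightarrow> ('c \<Rightarrow> nat) \<Rightarrow> ('c \<Rightarrow> nat) \<Rightarrow> ('c \<Rightarrow> nat) set" where
  "exchange d e v = (if \<forall>c. d c \<le> v c then {\<lambda>c. v c - d c + e c} else {})"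

text \<open>No round can use what earlier rounds have added, because no counter is both removed and
  added. So k rounds are possible exactly if the initial contents cover k times
  \<open>d\<close>.\<close>

lemma exchange_star:
  assumes disj: "\<And>c. d c = 0 \<or> e c = 0"
    and body: "\<And>v. run act b v = exchange d e v"
  shows "run act (Star b) v
    = (\<lambda>k c. v c - k * d c + k * e c) ` {k. \<forall>c. k * d c \<le> v c}" (is "_ = ?R")
proof (intro subset_antisym subsetI)
  fix w assume "w \<in> run act (Star b) v"
  then have "(\<lambda>x y. y \<in> exchange d e x)\<^sup>*\<^sup>* v w" by (simp add: body)
  then show "w \<in> ?R"
  proof induction
    case base
    show ?case by (rule image_eqI[of _ _ 0]) auto
  next
    case (step x y)
    then obtain k where k: "\<forall>c. k * d c \<le> v c" "x = (\<lambda>c. v c - k * d c + k * e c)" by blast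
    from step.hyps(2) have x: "\<forall>c. d c \<le> x c" and y: "y = (\<lambda>c. x c - d c + e c)"
      by (auto simp: exchange_def split: if_splits)
    have *: "Suc k * d c \<le> v c" for c
    proof (cases "d c = 0")
      case False
      then have "d c \<le> v c - k * d c" using x[rule_format, of c] disj[of c] k(2) by simp
      moreover have "k * d c \<le> v c" using k(1) by blast
      ultimately show ?thesis by simp
    qed simp
    have "y = (\<lambda>c. v c - Suc k * d c + Suc k * e c)"
      unfolding y k(2)
    proof
      fix c show "v c - k * d c + k * e c - d c + e c = v c - Suc k * d c + Suc k * e c"
        using disj[of c] *[of c] by auto
    qed
    with * show ?case by (intro image_eqI[of _ _ "Suc k"]) auto
  qed
next
  fix w assume "w \<in> ?R"
  then obtain k where k: "\<forall>c. k * d c \<le> v c" "w = (\<lambda>c. v c - k * d c + k * e c)" by blast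
  then have "(\<lambda>x y. y \<in> exchange d e x)\<^sup>*\<^sup>* v w"
  proof (induction k arbitrary: w)
    case 0
    then show ?case by simp
  next
    case (Suc k)
    let ?x = "\<lambda>c. v c - k * d c + k * e c"
    have le: "d c + k * d c \<le> v c" for c using Suc.prems(1) by simp
    have "\<forall>c. k * d c \<le> v c" using le by (meson add_leD2)
    then have "(\<lambda>x y. y \<in> exchange d e x)\<^sup>*\<^sup>* v ?x" by (rule Suc.IH) simp
    moreover have "w \<in> exchange d e ?x"
    proof -
      have "d c \<le> ?x c" for c using le[of c] by simp
      moreover have "w = (\<lambda>c. ?x c - d c + e c)"
        unfolding Suc.prems(2)
      proof
        fix c show "v c - Suc k * d c + Suc k * e c = v c - k * d c + k * e c - d c + e c"
          using disj[of c] le[of c] by auto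
      qed
      ultimately show ?thesis by (simp add: exchange_def)
    qed
    ultimately show ?case
      by (rule rtranclp.rtrancl_into_rtrancl[where r = "\<lambda>x y. y \<in> exchange d e x"])
  qed
  then show "w \<in> run act (Star b) v" by (simp add: body)
qed

text \<open>A zero test after a draining loop: of all guessed lengths k only the full one
  survives.\<close>

lemma UN_atMost_chk: "(\<Union>k\<le>n. if n - k = 0 then A k else {}) = A (n::nat)"
  by (auto split: if_splits)

definition clear :: "'c \<Rightarrow> 'c action rx" where
  "clear r = Seq (Star (dec r)) (chk r)"

lemma run_clear: "run act (clear r) v = {v(r := 0)}"
proof -
  have "run act (dec r) v = exchange ((\<lambda>_. 0)(r := 1)) (\<lambda>_. 0) v" for v :: "'a \<Rightarrow> nat"
    by (auto simp: exchange_def fun_eq_iff)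
  from exchange_star[OF _ this, of v]
  have "run act (Star (dec r)) v = (\<lambda>k c. v c - k * ((\<lambda>_. 0)(r := 1)) c) ` {..v r}"
    by (auto simp: image_def)
  also have "\<dots> = (\<lambda>k. v(r := v r - k)) ` {..v r}"
    by (intro image_cong) auto
  finally have star: "run act (Star (dec r)) v = (\<lambda>k. v(r := v r - k)) ` {..v r}" .
  have "run act (clear r) v = (\<Union>k\<le>v r. if v r - k = 0 then {v(r := v r - k)} else {})"
    unfolding clear_def run.simps(4) star image_image by (intro SUP_cong) auto
  then show ?thesis unfolding UN_atMost_chk by simp
qed

definition move :: "'c \<Rightarrow> 'c \<Rightarrow> 'c action rx" where
  "move r t = Seq (Star (Seq (dec r) (inc t))) (chk r)"

lemma run_move:
  assumes "r \<noteq> t"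
  shows "run act (move r t) v = {v(r := 0, t := v t + v r)}"
proof -
  have "run act (Seq (dec r) (inc t)) v
    = exchange ((\<lambda>_. 0)(r := 1)) ((\<lambda>_. 0)(t := 1)) v" for v :: "'a \<Rightarrow> nat"
    using assms by (auto simp: exchange_def fun_eq_iff)
  from exchange_star[OF _ this, of v] assms
  have "run act (Star (Seq (dec r) (inc t))) v
    = (\<lambda>k c. v c - k * ((\<lambda>_. 0)(r := 1)) c + k * ((\<lambda>_. 0)(t := 1)) c) ` {..v r}"
    by (auto simp: image_def)
  also have "\<dots> = (\<lambda>k. v(r := v r - k, t := v t + k)) ` {..v r}"
    using assms by (intro image_cong) auto
  finally have star: "run act (Star (Seq (dec r) (inc t))) v
    = (\<lambda>k. v(r := v r - k, t := v t + k)) ` {..v r}" .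
  have "run act (move r t) v
    = (\<Union>k\<le>v r. if v r - k = 0 then {v(r := v r - k, t := v t + k)} else {})"
    unfolding move_def run.simps(4)[of _ "Star _"] star image_image
    using assms by (intro SUP_cong) auto
  then show ?thesis unfolding UN_atMost_chk by simp
qed

text \<open>Reading a counter empties it, hence the second copy in \<open>u\<close>, from which
  \<open>r\<close> is refilled.\<close>

definition copy :: "'c \<Rightarrow> 'c \<Rightarrow> 'c \<Rightarrow> 'c action rx" where
  "copy r t u = Seq (Star (Seq (dec r) (Seq (inc t) (inc u)))) (Seq (chk r) (move u r))"

lemma run_copy:
  assumes "r \<noteq> t" "r \<noteq> u" "t \<noteq> u" "v u = 0"
  shows "run act (copy r t u) v = {v(t := v t + v r)}"
proof -
  have "run act (Seq (dec r) (Seq (inc t) (inc u))) v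
    = exchange ((\<lambda>_. 0)(r := 1)) ((\<lambda>_. 0)(t := 1, u := 1)) v" for v :: "'a \<Rightarrow> nat"
    using assms(1-3) by (auto simp: exchange_def fun_eq_iff)
  from exchange_star[OF _ this, of v] assms
  have "run act (Star (Seq (dec r) (Seq (inc t) (inc u)))) v
    = (\<lambda>k c. v c - k * ((\<lambda>_. 0)(r := 1)) c + k * ((\<lambda>_. 0)(t := 1, u := 1)) c) ` {..v r}"
    by (auto simp: image_def)
  also have "\<dots> = (\<lambda>k. v(r := v r - k, t := v t + k, u := v u + k)) ` {..v r}"
    using assms by (intro image_cong) auto
  finally have star: "run act (Star (Seq (dec r) (Seq (inc t) (inc u)))) v
    = (\<lambda>k. v(r := v r - k, t := v t + k, u := v u + k)) ` {..v r}" .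
  have "run act (copy r t u) v
    = (\<Union>k\<le>v r. if v r - k = 0 then {v(r := v u + k, t := v t + k, u := 0)} else {})"
    unfolding copy_def run.simps(4)[of _ "Star _"] star image_image
    using assms by (intro SUP_cong) (auto simp: run_move fun_eq_iff)
  then show ?thesis unfolding UN_atMost_chk using assms by (simp add: fun_eq_iff)
qed

lemma run_clears: "run act (seqs (map clear rs)) v = {\<lambda>r. if r \<in> set rs then 0 else v r}"
  by (induction rs arbitrary: v) (auto simp: run_clear)

section \<open>Compilation of recursive functions into register programs\<close>

text \<open>\<open>compile f rs t u\<close> writes the value of \<open>f\<close> at the contents of the registers \<open>rs\<close> to the empty
  register \<open>t\<close>, with all registers from \<open>u\<close> on free as scratch space.\<close>

fun compile :: "recf \<Rightarrow> nat list \<Rightarrow> nat \<Rightarrow> nat \<Rightarrow> nat action rx"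
  and compile_list :: "recf list \<Rightarrow> nat list \<Rightarrow> nat \<Rightarrow> nat \<Rightarrow> nat action rx" where
  "compile Z rs t u = One"
| "compile S rs t u = (case rs of [] \<Rightarrow> Fail | r # _ \<Rightarrow> Seq (copy r t u) (inc t))"
| "compile (Proj i) rs t u = (if i < length rs then copy (rs ! i) t u else Fail)"
| "compile (Cn f gs) rs t u = (let w = u + length gs in
     seqs [compile_list gs rs u w, compile f [u..<w] t w, seqs (map clear [u..<w])])"
| "compile (Pr f g) rs t u = (case rs of [] \<Rightarrow> Fail | n # xs \<Rightarrow>
     seqs [copy n u (u + 3), compile f xs (u + 2) (u + 4),
       Star (seqs [dec u, compile g ((u + 1) # (u + 2) # xs) (u + 3) (u + 4), clear (u + 2),
         move (u + 3) (u + 2), inc (u + 1)]),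
       chk u, move (u + 2) t, clear (u + 1)])"
| "compile (Mn f) rs t u =
     seqs [Star (seqs [compile f (u # rs) (u + 1) (u + 2), dec (u + 1), clear (u + 1), inc u]),
       compile f (u # rs) (u + 1) (u + 2), chk (u + 1), move u t]"
| "compile_list [] rs j w = One"
| "compile_list (g # gs) rs j w = Seq (compile g rs j w) (compile_list gs rs (Suc j) w)"

definition put :: "nat \<Rightarrow> nat list \<Rightarrow> (nat \<Rightarrow> nat) \<Rightarrow> nat \<Rightarrow> nat" where
  "put j ys v = (\<lambda>r. if j \<le> r \<and> r < j + length ys then ys ! (r - j) else v r)"

lemma put_Cons: "put j (y # ys) v = put (Suc j) ys (v(j := y))"
  by (auto simp: put_def fun_eq_iff nth_Cons' Suc_le_eq)

lemma run_Star_eqI: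
  assumes "\<And>w. (\<lambda>x y. y \<in> run \<alpha> e x)\<^sup>*\<^sup>* v w \<longleftrightarrow> w \<in> A"
  shows "run \<alpha> (Star e) v = A"
  using assms by auto

inductive_cases eval_ZE: "eval Z xs y"
inductive_cases eval_SE: "eval S xs y"
inductive_cases eval_ProjE: "eval (Proj i) xs y"
inductive_cases eval_Pr_NilE: "eval (Pr f g) [] y"

text \<open>An equality of sets, so that a program for an undefined value has no successful run. As
  the outcomes are \<open>v(t := y)\<close>, the arguments are preserved and the scratch registers
  come back empty, ready for reuse.\<close>

definition comp_correct :: "recf \<Rightarrow> bool" where
  "comp_correct f \<longleftrightarrow> (\<forall>rs t u v. set rs \<subseteq> {..<u} \<longrightarrow> t < u \<longrightarrow> t \<notin> set rs \<longrightarrow> v t = 0 \<longrightarrow> (\<forall>r\<ge>u. v r = 0) \<longrightarrow>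
     run act (compile f rs t u) v = (\<lambda>y. v(t := y)) ` {y. eval f (map v rs) y})"

lemma comp_correctD:
  "\<lbrakk>comp_correct f; set rs \<subseteq> {..<u}; t < u; t \<notin> set rs; v t = 0; \<forall>r\<ge>u. v r = 0\<rbrakk> \<Longrightarrow>
    run act (compile f rs t u) v = (\<lambda>y. v(t := y)) ` {y. eval f (map v rs) y}"
  unfolding comp_correct_def by blast

text \<open>During the loop \<open>u\<close> holds the number of rounds still to do,
  \<open>u + 1\<close> the number of rounds done, \<open>u + 2\<close> the current value, and
  \<open>u + 3\<close> receives the next value. \<open>st i y\<close> is the state after i rounds
  with current value y.\<close>

lemma run_comp_Pr:
  fixes v :: "nat \<Rightarrow> nat"
  assumes rs: "a < u" "set as \<subseteq> {..<u}" "t < u" "t \<noteq> a" "t \<notin> set as"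
    and v: "v t = 0" "\<forall>r\<ge>u. v r = 0"
    and f: "comp_correct f" and g: "comp_correct g"
  shows "run act (compile (Pr f g) (a # as) t u) v
    = (\<lambda>y. v(t := y)) ` {y. eval (Pr f g) (map v (a # as)) y}"
proof -
  define n xs where "n = v a" and "xs = map v as"
  define st where "st i y = v(u := n - i, u + 1 := i, u + 2 := y)" for i y
  define B where "B = seqs [dec u, compile g ((u + 1) # (u + 2) # as) (u + 3) (u + 4),
    clear (u + 2), move (u + 3) (u + 2), inc (u + 1)]"
  have as: "r \<in> set as \<Longrightarrow> r < u" for r using rs(2) by auto
  have mapas: "map (\<lambda>r. w r) as = xs" if "\<And>r. r < u \<Longrightarrow> w r = v r" for w :: "nat \<Rightarrow> nat"
    using that as by (auto simp: xs_def)
  have c1: "run act (copy a u (u + 3)) v = {v(u := n)}"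
    using rs v by (subst run_copy) (auto simp: n_def)
  have c2: "run act (compile f as (u + 2) (u + 4)) (v(u := n)) = (st 0) ` {y. eval f xs y}"
  proof -
    have "run act (compile f as (u + 2) (u + 4)) (v(u := n))
      = (\<lambda>y. (v(u := n))(u + 2 := y)) ` {y. eval f (map (v(u := n)) as) y}"
      using rs v as by (intro comp_correctD[OF f]) force+
    also have "map (v(u := n)) as = xs" by (rule mapas) simp
    also have "(\<lambda>y. (v(u := n))(u + 2 := y)) = st 0"
      using v by (auto simp: st_def fun_eq_iff)
    finally show ?thesis .
  qed
  have B: "run act B (st i y) = (if i < n then st (Suc i) ` {z. eval g (i # y # xs) z} else {})" for i y
  proof (cases "i < n")
    case True
    let ?w = "v(u := n - Suc i, u + 1 := i, u + 2 := y)"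
    have d: "run act (dec u) (st i y) = {?w}"
      using True by (auto simp: st_def fun_eq_iff)
    have "run act (compile g ((u + 1) # (u + 2) # as) (u + 3) (u + 4)) ?w
      = (\<lambda>z. ?w(u + 3 := z)) ` {z. eval g (map ?w ((u + 1) # (u + 2) # as)) z}"
      using rs v as by (intro comp_correctD[OF g]) force+
    also have "map ?w ((u + 1) # (u + 2) # as) = i # y # map ?w as" by simp
    also have "map ?w as = xs" by (rule mapas) simp
    finally have c: "run act (compile g ((u + 1) # (u + 2) # as) (u + 3) (u + 4)) ?w
      = (\<lambda>z. ?w(u + 3 := z)) ` {z. eval g (i # y # xs) z}" .
    have m: "run act (seqs [clear (u + 2), move (u + 3) (u + 2), inc (u + 1)]) (?w(u + 3 := z))
      = {st (Suc i) z}" for z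
      using v by (auto simp: run_clear run_move st_def fun_eq_iff)
    have "run act B (st i y) = (\<Union>x\<in>run act (dec u) (st i y).
      \<Union>w\<in>run act (compile g ((u + 1) # (u + 2) # as) (u + 3) (u + 4)) x.
        run act (seqs [clear (u + 2), move (u + 3) (u + 2), inc (u + 1)]) w)"
      by (simp add: B_def)
    also have "\<dots> = st (Suc i) ` {z. eval g (i # y # xs) z}"
      unfolding d UN_insert UN_empty Un_empty_right c image_image m by auto
    finally show ?thesis using True by simp
  next
    case False
    then have "run act (dec u) (st i y) = {}" by (simp add: st_def)
    with False show ?thesis by (simp add: B_def)
  qed
  \<comment> \<open>With \<open>complete\<close> below: the reachable loop states are the stages of
    the recursion, y being a value at i.\<close>
  have sound: "\<exists>i y. i \<le> n \<and> eval (Pr f g) (i # xs) y \<and> w = st i y"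
    if "(\<lambda>x y. y \<in> run act B x)\<^sup>*\<^sup>* (st 0 y0) w" "eval f xs y0" for w y0
    using that(1)
  proof induction
    case base
    show ?case using that(2) by (blast intro: eval_Pr0)
  next
    case (step x w)
    then obtain i y where iy: "eval (Pr f g) (i # xs) y" "x = st i y" by blast
    with step.hyps(2) obtain z where "i < n" "eval g (i # y # xs) z" "w = st (Suc i) z"
      by (auto simp: B split: if_splits)
    with iy(1) show ?case by (blast intro: eval_PrS Suc_leI)
  qed
  have complete: "\<exists>y0. eval f xs y0 \<and> (\<lambda>x y. y \<in> run act B x)\<^sup>*\<^sup>* (st 0 y0) (st i y)"
    if "eval (Pr f g) (i # xs) y" "i \<le> n" for i y
    using that
  proof (induction i arbitrary: y)
    case 0
    then have "eval f xs y" by (cases rule: eval.cases) auto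
    then show ?case by blast
  next
    case (Suc i)
    from Suc.prems(1) obtain z where z: "eval (Pr f g) (i # xs) z" "eval g (i # z # xs) y"
      by (cases rule: eval.cases) auto
    with Suc.IH[of z] Suc.prems(2) obtain y0 where
      y0: "eval f xs y0" "(\<lambda>x y. y \<in> run act B x)\<^sup>*\<^sup>* (st 0 y0) (st i z)" by auto
    have "st (Suc i) y \<in> run act B (st i z)" using z(2) Suc.prems(2) by (simp add: B)
    with y0 show ?case by (meson rtranclp.rtrancl_into_rtrancl)
  qed
  \<comment> \<open>Register \<open>u\<close> holds \<open>n - i\<close>, so among the stages
    \<open>i \<le> n\<close> the zero test lets only \<open>i = n\<close> through.\<close>
  have fin: "run act (seqs [chk u, move (u + 2) t, clear (u + 1)]) (st i y)
      = (if n \<le> i then {v(t := y)} else {})" for i y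
    using v rs by (auto simp: run_clear run_move st_def fun_eq_iff)
  have "run act (compile (Pr f g) (a # as) t u) v = (\<Union>x\<in>run act (copy a u (u + 3)) v.
      \<Union>w\<in>run act (compile f as (u + 2) (u + 4)) x. \<Union>z\<in>run act (Star B) w.
        run act (seqs [chk u, move (u + 2) t, clear (u + 1)]) z)"
    by (simp add: B_def)
  also have "\<dots> = (\<Union>y0\<in>{y. eval f xs y}. \<Union>z\<in>run act (Star B) (st 0 y0).
        run act (seqs [chk u, move (u + 2) t, clear (u + 1)]) z)"
    by (simp only: c1 c2 UN_insert UN_empty Un_empty_right) blast
  also have "\<dots> = (\<lambda>y. v(t := y)) ` {y. eval (Pr f g) (n # xs) y}"
  proof (intro subset_antisym subsetI)
    fix w assume "w \<in> (\<Union>y0\<in>{y. eval f xs y}. \<Union>z\<in>run act (Star B) (st 0 y0).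
        run act (seqs [chk u, move (u + 2) t, clear (u + 1)]) z)"
    then obtain y0 z where "eval f xs y0" "(\<lambda>x y. y \<in> run act B x)\<^sup>*\<^sup>* (st 0 y0) z"
      and w: "w \<in> run act (seqs [chk u, move (u + 2) t, clear (u + 1)]) z" by auto
    then obtain i y where "i \<le> n" "eval (Pr f g) (i # xs) y" "z = st i y" using sound by blast
    with w fin show "w \<in> (\<lambda>y. v(t := y)) ` {y. eval (Pr f g) (n # xs) y}"
      by (auto simp del: seqs.simps split: if_splits)
  next
    fix w assume "w \<in> (\<lambda>y. v(t := y)) ` {y. eval (Pr f g) (n # xs) y}"
    then obtain y where y: "eval (Pr f g) (n # xs) y" "w = v(t := y)" by blast
    with complete obtain y0 where "eval f xs y0" "(\<lambda>x y. y \<in> run act B x)\<^sup>*\<^sup>* (st 0 y0) (st n y)" by blast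
    moreover have "w \<in> run act (seqs [chk u, move (u + 2) t, clear (u + 1)]) (st n y)"
      unfolding fin using y by simp
    ultimately show "w \<in> (\<Union>y0\<in>{y. eval f xs y}. \<Union>z\<in>run act (Star B) (st 0 y0).
        run act (seqs [chk u, move (u + 2) t, clear (u + 1)]) z)"
      by (auto simp del: seqs.simps)
  qed
  finally show ?thesis by (simp add: n_def xs_def)
qed

text \<open>Register \<open>u\<close> holds the candidate m. A round can pass its \<open>dec\<close>
  only if the value at m is positive, and the test after the loop only if it is 0; this is the
  definition of the minimum.\<close>

lemma run_comp_Mn:
  fixes v :: "nat \<Rightarrow> nat"
  assumes rs: "set rs \<subseteq> {..<u}" "t < u" "t \<notin> set rs"
    and v: "v t = 0" "\<forall>r\<ge>u. v r = 0"
    and f: "comp_correct f"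
  shows "run act (compile (Mn f) rs t u) v = (\<lambda>y. v(t := y)) ` {y. eval (Mn f) (map v rs) y}"
proof -
  define xs where "xs = map v rs"
  define st where "st m = v(u := m)" for m
  define B where "B = seqs [compile f (u # rs) (u + 1) (u + 2), dec (u + 1), clear (u + 1), inc u]"
  have c: "run act (compile f (u # rs) (u + 1) (u + 2)) (st m)
    = (\<lambda>y. (st m)(u + 1 := y)) ` {y. eval f (m # xs) y}" for m
  proof -
    have "run act (compile f (u # rs) (u + 1) (u + 2)) (st m)
      = (\<lambda>y. (st m)(u + 1 := y)) ` {y. eval f (map (st m) (u # rs)) y}"
      using rs v by (intro comp_correctD[OF f]) (force simp: st_def)+
    moreover have "map (st m) (u # rs) = m # xs"
      using rs by (auto simp: st_def xs_def)
    ultimately show ?thesis by simp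
  qed
  have fin1: "run act (seqs [dec (u + 1), clear (u + 1), inc u]) ((st m)(u + 1 := y))
    = (if y = 0 then {} else {st (Suc m)})" for m y
    using v by (auto simp: run_clear st_def fun_eq_iff)
  have fin2: "run act (seqs [chk (u + 1), move u t]) ((st m)(u + 1 := y))
    = (if y = 0 then {v(t := m)} else {})" for m y
    using v rs by (auto simp: run_move st_def fun_eq_iff)
  have B: "run act B (st m) = (if \<exists>y. eval f (m # xs) (Suc y) then {st (Suc m)} else {})" for m
  proof -
    have "run act B (st m) = (\<Union>x\<in>run act (compile f (u # rs) (u + 1) (u + 2)) (st m).
      run act (seqs [dec (u + 1), clear (u + 1), inc u]) x)"
      by (simp add: B_def)
    also have "\<dots> = (\<Union>y\<in>{y. eval f (m # xs) y}. if y = 0 then {} else {st (Suc m)})"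
      unfolding c image_image fin1 ..
    also have "\<dots> = (if \<exists>y. eval f (m # xs) (Suc y) then {st (Suc m)} else {})"
    proof (cases "\<exists>y. eval f (m # xs) (Suc y)")
      case True
      then obtain z where "eval f (m # xs) (Suc z)" by blast
      then have "st (Suc m) \<in> (\<Union>y\<in>{y. eval f (m # xs) y}. if y = 0 then {} else {st (Suc m)})"
        by (intro UN_I[of "Suc z"]) auto
      moreover have "(\<Union>y\<in>{y. eval f (m # xs) y}. if y = 0 then {} else {st (Suc m)}) \<subseteq> {st (Suc m)}"
        by auto
      ultimately show ?thesis using True by auto
    next
      case False
      have "y = 0" if "eval f (m # xs) y" for y
        using that False by (cases y) auto
      with False show ?thesis by auto
    qed
    finally show ?thesis .
  qed
  have v0: "v = st 0" using v by (auto simp: st_def fun_eq_iff)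
  have star: "run act (Star B) v = st ` {m. \<forall>k<m. \<exists>y. eval f (k # xs) (Suc y)}"
  proof (rule run_Star_eqI, rule iffI)
    fix w assume "(\<lambda>x y. y \<in> run act B x)\<^sup>*\<^sup>* v w"
    then show "w \<in> st ` {m. \<forall>k<m. \<exists>y. eval f (k # xs) (Suc y)}"
    proof induction
      case base
      show ?case using v0 by auto
    next
      case (step x w)
      then obtain m where m: "\<forall>k<m. \<exists>y. eval f (k # xs) (Suc y)" "x = st m" by blast
      with step.hyps(2) have "\<exists>y. eval f (m # xs) (Suc y)" "w = st (Suc m)"
        by (auto simp: B split: if_splits)
      with m(1) show ?case by (auto simp: less_Suc_eq)
    qed
  next
    fix w assume "w \<in> st ` {m. \<forall>k<m. \<exists>y. eval f (k # xs) (Suc y)}"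
    then obtain m where m: "\<forall>k<m. \<exists>y. eval f (k # xs) (Suc y)" "w = st m" by blast
    from m(1) have "(\<lambda>x y. y \<in> run act B x)\<^sup>*\<^sup>* v (st m)"
    proof (induction m)
      case 0
      show ?case using v0 by simp
    next
      case (Suc m)
      then have "st (Suc m) \<in> run act B (st m)" by (auto simp: B)
      moreover have "(\<lambda>x y. y \<in> run act B x)\<^sup>*\<^sup>* v (st m)" using Suc by auto
      ultimately show ?case by (metis (mono_tags, lifting) rtranclp.rtrancl_into_rtrancl)
    qed
    with m(2) show "(\<lambda>x y. y \<in> run act B x)\<^sup>*\<^sup>* v w" by simp
  qed
  have "run act (compile (Mn f) rs t u) v = (\<Union>w\<in>run act (Star B) v.
      \<Union>x\<in>run act (compile f (u # rs) (u + 1) (u + 2)) w. run act (seqs [chk (u + 1), move u t]) x)"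
    by (simp add: B_def)
  also have "\<dots> = (\<Union>m\<in>{m. \<forall>k<m. \<exists>y. eval f (k # xs) (Suc y)}.
      \<Union>y\<in>{y. eval f (m # xs) y}. if y = 0 then {v(t := m)} else {})"
    unfolding star c image_image fin2 ..
  also have "\<dots> = (\<lambda>y. v(t := y)) ` {y. eval (Mn f) xs y}"
  proof (intro subset_antisym subsetI)
    fix w assume "w \<in> (\<Union>m\<in>{m. \<forall>k<m. \<exists>y. eval f (k # xs) (Suc y)}.
      \<Union>y\<in>{y. eval f (m # xs) y}. if y = 0 then {v(t := m)} else {})"
    then show "w \<in> (\<lambda>y. v(t := y)) ` {y. eval (Mn f) xs y}"
      by (auto split: if_splits intro: eval_Mn)
  next
    fix w assume "w \<in> (\<lambda>y. v(t := y)) ` {y. eval (Mn f) xs y}"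
    then obtain m where m: "eval (Mn f) xs m" "w = v(t := m)" by blast
    from m(1) have "eval f (m # xs) 0" "\<forall>k<m. \<exists>y. eval f (k # xs) (Suc y)"
      by (cases rule: eval.cases; simp)+
    with m(2) show "w \<in> (\<Union>m\<in>{m. \<forall>k<m. \<exists>y. eval f (k # xs) (Suc y)}.
      \<Union>y\<in>{y. eval f (m # xs) y}. if y = 0 then {v(t := m)} else {})" by force
  qed
  finally show ?thesis by (simp add: xs_def)
qed

text \<open>Each result goes to the next free register \<open>j\<close>, above all arguments in
  \<open>rs\<close>, so the later functions still see the same arguments.\<close>

lemma run_comps:
  assumes "\<And>g. g \<in> set gs \<Longrightarrow> comp_correct g"
    and "set rs \<subseteq> {..<j}" "j + length gs \<le> w" "\<forall>r\<ge>j. v r = 0"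
  shows "run act (compile_list gs rs j w) v
    = (\<lambda>ys. put j ys v) ` {ys. list_all2 (\<lambda>g. eval g (map v rs)) gs ys}"
  using assms
proof (induction gs arbitrary: j v)
  case Nil
  show ?case by (auto simp: put_def fun_eq_iff)
next
  case (Cons g gs)
  have j: "r \<in> set rs \<Longrightarrow> r < j" for r using Cons.prems(2) by auto
  have g: "run act (compile g rs j w) v = (\<lambda>y. v(j := y)) ` {y. eval g (map v rs) y}"
    using Cons.prems by (intro comp_correctD) auto
  have gs: "run act (compile_list gs rs (Suc j) w) (v(j := y))
    = (\<lambda>ys. put (Suc j) ys (v(j := y))) ` {ys. list_all2 (\<lambda>g. eval g (map v rs)) gs ys}" for y
  proof -
    have m: "map (v(j := y)) rs = map v rs" using j by auto
    have "set rs \<subseteq> {..<Suc j}" using Cons.prems(2) by auto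
    then show ?thesis
      using Cons.prems by (subst Cons.IH) (auto simp: m)
  qed
  have "run act (compile_list (g # gs) rs j w) v
    = (\<Union>y\<in>{y. eval g (map v rs) y}. (\<lambda>ys. put j (y # ys) v) ` {ys. list_all2 (\<lambda>g. eval g (map v rs)) gs ys})"
    by (simp add: g gs image_image put_Cons)
  also have "\<dots> = (\<lambda>ys. put j ys v) ` {ys. list_all2 (\<lambda>g. eval g (map v rs)) (g # gs) ys}"
    unfolding list_all2_Cons1 by blast
  finally show ?case .
qed

lemma run_comp_Cn:
  fixes v :: "nat \<Rightarrow> nat"
  assumes rs: "set rs \<subseteq> {..<u}" "t < u" "t \<notin> set rs"
    and v: "v t = 0" "\<forall>r\<ge>u. v r = 0"
    and gs: "\<And>g. g \<in> set gs \<Longrightarrow> comp_correct g"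
    and f: "comp_correct f"
  shows "run act (compile (Cn f gs) rs t u) v = (\<lambda>y. v(t := y)) ` {y. eval (Cn f gs) (map v rs) y}"
proof -
  define w xs where "w = u + length gs" and "xs = map v rs"
  have c1: "run act (compile_list gs rs u w) v = (\<lambda>ys. put u ys v) ` {ys. list_all2 (\<lambda>g. eval g xs) gs ys}"
    using rs v by (subst run_comps[OF gs]) (auto simp: w_def xs_def)
  have c2: "(\<Union>x\<in>run act (compile f [u..<w] t w) (put u ys v). run act (seqs (map clear [u..<w])) x)
    = (\<lambda>y. v(t := y)) ` {y. eval f ys y}" if "length ys = length gs" for ys
  proof -
    have "run act (compile f [u..<w] t w) (put u ys v)
      = (\<lambda>y. (put u ys v)(t := y)) ` {y. eval f (map (put u ys v) [u..<w]) y}"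
      using rs v that by (intro comp_correctD[OF f]) (auto simp: put_def w_def)
    moreover have "map (put u ys v) [u..<w] = ys"
      using that by (intro nth_equalityI) (auto simp: put_def w_def)
    moreover have "run act (seqs (map clear [u..<w])) ((put u ys v)(t := y)) = {v(t := y)}" for y
      using rs v that by (auto simp: run_clears put_def fun_eq_iff w_def)
    ultimately show ?thesis by auto
  qed
  have "run act (compile (Cn f gs) rs t u) v = (\<Union>z\<in>run act (compile_list gs rs u w) v.
    \<Union>x\<in>run act (compile f [u..<w] t w) z. run act (seqs (map clear [u..<w])) x)"
    by (simp add: w_def Let_def del: upt_Suc)
  also have "\<dots> = (\<Union>ys\<in>{ys. list_all2 (\<lambda>g. eval g xs) gs ys}. (\<lambda>y. v(t := y)) ` {y. eval f ys y})"
    unfolding c1 image_image by (intro SUP_cong[OF refl] c2) (auto dest: list_all2_lengthD)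
  also have "\<dots> = (\<lambda>y. v(t := y)) ` {y. eval (Cn f gs) xs y}"
  proof (intro subset_antisym subsetI)
    fix x assume "x \<in> (\<Union>ys\<in>{ys. list_all2 (\<lambda>g. eval g xs) gs ys}. (\<lambda>y. v(t := y)) ` {y. eval f ys y})"
    then show "x \<in> (\<lambda>y. v(t := y)) ` {y. eval (Cn f gs) xs y}"
      using eval_Cn[of _ gs xs f] by (auto simp: list_all2_conv_all_nth)
  next
    fix x assume "x \<in> (\<lambda>y. v(t := y)) ` {y. eval (Cn f gs) xs y}"
    then obtain y where y: "eval (Cn f gs) xs y" "x = v(t := y)" by blast
    from y(1) obtain ys where "length ys = length gs" "\<forall>i<length gs. eval (gs ! i) xs (ys ! i)"
      and f: "eval f ys y"
      by (cases rule: eval.cases) auto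
    then have "list_all2 (\<lambda>g. eval g xs) gs ys" by (simp add: list_all2_conv_all_nth)
    with y(2) f show "x \<in> (\<Union>ys\<in>{ys. list_all2 (\<lambda>g. eval g xs) gs ys}. (\<lambda>y. v(t := y)) ` {y. eval f ys y})"
      by blast
  qed
  finally show ?thesis by (simp add: xs_def)
qed

lemma comp_correct: "comp_correct f"
proof (induction f)
  case Z
  have "{y. eval Z xs y} = {0}" for xs by (auto elim: eval_ZE intro: eval_Z)
  then show ?case unfolding comp_correct_def by (auto simp: fun_upd_idem)
next
  case S
  show ?case
    unfolding comp_correct_def
  proof (intro allI impI)
    fix rs t u and v :: "nat \<Rightarrow> nat"
    assume *: "set rs \<subseteq> {..<u}" "t < u" "t \<notin> set rs" "v t = 0" "\<forall>r\<ge>u. v r = 0"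
    show "run act (compile S rs t u) v = (\<lambda>y. v(t := y)) ` {y. eval S (map v rs) y}"
    proof (cases rs)
      case Nil
      then have "{y. eval S (map v rs) y} = {}" by (auto elim: eval_SE)
      with Nil show ?thesis by simp
    next
      case (Cons r xs)
      then have "{y. eval S (map v rs) y} = {Suc (v r)}" by (auto elim: eval_SE intro: eval_S)
      with Cons * show ?thesis by (auto simp: run_copy)
    qed
  qed
next
  case (Proj i)
  show ?case
    unfolding comp_correct_def
  proof (intro allI impI)
    fix rs t u and v :: "nat \<Rightarrow> nat"
    assume *: "set rs \<subseteq> {..<u}" "t < u" "t \<notin> set rs" "v t = 0" "\<forall>r\<ge>u. v r = 0"
    show "run act (compile (Proj i) rs t u) v = (\<lambda>y. v(t := y)) ` {y. eval (Proj i) (map v rs) y}"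
    proof (cases "i < length rs")
      case True
      then have "{y. eval (Proj i) (map v rs) y} = {v (rs ! i)}"
        using eval_Proj[of i "map v rs"] by (auto elim: eval_ProjE)
      moreover have "rs ! i < u" "rs ! i \<noteq> t" using * nth_mem[OF True] by auto
      ultimately show ?thesis using True * by (auto simp: run_copy)
    next
      case False
      then have "{y. eval (Proj i) (map v rs) y} = {}" by (auto elim: eval_ProjE)
      with False show ?thesis by simp
    qed
  qed
next
  case (Cn f gs)
  then show ?case unfolding comp_correct_def[of "Cn f gs"] by - (intro allI impI, rule run_comp_Cn; simp)
next
  case (Pr f g)
  show ?case
    unfolding comp_correct_def
  proof (intro allI impI)
    fix rs t u and v :: "nat \<Rightarrow> nat"
    assume *: "set rs \<subseteq> {..<u}" "t < u" "t \<notin> set rs" "v t = 0" "\<forall>r\<ge>u. v r = 0"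
    show "run act (compile (Pr f g) rs t u) v = (\<lambda>y. v(t := y)) ` {y. eval (Pr f g) (map v rs) y}"
    proof (cases rs)
      case Nil
      then have "{y. eval (Pr f g) (map v rs) y} = {}" by (auto elim: eval_Pr_NilE)
      with Nil show ?thesis by simp
    next
      case (Cons a as)
      with * Pr.IH show ?thesis by (simp only: Cons) (rule run_comp_Pr; simp)
    qed
  qed
next
  case (Mn f)
  then show ?case unfolding comp_correct_def[of "Mn f"] by - (intro allI impI, rule run_comp_Mn; simp)
qed

section \<open>Three counters instead of unboundedly many\<close>

primrec rsubst :: "('a \<Rightarrow> 'b rx) \<Rightarrow> 'a rx \<Rightarrow> 'b rx" where
  "rsubst \<sigma> Fail = Fail"
| "rsubst \<sigma> One = One"
| "rsubst \<sigma> (Atom a) = \<sigma> a"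
| "rsubst \<sigma> (Seq e f) = Seq (rsubst \<sigma> e) (rsubst \<sigma> f)"
| "rsubst \<sigma> (Alt e f) = Alt (rsubst \<sigma> e) (rsubst \<sigma> f)"
| "rsubst \<sigma> (Star e) = Star (rsubst \<sigma> e)"

text \<open>The equality for atoms says that a simulated action leads from encoded states to encoded
  states only; this is what lets simulated actions be chained, in particular under
  \<open>Star\<close>.\<close>

lemma run_rsubst:
  assumes "\<And>a s. a \<in> set_rx e \<Longrightarrow> run \<beta> (\<sigma> a) (en s) = en ` \<alpha> a s"
  shows "run \<beta> (rsubst \<sigma> e) (en s) = en ` run \<alpha> e s"
  using assms
proof (induction e arbitrary: s)
  case (Seq e f)
  then have e: "run \<beta> (rsubst \<sigma> e) (en s) = en ` run \<alpha> e s"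
    and f: "run \<beta> (rsubst \<sigma> f) (en t) = en ` run \<alpha> f t" for s t by simp_all
  show ?case by (auto simp: e f)
next
  case (Star e)
  then have e: "run \<beta> (rsubst \<sigma> e) (en s) = en ` run \<alpha> e s" for s by simp
  let ?R = "\<lambda>x y. y \<in> run \<alpha> e x" and ?Q = "\<lambda>x y. y \<in> run \<beta> (rsubst \<sigma> e) x"
  have "?Q\<^sup>*\<^sup>* (en s) w \<longleftrightarrow> (\<exists>t. ?R\<^sup>*\<^sup>* s t \<and> w = en t)" for w
  proof
    assume "?Q\<^sup>*\<^sup>* (en s) w"
    then show "\<exists>t. ?R\<^sup>*\<^sup>* s t \<and> w = en t"
    proof induction
      case (step x y)
      then obtain t where t: "?R\<^sup>*\<^sup>* s t" "x = en t" by blast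
      with step.hyps(2) e obtain t' where "t' \<in> run \<alpha> e t" "y = en t'" by auto
      with t(1) show ?case
        using rtranclp.rtrancl_into_rtrancl[where r = ?R] by metis
    qed auto
  next
    assume "\<exists>t. ?R\<^sup>*\<^sup>* s t \<and> w = en t"
    then obtain t where t: "?R\<^sup>*\<^sup>* s t" "w = en t" by blast
    from t(1) have "?Q\<^sup>*\<^sup>* (en s) (en t)"
    proof induction
      case (step x y)
      then have "?Q (en x) (en y)" by (simp add: e)
      with step.IH show ?case by (rule rtranclp.rtrancl_into_rtrancl[where r = ?Q])
    qed simp
    with t(2) show "?Q\<^sup>*\<^sup>* (en s) w" by simp
  qed
  then show ?case by auto
qed auto

datatype dctr = RA | RB | RC

text \<open>Register 0 is kept in \<open>RC\<close>, the others as exponents in a Goedel number in \<open>RA\<close>;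
  \<open>RB\<close> is empty between two simulated operations.\<close>

definition prm :: "nat \<Rightarrow> nat" where
  "prm i = enumerate {p. prime p} i"

lemma prime_prm: "prime (prm i)"
  using enumerate_in_set[OF primes_infinite, of i] by (simp add: prm_def)

lemma prm_inj: "prm i = prm j \<longleftrightarrow> i = j"
  unfolding prm_def using strict_mono_enumerate[OF primes_infinite] by (simp add: strict_mono_eq)

lemma prm_pos: "0 < prm i"
  using prime_prm prime_gt_0_nat by blast

text \<open>Register 0 holds the input, which arrives in unary. Keeping it out of the product makes
  the initial Goedel number independent of the input. The bound \<open>k\<close> exceeds all
  registers that the simulated program mentions.\<close>

definition godel :: "nat \<Rightarrow> (nat \<Rightarrow> nat) \<Rightarrow> nat" where
  "godel k v = (\<Prod>i\<in>{1..<k}. prm i ^ v i)"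

lemma godel_Suc:
  assumes "0 < i" "i < k" shows "godel k (v(i := Suc (v i))) = prm i * godel k v"
proof -
  have i: "i \<in> {1..<k}" using assms by auto
  have "(\<Prod>j\<in>{1..<k} - {i}. prm j ^ (v(i := Suc (v i))) j) = (\<Prod>j\<in>{1..<k} - {i}. prm j ^ v j)"
    by (intro prod.cong) auto
  moreover have "godel k w = prm i ^ w i * (\<Prod>j\<in>{1..<k} - {i}. prm j ^ w j)" for w
    unfolding godel_def by (rule prod.remove[OF _ i]) simp
  ultimately show ?thesis by simp
qed

lemma prm_dvd_godel:
  assumes "0 < i" "i < k" shows "prm i dvd godel k v \<longleftrightarrow> 0 < v i"
proof
  assume "prm i dvd godel k v"
  then obtain j where "j \<in> {1..<k}" "prm i dvd prm j ^ v j"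
    unfolding godel_def using prime_prm[of i] by (auto simp: prime_dvd_prod_iff)
  then have "prm i dvd prm j" and "0 < v j"
    using prime_dvd_power[OF prime_prm] prime_gt_1_nat[OF prime_prm[of i]]
    by (auto intro!: gr0I)
  moreover from this(1) have "i = j"
    using primes_dvd_imp_eq[OF prime_prm prime_prm] prm_inj by simp
  ultimately show "0 < v i" by simp
next
  assume "0 < v i"
  then have "prm i dvd prm i ^ v i" by (simp add: dvd_power)
  also have "\<dots> dvd godel k v" unfolding godel_def using assms by (intro dvd_prodI) auto
  finally show "prm i dvd godel k v" .
qed

definition rep :: "nat \<Rightarrow> 'a rx \<Rightarrow> 'a rx" where
  "rep n e = seqs (replicate n e)"

lemma run_rep_inc: "run act (rep n (inc c)) v = {v(c := v c + n)}"
  by (induction n arbitrary: v) (auto simp: rep_def)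

lemma run_rep_dec: "run act (rep n (dec c)) v = (if n \<le> v c then {v(c := v c - n)} else {})"
proof (induction n arbitrary: v)
  case (Suc n)
  have "run act (rep (Suc n) (dec c)) v = (\<Union>w\<in>act (Dec c) v. run act (rep n (dec c)) w)"
    by (simp add: rep_def)
  then show ?case by (auto simp: Suc)
qed (simp add: rep_def)

text \<open>Moves the contents of \<open>a\<close> to \<open>b\<close> at the exchange rate q / p:
  \<open>p = 1\<close> multiplies, \<open>q = 1\<close> divides, and \<open>p = q\<close> moves
  multiples of p unchanged.\<close>

definition xfer :: "'c \<Rightarrow> nat \<Rightarrow> 'c \<Rightarrow> nat \<Rightarrow> 'c action rx" where
  "xfer a p b q = Star (Seq (rep p (dec a)) (rep q (inc b)))"

lemma run_xfer:
  assumes "a \<noteq> b"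
  shows "run act (xfer a p b q) v = (\<lambda>k. v(a := v a - k * p, b := v b + k * q)) ` {k. k * p \<le> v a}"
proof -
  have "run act (Seq (rep p (dec a)) (rep q (inc b))) v
    = exchange ((\<lambda>_. 0)(a := p)) ((\<lambda>_. 0)(b := q)) v" for v :: "'a \<Rightarrow> nat"
    using assms by (auto simp: exchange_def run_rep_dec run_rep_inc fun_eq_iff)
  from exchange_star[OF _ this, of v] assms
  have "run act (xfer a p b q) v
    = (\<lambda>k c. v c - k * ((\<lambda>_. 0)(a := p)) c + k * ((\<lambda>_. 0)(b := q)) c) ` {k. k * p \<le> v a}"
    unfolding xfer_def by auto
  also have "\<dots> = (\<lambda>k. v(a := v a - k * p, b := v b + k * q)) ` {k. k * p \<le> v a}"
    using assms by (intro image_cong) auto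
  finally show ?thesis .
qed

text \<open>\<open>Inc\<close> multiplies and \<open>Dec\<close> divides the Goedel number by the
  prime of the register; the test of \<open>RA\<close> ensures that the division leaves no
  remainder. For \<open>Chk\<close> a remainder between 1 and \<open>prm i - 1\<close> has to be
  exhibited.\<close>

primrec gact :: "nat action \<Rightarrow> dctr action rx" where
  "gact (Inc i) = (if i = 0 then inc RC
     else seqs [xfer RA 1 RB (prm i), chk RA, move RB RA])"
| "gact (Dec i) = (if i = 0 then dec RC
     else seqs [xfer RA (prm i) RB 1, chk RA, move RB RA])"
| "gact (Chk i) = (if i = 0 then chk RC
     else seqs [xfer RA (prm i) RB (prm i), alts (map (\<lambda>r. Seq (rep r (dec RA)) (rep r (inc RB))) [1..<prm i]),
       chk RA, move RB RA])"

definition genc :: "nat \<Rightarrow> (nat \<Rightarrow> nat) \<Rightarrow> dctr \<Rightarrow> nat" where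
  "genc k v = (\<lambda>c. case c of RA \<Rightarrow> godel k v | RB \<Rightarrow> 0 | RC \<Rightarrow> v 0)"

lemma godel_upd0 [simp]: "godel k (v(0 := x)) = godel k v"
  unfolding godel_def by (intro prod.cong) auto

lemma run_gact:
  assumes "set_action a \<subseteq> {..<k}"
  shows "run act (gact a) (genc k v) = genc k ` act a v"
proof (cases "set_action a = {0}")
  case True
  then show ?thesis
    by (cases a) (auto simp: genc_def fun_eq_iff split: dctr.split)
next
  case False
  define D where "D A B = (\<lambda>c. case c of RA \<Rightarrow> A | RB \<Rightarrow> B | RC \<Rightarrow> v 0)" for A B :: nat
  have genc: "genc k v = D (godel k v) 0" by (simp add: genc_def D_def)
  have x: "run act (xfer RA p RB q) (D A B) = (\<lambda>j. D (A - j * p) (B + j * q)) ` {j. j * p \<le> A}" for p q A B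
    unfolding run_xfer[of RA RB, simplified]
    by (intro image_cong) (auto simp: D_def fun_eq_iff split: dctr.split)
  have fin: "run act (Seq (chk RA) (move RB RA)) (D A B) = (if A = 0 then {D B 0} else {})" for A B
    by (auto simp: run_move D_def fun_eq_iff split: dctr.split)
  show ?thesis
  proof (cases a)
    case (Inc i)
    with False assms have i: "0 < i" "i < k" by auto
    have "run act (gact a) (genc k v)
      = (\<Union>w\<in>run act (xfer RA 1 RB (prm i)) (genc k v). run act (Seq (chk RA) (move RB RA)) w)"
      using i Inc by simp
    also have "\<dots> = (\<Union>j\<in>{j. j * 1 \<le> godel k v}. if godel k v - j * 1 = 0 then {D (0 + j * prm i) 0} else {})"
      unfolding genc x image_image fin ..
    also have "\<dots> = {D (godel k v * prm i) 0}" by (auto split: if_splits)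
    also have "\<dots> = genc k ` act a v"
      using i by (simp add: Inc godel_Suc genc_def D_def mult.commute)
    finally show ?thesis .
  next
    case (Dec i)
    with False assms have i: "0 < i" "i < k" by auto
    have "run act (gact a) (genc k v)
      = (\<Union>w\<in>run act (xfer RA (prm i) RB 1) (genc k v). run act (Seq (chk RA) (move RB RA)) w)"
      using i Dec by simp
    also have "\<dots> = (\<Union>j\<in>{j. j * prm i \<le> godel k v}. if godel k v - j * prm i = 0 then {D (0 + j * 1) 0} else {})"
      unfolding genc x image_image fin ..
    also have "\<dots> = (\<Union>j\<in>{j. godel k v = j * prm i}. {D j 0})" by (auto split: if_splits)
    also have "\<dots> = genc k ` act a v"
    proof (cases "v i")
      case 0
      then have "\<not> prm i dvd godel k v" using prm_dvd_godel[OF i, of v] by simp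
      then have "{j. godel k v = j * prm i} = {}" by auto
      with Dec 0 show ?thesis by simp
    next
      case (Suc n)
      have *: "(v(i := n))(i := Suc ((v(i := n)) i)) = v" using Suc by auto
      have "godel k v = prm i * godel k (v(i := n))" using godel_Suc[OF i, of "v(i := n)"] unfolding * .
      then have "{j. godel k v = j * prm i} = {godel k (v(i := n))}" using prm_pos[of i] by auto
      then show ?thesis using Dec Suc i by (simp add: genc_def D_def)
    qed
    finally show ?thesis .
  next
    case (Chk i)
    with False assms have i: "0 < i" "i < k" by auto
    let ?alts = "alts (map (\<lambda>r. Seq (rep r (dec RA)) (rep r (inc RB))) [1..<prm i])"
    have al: "run act ?alts (D A B) = (\<Union>r\<in>{1..<prm i}. if r \<le> A then {D (A - r) (B + r)} else {})" for A B
      by (auto simp: run_alts run_rep_dec run_rep_inc D_def fun_eq_iff split: dctr.split if_splits)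
    have "run act (gact a) (genc k v)
      = (\<Union>w\<in>run act (xfer RA (prm i) RB (prm i)) (genc k v). \<Union>z\<in>run act ?alts w. run act (Seq (chk RA) (move RB RA)) z)"
      using i Chk by simp
    also have "\<dots> = (\<Union>j\<in>{j. j * prm i \<le> godel k v}. \<Union>z\<in>(\<Union>r\<in>{1..<prm i}.
        if r \<le> godel k v - j * prm i then {D (godel k v - j * prm i - r) (0 + j * prm i + r)} else {}).
        run act (Seq (chk RA) (move RB RA)) z)"
      unfolding genc x image_image al ..
    also have "\<dots> = (\<Union>j\<in>{j. j * prm i \<le> godel k v}. \<Union>r\<in>{1..<prm i}.
        if godel k v = j * prm i + r then {D (godel k v) 0} else {})"
    proof -
      have "(\<Union>z\<in>(if r \<le> G - j * prm i then {D (G - j * prm i - r) (0 + j * prm i + r)} else {}).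
          run act (Seq (chk RA) (move RB RA)) z) = (if G = j * prm i + r then {D G 0} else {})"
        if "j * prm i \<le> G" for j r G
        using that by (auto simp: fin simp del: run.simps)
      then show ?thesis unfolding UN_UN_flatten by (intro SUP_cong[OF refl]) blast
    qed
    \<comment> \<open>Division with a nonzero remainder: such j and r exist exactly if the prime
      does not divide the Goedel number.\<close>
    also have "\<dots> = (\<Union>j. \<Union>r\<in>{r. 1 \<le> r \<and> r < prm i \<and> godel k v = j * prm i + r}. {D (godel k v) 0})"
      by (auto split: if_splits) (blast, use le_add1 in blast)
    also have "\<dots> = genc k ` act a v"
    proof (cases "v i")
      case 0
      then have "\<not> prm i dvd godel k v" using prm_dvd_godel[OF i, of v] by simp
      then have "1 \<le> godel k v mod prm i" "godel k v mod prm i < prm i"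
        using prm_pos[of i] by (auto simp: dvd_eq_mod_eq_0 Suc_le_eq)
      moreover have "godel k v = godel k v div prm i * prm i + godel k v mod prm i" by simp
      ultimately have "(\<Union>j. \<Union>r\<in>{r. 1 \<le> r \<and> r < prm i \<and> godel k v = j * prm i + r}. {D (godel k v) 0})
        = {D (godel k v) 0}" by blast
      then show ?thesis using Chk 0 by (simp add: genc)
    next
      case (Suc n)
      then have "prm i dvd godel k v" using prm_dvd_godel[OF i, of v] by simp
      then have "r = 0" if "r < prm i" "godel k v = j * prm i + r" for j r
        using that by (metis dvd_add_right_iff dvd_triv_right nat_dvd_not_less neq0_conv)
      then have "(\<Union>j. \<Union>r\<in>{r. 1 \<le> r \<and> r < prm i \<and> godel k v = j * prm i + r}. {D (godel k v) 0}) = {}"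
        by (auto simp: Suc_le_eq)
      then show ?thesis using Chk Suc by simp
    qed
    finally show ?thesis .
  qed
qed

section \<open>From expressions to a list of rules\<close>

text \<open>The states of the automaton for \<open>e\<close> are continuations: lists of expressions still to be run.\<close>

fun transitions :: "'a rx \<Rightarrow> 'a rx list \<Rightarrow> ('a rx list \<times> 'a option \<times> 'a rx list) set" where
  "transitions Fail k = {}"
| "transitions One k = {(One # k, None, k)}"
| "transitions (Atom a) k = {(Atom a # k, Some a, k)}"
| "transitions (Seq e f) k = {(Seq e f # k, None, e # f # k)} \<union> transitions e (f # k) \<union> transitions f k"
| "transitions (Alt e f) k = {(Alt e f # k, None, e # k), (Alt e f # k, None, f # k)} \<union> transitions e k \<union> transitions f k"
| "transitions (Star e) k = {(Star e # k, None, k), (Star e # k, None, e # Star e # k)} \<union> transitions e (Star e # k)"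

lemma finite_trans: "finite (transitions e k)"
  by (induction e arbitrary: k) auto

fun effect :: "('a \<Rightarrow> 's \<Rightarrow> 's set) \<Rightarrow> 'a option \<Rightarrow> 's \<Rightarrow> 's set" where
  "effect \<alpha> None s = {s}"
| "effect \<alpha> (Some a) s = \<alpha> a s"

text \<open>Every transition prepends one step to a run of the remaining continuation. Whole runs
  are therefore rebuilt from their end, which is why \<open>rules_sound\<close> uses the converse
  induction on the closure.\<close>

lemma trans_sound:
  "\<lbrakk>(l, x, l') \<in> transitions e k; s' \<in> effect \<alpha> x s; t \<in> run \<alpha> (seqs l') s'\<rbrakk> \<Longrightarrow> t \<in> run \<alpha> (seqs l) s"
proof (induction e arbitrary: k)
  case (Star e)
  then show ?case
    using converse_rtranclp_into_rtranclp[where r = "\<lambda>x y. y \<in> run \<alpha> e x"] by fastforce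
qed auto

definition nstep :: "('a \<Rightarrow> 's \<Rightarrow> 's set) \<Rightarrow> ('a rx list \<times> 'a option \<times> 'a rx list) set
    \<Rightarrow> 'a rx list \<times> 's \<Rightarrow> 'a rx list \<times> 's \<Rightarrow> bool" where
  "nstep \<alpha> D p q \<longleftrightarrow> (\<exists>x. (fst p, x, fst q) \<in> D \<and> snd q \<in> effect \<alpha> x (snd p))"

lemma nstep_mono: "(nstep \<alpha> D)\<^sup>*\<^sup>* p q \<Longrightarrow> D \<subseteq> E \<Longrightarrow> (nstep \<alpha> E)\<^sup>*\<^sup>* p q"
  by (erule rtranclp_mono[THEN predicate2D, rotated]) (unfold nstep_def, blast)

lemma nstepI: "(l, x, l') \<in> D \<Longrightarrow> t \<in> effect \<alpha> x s \<Longrightarrow> nstep \<alpha> D (l, s) (l', t)"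
  by (auto simp: nstep_def)

lemma trans_complete:
  "t \<in> run \<alpha> e s \<Longrightarrow> (nstep \<alpha> (transitions e k))\<^sup>*\<^sup>* (e # k, s) (k, t)"
proof (induction e arbitrary: k s t)
  case One
  then show ?case by (intro r_into_rtranclp nstepI[of _ None]) auto
next
  case (Atom a)
  then show ?case by (intro r_into_rtranclp nstepI[of _ "Some a"]) auto
next
  case (Seq e f)
  then obtain u where u: "u \<in> run \<alpha> e s" "t \<in> run \<alpha> f u" by auto
  have "nstep \<alpha> (transitions (Seq e f) k) (Seq e f # k, s) (e # f # k, s)"
    by (rule nstepI[of _ None]) auto
  also have "(nstep \<alpha> (transitions (Seq e f) k))\<^sup>*\<^sup>* (e # f # k, s) (f # k, u)"
    by (rule nstep_mono[OF Seq.IH(1)[OF u(1)]]) auto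
  also have "(nstep \<alpha> (transitions (Seq e f) k))\<^sup>*\<^sup>* (f # k, u) (k, t)"
    by (rule nstep_mono[OF Seq.IH(2)[OF u(2)]]) auto
  finally show ?case .
next
  case (Alt e f)
  from Alt.prems consider "t \<in> run \<alpha> e s" | "t \<in> run \<alpha> f s" by auto
  then show ?case
  proof cases
    case 1
    have "nstep \<alpha> (transitions (Alt e f) k) (Alt e f # k, s) (e # k, s)"
      by (rule nstepI[of _ None]) auto
    also have "(nstep \<alpha> (transitions (Alt e f) k))\<^sup>*\<^sup>* (e # k, s) (k, t)"
      by (rule nstep_mono[OF Alt.IH(1)[OF 1]]) auto
    finally show ?thesis .
  next
    case 2
    have "nstep \<alpha> (transitions (Alt e f) k) (Alt e f # k, s) (f # k, s)"
      by (rule nstepI[of _ None]) auto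
    also have "(nstep \<alpha> (transitions (Alt e f) k))\<^sup>*\<^sup>* (f # k, s) (k, t)"
      by (rule nstep_mono[OF Alt.IH(2)[OF 2]]) auto
    finally show ?thesis .
  qed
next
  case (Star e)
  let ?N = "nstep \<alpha> (transitions (Star e) k)"
  from Star.prems have "(\<lambda>x y. y \<in> run \<alpha> e x)\<^sup>*\<^sup>* s t" by simp
  then have "?N\<^sup>*\<^sup>* (Star e # k, s) (Star e # k, t)"
  proof induction
    case (step u w)
    note step.IH
    also have "?N (Star e # k, u) (e # Star e # k, u)"
      by (rule nstepI[of _ None]) auto
    also have "?N\<^sup>*\<^sup>* (e # Star e # k, u) (Star e # k, w)"
      by (rule nstep_mono[OF Star.IH[OF step.hyps(2)]]) auto
    finally show ?case .
  qed simp
  also have "?N (Star e # k, t) (k, t)" by (rule nstepI[of _ None]) auto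
  finally show ?case .
qed simp

section \<open>Numbered states: one rule of counter actions for each transition\<close>

instance rx :: (countable) countable by countable_datatype
instance action :: (countable) countable by countable_datatype
instance dctr :: countable by countable_datatype

type_synonym ctr = "dctr option"

text \<open>Counter \<open>None\<close> holds the number of the automaton state.\<close>

definition state_no :: "dctr action rx list \<Rightarrow> nat" where
  "state_no l = (if l = [] then 0 else Suc (to_nat l))"

lemma state_no_inj: "state_no l = state_no l' \<longleftrightarrow> l = l'"
  by (auto simp: state_no_def)

lemma state_no_eq_0: "state_no l = 0 \<longleftrightarrow> l = []"
  by (auto simp: state_no_def)

text \<open>A rule may be tried in any state; its decrements followed by a zero test make sure that
  \<open>None\<close> holds exactly the number of the source state. Number 0 belongs to the empty
  continuation, so that \<open>None\<close> being 0 means that the program has finished.\<close>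

fun rule_of :: "dctr action rx list \<times> dctr action option \<times> dctr action rx list \<Rightarrow> ctr action list" where
  "rule_of (l, x, l') = replicate (state_no l) (Dec None) @ Chk None #
     (case x of None \<Rightarrow> [] | Some a \<Rightarrow> [map_action Some a]) @ replicate (state_no l') (Inc None)"

definition acts :: "'c action list \<Rightarrow> ('c \<Rightarrow> nat) \<Rightarrow> ('c \<Rightarrow> nat) set" where
  "acts as = run act (seqs (map Atom as))"

lemma acts_Nil [simp]: "acts [] v = {v}"
  by (simp add: acts_def)

lemma acts_Cons [simp]: "acts (a # as) v = (\<Union>w\<in>act a v. acts as w)"
  by (simp add: acts_def)

lemma acts_append: "acts (as @ bs) v = (\<Union>w\<in>acts as v. acts bs w)"
  by (simp add: acts_def run_seqs_append)

lemma acts_replicate_Inc: "acts (replicate n (Inc c)) v = {v(c := v c + n)}"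
  using run_rep_inc[of n c v] by (simp add: acts_def rep_def)

lemma acts_replicate_Dec: "acts (replicate n (Dec c)) v = (if n \<le> v c then {v(c := v c - n)} else {})"
  using run_rep_dec[of n c v] by (simp add: acts_def rep_def)

lemma act_Some: "act (map_action Some a) (case_option q d) = case_option q ` act a d"
  by (cases a) (auto simp: fun_eq_iff split: option.split)

lemma case_option_upd_None: "(case_option q d)(None := r) = case_option r d"
  by (auto simp: fun_eq_iff split: option.split)

lemma acts_rule_of:
  "acts (rule_of (l, x, l')) (case_option q d)
    = (if q = state_no l then case_option (state_no l') ` effect act x d else {})"
proof -
  have 1: "acts ((case x of None \<Rightarrow> [] | Some a \<Rightarrow> [map_action Some a]) @ replicate (state_no l') (Inc None)) (case_option 0 d)
    = case_option (state_no l') ` effect act x d"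
    by (cases x) (auto simp: acts_replicate_Inc case_option_upd_None acts_append act_Some)
  show ?thesis
    by (simp only: rule_of.simps acts_append[of "replicate (state_no l) _"] acts_replicate_Dec)
      (auto simp: case_option_upd_None 1)
qed

definition rstep :: "'c action list set \<Rightarrow> ('c \<Rightarrow> nat) \<Rightarrow> ('c \<Rightarrow> nat) \<Rightarrow> bool" where
  "rstep R v w \<longleftrightarrow> (\<exists>r\<in>R. w \<in> acts r v)"

lemma rules_sound:
  assumes "(rstep (rule_of ` transitions e []))\<^sup>*\<^sup>* v w" "w None = 0" "v = case_option (state_no l) d"
  shows "\<exists>d'. d' \<in> run act (seqs l) d"
  using assms(1,3)
proof (induction arbitrary: l d rule: converse_rtranclp_induct)
  case base
  then have "l = []" using assms(2) by (simp add: state_no_eq_0)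
  then show ?case by simp
next
  case (step v v1)
  then obtain l1 x l' where t: "(l1, x, l') \<in> transitions e []" and "v1 \<in> acts (rule_of (l1, x, l')) v"
    unfolding rstep_def by auto
  then obtain d1 where "l = l1" "v1 = case_option (state_no l') d1" "d1 \<in> effect act x d"
    unfolding step.prems acts_rule_of by (auto simp: state_no_inj split: if_splits)
  moreover then obtain d' where "d' \<in> run act (seqs l') d1" using step.IH by blast
  ultimately show ?case using trans_sound[OF t, of d1 act d d'] by blast
qed

lemma rules_complete:
  assumes "d' \<in> run act e d"
  shows "(rstep (rule_of ` transitions e []))\<^sup>*\<^sup>* (case_option (state_no [e]) d) (case_option 0 d')"
proof -
  let ?f = "\<lambda>p. case_option (state_no (fst p)) (snd p)"
  have one: "rstep (rule_of ` transitions e []) (?f p) (?f q)" if step: "nstep act (transitions e []) p q" for p q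
  proof -
    obtain x where x: "(fst p, x, fst q) \<in> transitions e []" "snd q \<in> effect act x (snd p)"
      using step unfolding nstep_def by blast
    then have "?f q \<in> acts (rule_of (fst p, x, fst q)) (?f p)"
      unfolding acts_rule_of by simp
    with x(1) show ?thesis unfolding rstep_def by blast
  qed
  have "(rstep (rule_of ` transitions e []))\<^sup>*\<^sup>* (?f p) (?f q)" if "(nstep act (transitions e []))\<^sup>*\<^sup>* p q" for p q
    using that
  proof induction
    case base
    show ?case by simp
  next
    case (step y z)
    from step.IH one[OF step.hyps(2)]
    show ?case by (rule rtranclp.rtrancl_into_rtrancl[where r = "rstep (rule_of ` transitions e [])"])
  qed
  from this[OF trans_complete[OF assms]] show ?thesis by (simp add: state_no_def)
qed

section \<open>Acceptance by a set of rules\<close>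

datatype instr = Op "ctr action" | Init | Halt

text \<open>The list is what is left of the current rule; at its end any rule may follow, and the
  rules \<open>rule_of\<close> test the state by themselves. \<open>Init\<close> has no clause: it
  belongs to the input row and is not an operation on counters.\<close>

inductive accepts :: "instr list set \<Rightarrow> instr list \<Rightarrow> (ctr \<Rightarrow> nat) \<Rightarrow> bool" for R where
  acc_Halt: "v None = 0 \<Longrightarrow> accepts R (Halt # l) v"
| acc_Op: "w \<in> act a v \<Longrightarrow> accepts R l w \<Longrightarrow> accepts R (Op a # l) v"
| acc_Nil: "r \<in> R \<Longrightarrow> accepts R r v \<Longrightarrow> accepts R [] v"

lemma acc_map_Op:
  "accepts R (map Op l) v \<longleftrightarrow> (\<exists>w\<in>acts l v. accepts R [] w)"
proof (induction l arbitrary: v)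
  case (Cons a l)
  have "accepts R (Op a # map Op l) v \<longleftrightarrow> (\<exists>w\<in>act a v. accepts R (map Op l) w)"
    by (auto elim: accepts.cases intro: acc_Op)
  with Cons show ?case by auto
qed simp

lemma acc_iff:
  "accepts (insert [Halt] (map Op ` R)) [] v \<longleftrightarrow> (\<exists>w. (rstep R)\<^sup>*\<^sup>* v w \<and> w None = 0)"
    (is "accepts ?R [] v \<longleftrightarrow> ?P v")
proof
  \<comment> \<open>Stated for every rest \<open>L\<close> of a rule, because a derivation passes
    through such rests: either a list of operations, or one with \<open>Halt\<close> in
    front.\<close>
  have "(\<forall>l. L = map Op l \<longrightarrow> (\<exists>w\<in>acts l v. ?P w)) \<and> (\<forall>l. L = Halt # l \<longrightarrow> v None = 0)"
    if "accepts ?R L v" for L v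
    using that
  proof induction
    case (acc_Nil r v)
    have "?P v"
    proof (cases "r = [Halt]")
      case True
      with acc_Nil show ?thesis by blast
    next
      case False
      with acc_Nil obtain l w where "l \<in> R" "w \<in> acts l v" "?P w" by blast
      then show ?thesis
        by (meson converse_rtranclp_into_rtranclp rstep_def)
    qed
    then show ?case by simp
  next
    case (acc_Op w a v L)
    have "\<exists>w\<in>acts l v. ?P w" if "Op a # L = map Op l" for l
    proof -
      from that obtain zs where "l = a # zs" "L = map Op zs" by (auto simp: Cons_eq_map_conv)
      moreover from acc_Op.IH this(2) obtain w' where "w' \<in> acts zs w" "?P w'" by blast
      ultimately show ?thesis using acc_Op.hyps(1) by auto
    qed
    then show ?case by blast
  qed (auto simp: Cons_eq_map_conv)
  from this[of "[]" v] show "accepts ?R [] v \<Longrightarrow> ?P v" by simp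
next
  assume "?P v"
  then obtain w where w: "(rstep R)\<^sup>*\<^sup>* v w" "w None = 0" by blast
  from w(1) show "accepts ?R [] v"
  proof (induction rule: converse_rtranclp_induct)
    case base
    show ?case using w(2) by (intro acc_Nil[of "[Halt]"] acc_Halt) auto
  next
    case (step x y)
    then obtain r where "r \<in> R" "y \<in> acts r x" by (auto simp: rstep_def)
    with step.IH have "accepts ?R (map Op r) x" unfolding acc_map_Op by blast
    with \<open>r \<in> R\<close> show ?case by (intro acc_Nil[of "map Op r"]) auto
  qed
qed

lemma acc_rules_iff:
  "accepts (insert [Halt] (map Op ` rule_of ` transitions e [])) [] (case_option (state_no [e]) d)
    \<longleftrightarrow> run act e d \<noteq> {}"
proof
  assume "accepts (insert [Halt] (map Op ` rule_of ` transitions e [])) [] (case_option (state_no [e]) d)"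
  then obtain w where "(rstep (rule_of ` transitions e []))\<^sup>*\<^sup>* (case_option (state_no [e]) d) w" "w None = 0"
    unfolding acc_iff by blast
  from rules_sound[OF this refl] show "run act e d \<noteq> {}" by auto
next
  assume "run act e d \<noteq> {}"
  then obtain d' where "d' \<in> run act e d" by blast
  from rules_complete[OF this]
  show "accepts (insert [Halt] (map Op ` rule_of ` transitions e [])) [] (case_option (state_no [e]) d)"
    unfolding acc_iff by force
qed

section \<open>Rows of tiles as transducer passes\<close>

text \<open>A tile is written north, east, south, west, with \<open>None\<close> for the color \<open>c\<^sub>0\<close>.\<close>

type_synonym ('s, 'g) atile = "'s option \<times> 'g option \<times> 's option \<times> 'g option"

abbreviation north :: "('s, 'g) atile \<Rightarrow> 's option" where "north t \<equiv> fst t"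
abbreviation east :: "('s, 'g) atile \<Rightarrow> 'g option" where "east t \<equiv> fst (snd t)"
abbreviation south :: "('s, 'g) atile \<Rightarrow> 's option" where "south t \<equiv> fst (snd (snd t))"
abbreviation west :: "('s, 'g) atile \<Rightarrow> 'g option" where "west t \<equiv> snd (snd (snd t))"

definition enc_tile :: "('s option \<Rightarrow> color) \<Rightarrow> ('g option \<Rightarrow> color) \<Rightarrow> ('s, 'g) atile \<Rightarrow> tile" where
  "enc_tile cs cg t = (cs (north t), cg (east t), cs (south t), cg (west t))"

text \<open>One token on a horizontal edge. The factor \<open>1 - kdelta k c0\<close> of a tile is
  built in by \<open>k \<noteq> 0\<close>: color 0 is no token.\<close>

definition hmap :: "int \<Rightarrow> int \<Rightarrow> color \<Rightarrow> edge \<Rightarrow> color \<Rightarrow> int" where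
  "hmap x y k e c = of_bool (e = {(x, y), (x + 1, y)} \<and> c = k \<and> k \<noteq> 0)"

definition vmap :: "int \<Rightarrow> int \<Rightarrow> color \<Rightarrow> edge \<Rightarrow> color \<Rightarrow> int" where
  "vmap x y k e c = of_bool (e = {(x, y), (x, y + 1)} \<and> c = k \<and> k \<noteq> 0)"

lemma hmap_0 [simp]: "hmap x y 0 e c = 0"
  by (simp add: hmap_def)

lemma vmap_0 [simp]: "vmap x y 0 e c = 0"
  by (simp add: vmap_def)

lemma hmap_hedge: "hmap x y k {(X, Y), (X + 1, Y)} c = of_bool (x = X \<and> y = Y \<and> c = k \<and> k \<noteq> 0)"
  unfolding hmap_def by (auto simp: doubleton_eq_iff)

lemma hmap_vedge: "hmap x y k {(X, Y), (X, Y + 1)} c = 0"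
  unfolding hmap_def by (auto simp: doubleton_eq_iff)

lemma vmap_vedge: "vmap x y k {(X, Y), (X, Y + 1)} c = of_bool (x = X \<and> y = Y \<and> c = k \<and> k \<noteq> 0)"
  unfolding vmap_def by (auto simp: doubleton_eq_iff)

lemma vmap_hedge: "vmap x y k {(X, Y), (X + 1, Y)} c = 0"
  unfolding vmap_def by (auto simp: doubleton_eq_iff)

lemma edge_shift_eq_iff: "edge_shift e (- x) (- y) = A \<longleftrightarrow> e = edge_shift A x y"
proof -
  have "edge_shift (edge_shift e a b) (- a) (- b) = e" for e a b
    by (simp add: edge_shift_def image_image split_beta)
  from this[of e "- x" "- y"] this[of A x y] show ?thesis by auto
qed

lemma translate_tile_map:
  "translate x y (tile_map 0 (n, e, s, w)) ed c
    = hmap x (y + 1) n ed c - hmap x y s ed c + vmap (x + 1) y e ed c - vmap x y w ed c"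
proof -
  have E: "edge_shift {(0, 0), (1, 0)} x y = {(x, y), (x + 1, y)}"
    "edge_shift {(1, 0), (1, 1)} x y = {(x + 1, y), (x + 1, y + 1)}"
    "edge_shift {(1, 1), (0, 1)} x y = {(x, y + 1), (x + 1, y + 1)}"
    "edge_shift {(0, 1), (0, 0)} x y = {(x, y), (x, y + 1)}"
    by (auto simp: edge_shift_def)
  have P: "(if ed = A \<and> c = k then 1 - kdelta k 0 else 0) = (of_bool (ed = A \<and> c = k \<and> k \<noteq> 0) :: int)"
    and N: "(if ed = A \<and> c = k then - (1 - kdelta k 0) else 0) = - (of_bool (ed = A \<and> c = k \<and> k \<noteq> 0) :: int)"
    for A k
    by (auto simp: kdelta_def)
  show ?thesis
    unfolding translate_def tile_map.simps edge_shift_eq_iff P N E hmap_def vmap_def by simp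
qed

text \<open>By \<open>nonempty\<close> no tile makes tokens out of nothing. By
  \<open>left_only\<close> nothing but the left marker is consumed without a west signal, so two
  tiles cannot divide the inputs of a cell between them; as such a tile also emits an east signal, a
  row with finitely many signals has finitely many tokens. \<open>left_north\<close> keeps the
  marker in its column.\<close>

locale sweeping =
  fixes tl :: "('s, 'g) atile set" and lft :: 's
    and cs :: "'s option \<Rightarrow> color" and cg :: "'g option \<Rightarrow> color"
  assumes cs: "inj cs" "cs None = 0" and cg: "inj cg" "cg None = 0"
    and nonempty: "(n, e, None, None) \<notin> tl"
    and left_only: "(n, e, s, None) \<in> tl \<Longrightarrow> s = Some lft \<and> e \<noteq> None"
    and left_west: "(n, e, Some lft, w) \<in> tl \<Longrightarrow> w = None"
    and left_north: "(Some lft, e, s, w) \<in> tl \<Longrightarrow> s = Some lft"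
begin

text \<open>The additional quadruple is no tile; it stands for a cell in which no tile lies.\<close>

definition tlx :: "('s, 'g) atile set" where "tlx = insert (None, None, None, None) tl"

text \<open>One row of tiles is one pass of a transducer over the row, with the west and east colors
  as its states.\<close>

definition sweep :: "(nat \<Rightarrow> 's option) \<Rightarrow> (nat \<Rightarrow> 's option) \<Rightarrow> bool" where
  "sweep H H' \<longleftrightarrow> (\<exists>V. V 0 = None \<and> (\<exists>M. \<forall>i\<ge>M. V i = None) \<and>
     (\<forall>i. (H' i, V (Suc i), H i, V i) \<in> tlx))"

definition tile_set :: "tile set" where "tile_set = enc_tile cs cg ` tl"

lemma cs_eq_0: "cs o1 = 0 \<longleftrightarrow> o1 = None"
  using cs by (metis injD)

lemma cg_eq_0: "cg o1 = 0 \<longleftrightarrow> o1 = None"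
  using cg by (metis injD)

definition tsum :: "(int \<times> int \<times> ('s, 'g) atile) list \<Rightarrow> edge \<Rightarrow> color \<Rightarrow> int" where
  "tsum ts e c = (\<Sum>(x, y, t)\<leftarrow>ts. hmap x (y + 1) (cs (north t)) e c - hmap x y (cs (south t)) e c
     + vmap (x + 1) y (cg (east t)) e c - vmap x y (cg (west t)) e c)"

lemma is_tiling_sum_iff:
  "is_tiling_sum 0 tile_set f \<longleftrightarrow> (\<exists>ts. (\<forall>(x, y, t)\<in>set ts. t \<in> tl) \<and> f = tsum ts)"
proof -
  let ?enc = "\<lambda>(x, y, t). (x, y, enc_tile cs cg t)"
  have eq: "(\<Sum>(x, y, t)\<leftarrow>map ?enc ts. translate x y (tile_map 0 t) e c) = tsum ts e c" for ts e c
    by (induction ts) (auto simp: tsum_def enc_tile_def translate_tile_map)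
  show ?thesis
  proof
    assume "is_tiling_sum 0 tile_set f"
    then obtain ts where ts: "\<forall>(x, y, t)\<in>set ts. t \<in> tile_set"
      and f: "f = (\<lambda>e c. \<Sum>(x, y, t)\<leftarrow>ts. translate x y (tile_map 0 t) e c)"
      unfolding is_tiling_sum_def by blast
    from ts have "\<exists>us. (\<forall>(x, y, t)\<in>set us. t \<in> tl) \<and> ts = map ?enc us"
    proof (induction ts)
      case (Cons p ts)
      then obtain us where us: "\<forall>(x, y, t)\<in>set us. t \<in> tl" "ts = map ?enc us" by auto
      obtain x y t' where p: "p = (x, y, t')" by (cases p) auto
      with Cons.prems obtain t where "t \<in> tl" "t' = enc_tile cs cg t" by (auto simp: tile_set_def)
      with us p show ?case by (intro exI[of _ "(x, y, t) # us"]) auto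
    qed simp
    then obtain us where "\<forall>(x, y, t)\<in>set us. t \<in> tl" "ts = map ?enc us" by blast
    moreover then have "f = tsum us" unfolding f by (intro ext) (simp only: eq)
    ultimately show "\<exists>ts. (\<forall>(x, y, t)\<in>set ts. t \<in> tl) \<and> f = tsum ts" by blast
  next
    assume "\<exists>ts. (\<forall>(x, y, t)\<in>set ts. t \<in> tl) \<and> f = tsum ts"
    then obtain ts where "\<forall>(x, y, t)\<in>set ts. t \<in> tl" "f = tsum ts" by blast
    then have "\<forall>(x, y, t)\<in>set (map ?enc ts). t \<in> tile_set" and "f = (\<lambda>e c. \<Sum>(x, y, t)\<leftarrow>map ?enc ts. translate x y (tile_map 0 t) e c)"
      unfolding eq by (auto simp: tile_set_def)
    then show "is_tiling_sum 0 tile_set f" unfolding is_tiling_sum_def by blast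
  qed
qed

definition rowsum :: "int \<Rightarrow> int \<Rightarrow> (nat \<Rightarrow> 's option) \<Rightarrow> nat \<Rightarrow> edge \<Rightarrow> color \<Rightarrow> int" where
  "rowsum x0 y H M e c = (\<Sum>i<M. hmap (x0 + int i) y (cs (H i)) e c)"

lemma rowsum_eq:
  assumes "\<And>i. M \<le> i \<Longrightarrow> H i = None" "M \<le> M'"
  shows "rowsum x0 y H M' = rowsum x0 y H M"
  unfolding rowsum_def
  by (intro ext sum.mono_neutral_right) (use assms cs in auto)

text \<open>A row of tiles sums to the tokens above it minus those below it, because the vertical
  edges telescope; stacking the rows telescopes again.\<close>

lemma tiling_of_sweeps:
  assumes "sweep\<^sup>*\<^sup>* H (\<lambda>_. None)"
  shows "\<exists>M. (\<forall>i\<ge>M. H i = None) \<and> (\<exists>ts. (\<forall>(x, y, t)\<in>set ts. t \<in> tl) \<and>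
    (\<forall>e c. rowsum x0 y H M e c + tsum ts e c = 0))"
  using assms
proof (induction arbitrary: y rule: converse_rtranclp_induct)
  case base
  show ?case
    by (intro exI[of _ 0] conjI exI[of _ "[]"]) (auto simp: rowsum_def tsum_def)
next
  case (step H H')
  obtain V M1 where V: "V 0 = None" "\<And>i. M1 \<le> i \<Longrightarrow> V i = None"
    and t: "\<And>i. (H' i, V (Suc i), H i, V i) \<in> tlx"
    using step.hyps(1) unfolding sweep_def by blast
  obtain M2 ts where M2: "\<And>i. M2 \<le> i \<Longrightarrow> H' i = None" and ts: "\<forall>(x, y, t)\<in>set ts. t \<in> tl"
    and sum: "\<And>e c. rowsum x0 (y + 1) H' M2 e c + tsum ts e c = 0"
    using step.IH[of "y + 1"] by blast
  define M where "M = max M1 M2"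
  have VM: "V M = None" using V(2) by (simp add: M_def)
  \<comment> \<open>Beyond the last signal a tile would have no west input, hence an east signal by
    \<open>left_only\<close>; so these cells are blank.\<close>
  have H: "H i = None" if "M1 \<le> i" for i
    using t[of i] V(2)[of i] V(2)[of "Suc i"] that left_only by (auto simp: tlx_def)
  define us where "us = filter (\<lambda>(x, y, t). t \<in> tl)
    (map (\<lambda>i. (x0 + int i, y, H' i, V (Suc i), H i, V i)) [0..<M])"
  let ?g = "\<lambda>e c i. hmap (x0 + int i) (y + 1) (cs (H' i)) e c - hmap (x0 + int i) y (cs (H i)) e c
     + vmap (x0 + int i + 1) y (cg (V (Suc i))) e c - vmap (x0 + int i) y (cg (V i)) e c"
  have z: "?g e c i = 0" if "(H' i, V (Suc i), H i, V i) \<notin> tl" for e c i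
    using t[of i] that cs cg by (auto simp: tlx_def)
  have us: "tsum us e c = rowsum x0 (y + 1) H' M e c - rowsum x0 y H M e c" for e c
  proof -
    have "tsum (filter (\<lambda>(x, y, t). t \<in> tl)
      (map (\<lambda>i. (x0 + int i, y, H' i, V (Suc i), H i, V i)) js)) e c = (\<Sum>i\<leftarrow>js. ?g e c i)" for js
    proof (induction js)
      case (Cons i js)
      then show ?case using z[of i e c] by (simp add: tsum_def)
    qed (simp add: tsum_def)
    then have "tsum us e c = (\<Sum>i\<leftarrow>[0..<M]. ?g e c i)" unfolding us_def .
    also have "\<dots> = (\<Sum>i<M. ?g e c i)"
      by (simp add: interv_sum_list_conv_sum_set_nat atLeast0LessThan)
    also have "\<dots> = rowsum x0 (y + 1) H' M e c - rowsum x0 y H M e c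
      + (\<Sum>i<M. vmap (x0 + int (Suc i)) y (cg (V (Suc i))) e c - vmap (x0 + int i) y (cg (V i)) e c)"
      by (simp add: rowsum_def sum.distrib sum_subtractf algebra_simps)
    \<comment> \<open>An east signal cancels against the west signal of the next cell, and both ends
      of the row carry none.\<close>
    also have "(\<Sum>i<M. vmap (x0 + int (Suc i)) y (cg (V (Suc i))) e c - vmap (x0 + int i) y (cg (V i)) e c) = 0"
      by (subst sum_lessThan_telescope) (simp add: VM V(1) cg)
    finally show ?thesis by simp
  qed
  have "rowsum x0 (y + 1) H' M = rowsum x0 (y + 1) H' M2"
    by (rule rowsum_eq) (auto simp: M2 M_def)
  then have "rowsum x0 y H M e c + tsum (us @ ts) e c = 0" for e c
    using us[of e c] sum[of e c] by (simp add: tsum_def)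
  moreover have "\<forall>(x, y, t)\<in>set (us @ ts). t \<in> tl" using ts by (auto simp: us_def)
  moreover have "\<forall>i\<ge>M. H i = None" using H by (simp add: M_def)
  ultimately show ?case by blast
qed

section \<open>From a cancelling tiling sum back to a sequence of sweeps\<close>

lemma multiset_le_1_cases:
  assumes "\<And>t u M'. M = {#t, u#} + M' \<Longrightarrow> False"
  obtains "M = {#}" | t where "M = {#t#}"
  by (metis assms multiset_cases add_mset_add_single union_commute add.left_neutral union_mset_add_mset_left)

text \<open>Inputs \<open>None\<close> leave no trace in the counts, so a priori one tile could take
  the south token and another one the west token. A tile without west input consumes the left
  marker; then \<open>v\<close> is \<open>None\<close>, every tile of the cell consumes a marker,
  and there is only one. Otherwise every tile of the cell consumes the west token, of which there is
  only one, too.\<close>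

lemma cell_tiles:
  assumes M: "\<And>t. t \<in># M \<Longrightarrow> t \<in> tl"
    and s: "\<And>a. count (image_mset south M) (Some a) = of_bool (h = Some a)"
    and w: "\<And>q. count (image_mset west M) (Some q) = of_bool (v = Some q)"
    and lft: "h = Some lft \<Longrightarrow> v = None"
  shows "\<exists>n e. (n, e, h, v) \<in> tlx \<and> M = (if (n, e, h, v) \<in> tl then {#(n, e, h, v)#} else {#})"
proof (rule multiset_le_1_cases[of M])
  fix t u M' assume M': "M = {#t, u#} + M'"
  then have tu: "t \<in> tl" "u \<in> tl" using M by auto
  have S: "south x = None \<or> south x = h" if "x \<in># M" for x
  proof (cases "south x")
    case (Some a)
    then have "0 < count (image_mset south M) (Some a)" using that by force
    with s Some show ?thesis by (auto split: if_splits)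
  qed simp
  have W: "west x = None \<or> west x = v" if "x \<in># M" for x
  proof (cases "west x")
    case (Some a)
    then have "0 < count (image_mset west M) (Some a)" using that by force
    with w Some show ?thesis by (auto split: if_splits)
  qed simp
  have "\<not> (south t = Some a \<and> south u = Some a)" for a
    using s[of a] by (auto simp: M' of_bool_def split: if_splits)
  moreover have "\<not> (west t = Some a \<and> west u = Some a)" for a
    using w[of a] by (auto simp: M' of_bool_def split: if_splits)
  moreover have "south x = Some lft" if "x \<in> tl" "west x = None" for x
    using left_only that by (metis prod.collapse)
  ultimately show False
    using tu S[of t] S[of u] W[of t] W[of u] lft M'
    by (cases "h = Some lft"; cases "west t"; cases "west u") auto
next
  assume "M = {#}"
  then have "h = None" "v = None" using s w by (cases h; cases v; force)+
  then show ?thesis using nonempty \<open>M = {#}\<close> by (intro exI[of _ None]) (auto simp: tlx_def)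
next
  fix t assume t: "M = {#t#}"
  then have "south t = h"
    using s by (cases "south t"; cases h) (force split: if_splits)+
  moreover have "west t = v"
    using t w by (cases "west t"; cases v) (force split: if_splits)+
  moreover have "t \<in> tl" using M t by simp
  ultimately show ?thesis using t
    by (intro exI[of _ "north t"] exI[of _ "east t"]) (auto simp: tlx_def)
qed

definition cell :: "(int \<times> int \<times> ('s, 'g) atile) list \<Rightarrow> int \<Rightarrow> int \<Rightarrow> ('s, 'g) atile multiset" where
  "cell ts X Y = image_mset (\<lambda>(x, y, t). t) (filter_mset (\<lambda>(x, y, t). x = X \<and> y = Y) (mset ts))"

lemma in_cell: "t \<in># cell ts X Y \<longleftrightarrow> (X, Y, t) \<in> set ts"
  by (force simp: cell_def)

lemma cell_Nil [simp]: "cell [] X Y = {#}"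
  by (simp add: cell_def)

lemma cell_Cons:
  "cell ((x, y, t) # ts) X Y = (if x = X \<and> y = Y then add_mset t (cell ts X Y) else cell ts X Y)"
  by (simp add: cell_def)

lemma tsum_Nil [simp]: "tsum [] e c = 0"
  by (simp add: tsum_def)

lemma tsum_Cons:
  "tsum ((x, y, t) # ts) e c = hmap x (y + 1) (cs (north t)) e c - hmap x y (cs (south t)) e c
     + vmap (x + 1) y (cg (east t)) e c - vmap x y (cg (west t)) e c + tsum ts e c"
  by (simp add: tsum_def)

lemma hmap_cs_hedge:
  "hmap x y (cs b) {(X, Y), (X + 1, Y)} (cs (Some a)) = of_bool (x = X \<and> y = Y \<and> b = Some a)"
proof -
  have "cs (Some a) = cs b \<and> cs b \<noteq> 0 \<longleftrightarrow> b = Some a"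
    using cs_eq_0 cs(1) by (auto dest: injD)
  then show ?thesis unfolding hmap_hedge by simp
qed

lemma vmap_cg_vedge:
  "vmap x y (cg b) {(X, Y), (X, Y + 1)} (cg (Some a)) = of_bool (x = X \<and> y = Y \<and> b = Some a)"
proof -
  have "cg (Some a) = cg b \<and> cg b \<noteq> 0 \<longleftrightarrow> b = Some a"
    using cg_eq_0 cg(1) by (auto dest: injD)
  then show ?thesis unfolding vmap_vedge by simp
qed

lemma tsum_hedge:
  "tsum ts {(X, Y), (X + 1, Y)} (cs (Some a))
    = int (count (image_mset north (cell ts X (Y - 1))) (Some a)) - int (count (image_mset south (cell ts X Y)) (Some a))"
proof (induction ts)
  case (Cons p ts)
  obtain x y t where p: "p = (x, y, t)" by (cases p) auto
  have "y + 1 = Y \<longleftrightarrow> y = Y - 1" by auto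
  with Cons show ?case
    unfolding p tsum_Cons cell_Cons hmap_cs_hedge vmap_hedge by (auto split: if_splits)
qed simp

lemma tsum_vedge:
  "tsum ts {(X, Y), (X, Y + 1)} (cg (Some a))
    = int (count (image_mset east (cell ts (X - 1) Y)) (Some a)) - int (count (image_mset west (cell ts X Y)) (Some a))"
proof (induction ts)
  case (Cons p ts)
  obtain x y t where p: "p = (x, y, t)" by (cases p) auto
  have "x + 1 = X \<longleftrightarrow> x = X - 1" by auto
  with Cons show ?case
    unfolding p tsum_Cons cell_Cons vmap_cg_vedge hmap_vedge by (auto split: if_splits)
qed simp

context
  fixes ts H M x0
  assumes ts: "\<forall>(x, y, t)\<in>set ts. t \<in> tl"
    and HM: "\<And>i. M \<le> i \<Longrightarrow> H i = None"
    and zero: "\<And>e c. rowsum x0 0 H M e c + tsum ts e c = 0"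
    and Hlft: "\<And>i. H i = Some lft \<Longrightarrow> i = 0"
begin

lemma rowsum_hedge:
  "rowsum x0 0 H M {(X, Y), (X + 1, Y)} (cs (Some a))
    = of_bool (Y = 0 \<and> x0 \<le> X \<and> H (nat (X - x0)) = Some a)"
proof -
  have "rowsum x0 0 H M {(X, Y), (X + 1, Y)} (cs (Some a))
    = (\<Sum>i<M. if i = nat (X - x0) then of_bool (Y = 0 \<and> x0 \<le> X \<and> H (nat (X - x0)) = Some a) else 0)"
    unfolding rowsum_def hmap_cs_hedge by (intro sum.cong) auto
  also have "\<dots> = of_bool (Y = 0 \<and> x0 \<le> X \<and> H (nat (X - x0)) = Some a)"
    using HM[of "nat (X - x0)"] by (auto simp: sum.delta not_less)
  finally show ?thesis .
qed

lemma rowsum_vedge: "rowsum x0 0 H M {(X, Y), (X, Y + 1)} c = 0"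
  by (simp add: rowsum_def hmap_vedge)

text \<open>Vanishing of the sum at an edge is a conservation law: what is consumed there was
  produced by the cell below or supplied by \<open>H\<close>.\<close>

lemma flow_south:
  "count (image_mset south (cell ts X Y)) (Some a)
    = count (image_mset north (cell ts X (Y - 1))) (Some a) + of_bool (Y = 0 \<and> x0 \<le> X \<and> H (nat (X - x0)) = Some a)"
  using zero[of "{(X, Y), (X + 1, Y)}" "cs (Some a)"] unfolding tsum_hedge rowsum_hedge
  by (auto simp: of_bool_def split: if_splits)

lemma flow_west:
  "count (image_mset west (cell ts X Y)) (Some a) = count (image_mset east (cell ts (X - 1) Y)) (Some a)"
  using zero[of "{(X, Y), (X, Y + 1)}" "cg (Some a)"] unfolding tsum_vedge rowsum_vedge by linarith

lemma cell_tl: "t \<in># cell ts X Y \<Longrightarrow> t \<in> tl"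
  using ts by (auto simp: in_cell)

text \<open>Induction along the antidiagonals: the finitely many tiles have a lower bound K of x +
  y, and a tile needs a token from a cell with x + y smaller by one. That cell lies again outside
  the quadrant, where nothing is supplied.\<close>

lemma cell_empty_outside:
  assumes "X < x0 \<or> Y < 0" shows "cell ts X Y = {#}"
proof -
  obtain K where K: "\<And>x y t. (x, y, t) \<in> set ts \<Longrightarrow> K \<le> x + y"
  proof -
    have "\<exists>K. \<forall>(x, y, t)\<in>set us. K \<le> x + y" for us :: "(int \<times> int \<times> ('s, 'g) atile) list"
    proof (induction us)
      case (Cons p us)
      then obtain K where "\<forall>(x, y, t)\<in>set us. K \<le> x + y" by blast
      then show ?case by (intro exI[of _ "min K (fst p + fst (snd p))"]) (auto simp: min_def)
    qed simp
    from this[of ts] that show ?thesis by blast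
  qed
  have "X < x0 \<or> Y < 0 \<Longrightarrow> X + Y < K + int n \<Longrightarrow> cell ts X Y = {#}" for n
  proof (induction n arbitrary: X Y)
    case 0
    have "t \<notin># cell ts X Y" for t using 0 K[of X Y t] by (auto simp: in_cell)
    then show ?case by (metis multiset_nonemptyE)
  next
    case (Suc n)
    have "cell ts X (Y - 1) = {#}" "cell ts (X - 1) Y = {#}"
      using Suc.prems by (auto intro!: Suc.IH)
    then have c: "count (image_mset south (cell ts X Y)) (Some a) = 0"
      "count (image_mset west (cell ts X Y)) (Some b) = 0" for a b
      using flow_south[of X Y a] flow_west[of X Y b] Suc.prems by auto
    have "t \<notin># cell ts X Y" for t
    proof
      assume t: "t \<in># cell ts X Y"
      have "south t = None" using c(1) t by (cases "south t") (force simp: count_eq_zero_iff)+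
      moreover have "west t = None" using c(2) t by (cases "west t") (force simp: count_eq_zero_iff)+
      ultimately show False using cell_tl[OF t] nonempty by (metis prod.collapse)
    qed
    then show ?case by (metis multiset_nonemptyE)
  qed
  from this[of "nat (X + Y - K + 1)"] assms show ?thesis by auto
qed

lemma cell_empty_far: "\<exists>B. \<forall>X Y. B \<le> X \<or> B \<le> Y \<longrightarrow> cell ts X Y = {#}"
proof -
  have "\<exists>B. \<forall>(x, y, t)\<in>set us. x < B \<and> y < B" for us :: "(int \<times> int \<times> ('s, 'g) atile) list"
  proof (induction us)
    case (Cons p us)
    then obtain B where "\<forall>(x, y, t)\<in>set us. x < B \<and> y < B" by blast
    then show ?case
      by (intro exI[of _ "max B (max (fst p + 1) (fst (snd p) + 1))"]) (auto simp: max_def)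
  qed simp
  then obtain B where B: "\<forall>(x, y, t)\<in>set ts. x < B \<and> y < B" by blast
  show ?thesis
  proof (intro exI[of _ B] allI impI)
    fix X Y assume "B \<le> X \<or> B \<le> Y"
    then have "t \<notin># cell ts X Y" for t using B by (auto simp: in_cell)
    then show "cell ts X Y = {#}" by (metis multiset_nonemptyE)
  qed
qed

text \<open>From west to east: no signal enters column 0, and by \<open>cell_tiles\<close> a cell
  with at most one signal from the west and at most one token from the south holds at most one tile,
  which passes at most one signal on.\<close>

lemma row_step:
  assumes h: "\<And>i a. count (image_mset south (cell ts (x0 + int i) (int n))) (Some a) = of_bool (h i = Some a)"
    and hlft: "\<And>i. h i = Some lft \<Longrightarrow> i = 0"
  shows "\<exists>h'. sweep h h' \<and> (\<forall>i. h' i = Some lft \<longrightarrow> i = 0) \<and>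
    (\<forall>i a. count (image_mset south (cell ts (x0 + int i) (int (Suc n)))) (Some a) = of_bool (h' i = Some a))"
proof -
  let ?c = "\<lambda>i. cell ts (x0 + int i) (int n)"
  have tiles: "\<exists>m e. (m, e, h i, v) \<in> tlx \<and> ?c i = (if (m, e, h i, v) \<in> tl then {#(m, e, h i, v)#} else {#})"
    if "\<And>q. count (image_mset west (?c i)) (Some q) = of_bool (v = Some q)" "i = 0 \<Longrightarrow> v = None" for i v
    using that hlft[of i] by (intro cell_tiles cell_tl h) auto
  have east: "count (image_mset east (?c i)) (Some q) = of_bool (e = Some q)"
    if "(m, e, h i, v) \<in> tlx" "?c i = (if (m, e, h i, v) \<in> tl then {#(m, e, h i, v)#} else {#})" for i m e v q
    using that by (auto simp: tlx_def)
  have north: "count (image_mset north (?c i)) (Some q) = of_bool (m = Some q)"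
    if "(m, e, h i, v) \<in> tlx" "?c i = (if (m, e, h i, v) \<in> tl then {#(m, e, h i, v)#} else {#})" for i m e v q
    using that by (auto simp: tlx_def)
  have "\<exists>v. (\<forall>q. count (image_mset west (?c i)) (Some q) = of_bool (v = Some q)) \<and> (i = 0 \<longrightarrow> v = None)" for i
  proof (induction i)
    case 0
    have "count (image_mset west (?c 0)) (Some q) = 0" for q
      using flow_west[of x0 "int n" q] cell_empty_outside[of "x0 - 1" "int n"] by simp
    then show ?case by (intro exI[of _ None]) auto
  next
    case (Suc i)
    then obtain v where "\<And>q. count (image_mset west (?c i)) (Some q) = of_bool (v = Some q)"
      "i = 0 \<Longrightarrow> v = None" by blast
    from tiles[OF this] obtain m e where
      "(m, e, h i, v) \<in> tlx" "?c i = (if (m, e, h i, v) \<in> tl then {#(m, e, h i, v)#} else {#})" by blast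
    from east[OF this] have "count (image_mset west (?c (Suc i))) (Some q) = of_bool (e = Some q)" for q
      using flow_west[of "x0 + int (Suc i)" "int n" q] by simp
    then show ?case by (intro exI[of _ e]) auto
  qed
  then obtain V where V: "\<And>i q. count (image_mset west (?c i)) (Some q) = of_bool (V i = Some q)"
    and V0: "\<And>i. i = 0 \<longrightarrow> V i = None"
    by metis
  have "\<exists>m e. (m, e, h i, V i) \<in> tlx \<and> ?c i = (if (m, e, h i, V i) \<in> tl then {#(m, e, h i, V i)#} else {#})" for i
    using tiles[OF V] V0 by blast
  then obtain h' E where hE: "\<And>i. (h' i, E i, h i, V i) \<in> tlx"
    "\<And>i. ?c i = (if (h' i, E i, h i, V i) \<in> tl then {#(h' i, E i, h i, V i)#} else {#})"
    by metis
  have E: "E i = V (Suc i)" for i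
  proof -
    have "of_bool (V (Suc i) = Some q) = (of_bool (E i = Some q) :: nat)" for q
      using V[of "Suc i" q] east[OF hE, of i q] flow_west[of "x0 + int (Suc i)" "int n" q] by simp
    then show ?thesis by (cases "E i"; cases "V (Suc i)") (auto simp: of_bool_eq_iff)
  qed
  obtain B where B: "\<And>X Y. B \<le> X \<Longrightarrow> cell ts X Y = {#}" using cell_empty_far by blast
  \<comment> \<open>Finitely many tiles, hence finitely many signals, as \<open>sweep\<close>
    demands.\<close>
  have "V i = None" if "nat (B - x0) \<le> i" for i
    using V[of i] B[of "x0 + int i" "int n"] that by (cases "V i") auto
  then have "sweep h h'"
    unfolding sweep_def using V0 hE(1) by (intro exI[of _ V]) (auto simp: E)
  moreover have "i = 0" if "h' i = Some lft" for i
    using hE(1)[of i] left_north hlft that by (auto simp: tlx_def)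
  moreover have "count (image_mset south (cell ts (x0 + int i) (int (Suc n)))) (Some a) = of_bool (h' i = Some a)" for i a
    using flow_south[of "x0 + int i" "int (Suc n)" a] north[OF hE, of i a] by simp
  ultimately show ?thesis by blast
qed

lemma sweeps_of_tiling: "sweep\<^sup>*\<^sup>* H (\<lambda>_. None)"
proof -
  have rows: "\<exists>h. sweep\<^sup>*\<^sup>* H h \<and> (\<forall>i. h i = Some lft \<longrightarrow> i = 0) \<and>
    (\<forall>i a. count (image_mset south (cell ts (x0 + int i) (int n))) (Some a) = of_bool (h i = Some a))" for n
  proof (induction n)
    case 0
    have "count (image_mset south (cell ts (x0 + int i) 0)) (Some a) = of_bool (H i = Some a)" for i a
      using flow_south[of "x0 + int i" 0 a] cell_empty_outside[of "x0 + int i" "-1"] by simp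
    with Hlft show ?case by (intro exI[of _ H]) auto
  next
    case (Suc n)
    then obtain h where "sweep\<^sup>*\<^sup>* H h" "\<And>i. h i = Some lft \<Longrightarrow> i = 0"
      "\<And>i a. count (image_mset south (cell ts (x0 + int i) (int n))) (Some a) = of_bool (h i = Some a)"
      by blast
    with row_step[of n h] obtain h' where "sweep h h'" "\<forall>i. h' i = Some lft \<longrightarrow> i = 0"
      "\<forall>i a. count (image_mset south (cell ts (x0 + int i) (int (Suc n)))) (Some a) = of_bool (h' i = Some a)"
      by blast
    with \<open>sweep\<^sup>*\<^sup>* H h\<close> show ?case by (meson rtranclp.rtrancl_into_rtrancl)
  qed
  obtain B where B: "\<And>X Y. B \<le> Y \<Longrightarrow> cell ts X Y = {#}" using cell_empty_far by blast
  obtain h where h: "sweep\<^sup>*\<^sup>* H h"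
    "\<And>i a. count (image_mset south (cell ts (x0 + int i) (int (nat B)))) (Some a) = of_bool (h i = Some a)"
    using rows[of "nat B"] by blast
  have "h i = None" for i
    using h(2)[of i] B[of "int (nat B)" "x0 + int i"] by (cases "h i") auto
  then have "h = (\<lambda>_. None)" by auto
  with h(1) show ?thesis by simp
qed

end

theorem tiling_iff_sweeps:
  assumes "\<And>i. M \<le> i \<Longrightarrow> H i = None" "\<And>i. H i = Some lft \<Longrightarrow> i = 0"
  shows "(\<exists>f. is_tiling_sum 0 tile_set f \<and> (\<lambda>e c. rowsum x0 0 H M e c + f e c) = (\<lambda>e c. 0))
    \<longleftrightarrow> sweep\<^sup>*\<^sup>* H (\<lambda>_. None)"
proof
  assume "\<exists>f. is_tiling_sum 0 tile_set f \<and> (\<lambda>e c. rowsum x0 0 H M e c + f e c) = (\<lambda>e c. 0)"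
  then obtain ts where "\<forall>(x, y, t)\<in>set ts. t \<in> tl"
    "(\<lambda>e c. rowsum x0 0 H M e c + tsum ts e c) = (\<lambda>e c. 0)"
    unfolding is_tiling_sum_iff by blast
  with assms show "sweep\<^sup>*\<^sup>* H (\<lambda>_. None)"
    by (intro sweeps_of_tiling[of ts M H x0]) (auto simp: fun_eq_iff)
next
  assume "sweep\<^sup>*\<^sup>* H (\<lambda>_. None)"
  then obtain M' ts where M': "\<And>i. M' \<le> i \<Longrightarrow> H i = None" and ts: "\<forall>(x, y, t)\<in>set ts. t \<in> tl"
    and sum: "\<And>e c. rowsum x0 0 H M' e c + tsum ts e c = 0"
    using tiling_of_sweeps[of H x0 0] by blast
  have "rowsum x0 0 H M = rowsum x0 0 H M'"
    using rowsum_eq[of M H "max M M'" x0 0] rowsum_eq[of M' H "max M M'" x0 0] assms(1) M' by simp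
  with sum ts show "\<exists>f. is_tiling_sum 0 tile_set f \<and> (\<lambda>e c. rowsum x0 0 H M e c + f e c) = (\<lambda>e c. 0)"
    unfolding is_tiling_sum_iff by (intro exI[of _ "tsum ts"]) auto
qed

end

section \<open>A universal set of tiles\<close>

text \<open>\<open>R0\<close> closes the input row: between the program and \<open>R0\<close> there
  are n blank columns, which the first pass turns into n units of the counter \<open>RC\<close>. In
  all later rows \<open>R\<close> closes the data.\<close>

datatype sym = Lft | Sep | Cell instr bool | Dat "ctr set" | R0 | R

text \<open>\<open>I\<close> travels as long as the star has not been met, \<open>K\<close> copies
  the rest of the data once the operation is done, and \<open>G\<close> puts \<open>R\<close> one
  column further when a counter outgrows the data.\<close>

datatype sig = I | P | Mv instr | Go instr | K | G | F | F'

text \<open>The star in \<open>Cell a True\<close> marks the instruction executed in the current row. It moves one cell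
  to the right (\<open>Mv\<close>) or, from the end of a rule, to the beginning of any rule (\<open>P\<close>, or \<open>Mv\<close> again);
  the data part of the row accepts only the signal \<open>Go\<close>, which exists only if there is exactly one star.
  Column \<open>j\<close> of the data holds the set of counters above \<open>j\<close>. The signals \<open>F\<close> and \<open>F'\<close> (before and after
  the star) erase the last row.\<close>

fun out :: "sym option \<Rightarrow> sig option \<Rightarrow> (sym option \<times> sig option) set" where
  "out (Some Lft) None = {(Some Lft, Some I), (None, Some F)}"
| "out (Some Sep) (Some q) = (case q of
      I \<Rightarrow> {(Some Sep, Some I), (Some Sep, Some P)}
    | Mv a \<Rightarrow> {(Some Sep, Some (Go a)), (Some Sep, Some (Mv a))}
    | Go a \<Rightarrow> {(Some Sep, Some (Go a)), (Some Sep, Some (Mv a))}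
    | F \<Rightarrow> {(None, Some F)}
    | F' \<Rightarrow> {(None, Some F')}
    | _ \<Rightarrow> {})"
| "out (Some (Cell a b)) (Some q) = (case q of
      I \<Rightarrow> {(Some (Cell a False), Some (if b then Mv a else I))}
    | P \<Rightarrow> {(Some (Cell a True), Some (if b then Mv a else I))}
    | Mv c \<Rightarrow> (if b then {} else {(Some (Cell a True), Some (Go c))})
    | Go c \<Rightarrow> (if b then {} else {(Some (Cell a False), Some (Go c))})
    | F \<Rightarrow> (if b then if a = Halt then {(None, Some F')} else {} else {(None, Some F)})
    | F' \<Rightarrow> (if b then {} else {(None, Some F')})
    | _ \<Rightarrow> {})"
| "out (Some (Dat X)) (Some q) = (case q of
      Go (Op (Inc c)) \<Rightarrow> (if c \<in> X then {(Some (Dat X), Some q)} else {(Some (Dat (insert c X)), Some K)})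
    | Go (Op (Dec c)) \<Rightarrow> (if c \<in> X then {(Some (Dat X), Some q), (Some (Dat (X - {c})), Some (Go (Op (Chk c))))} else {})
    | Go (Op (Chk c)) \<Rightarrow> (if c \<in> X then {} else {(Some (Dat X), Some K)})
    | K \<Rightarrow> {(Some (Dat X), Some K)}
    | F' \<Rightarrow> (if None \<in> X then {} else {(None, Some F')})
    | _ \<Rightarrow> {})"
| "out (Some R) (Some q) = (case q of
      Go (Op (Inc c)) \<Rightarrow> {(Some (Dat {c}), Some G)}
    | Go (Op (Chk c)) \<Rightarrow> {(Some R, None)}
    | K \<Rightarrow> {(Some R, None)}
    | F' \<Rightarrow> {(None, None)}
    | _ \<Rightarrow> {})"
| "out (Some R0) (Some q) = (if q = Go Init then {(Some R, None)} else {})"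
| "out None (Some q) = (if q = G then {(Some R, None)}
     else if q = Go Init then {(Some (Dat {Some RC}), Some q)} else {})"
| "out _ _ = {}"

definition tiles :: "(sym, sig) atile set" where
  "tiles = {(n, e, s, w). (n, e) \<in> out s w}"

lemma tiles_left:
  "(n, e, None, None) \<notin> tiles"
  "(n, e, s, None) \<in> tiles \<Longrightarrow> s = Some Lft \<and> e \<noteq> None"
  "(n, e, Some Lft, w) \<in> tiles \<Longrightarrow> w = None"
  "(Some Lft, e, s, w) \<in> tiles \<Longrightarrow> s = Some Lft"
proof -
  show "(n, e, None, None) \<notin> tiles" by (simp add: tiles_def)
  show "s = Some Lft \<and> e \<noteq> None" if "(n, e, s, None) \<in> tiles"
  proof (cases s)
    case (Some s')
    with that show ?thesis by (cases s') (auto simp: tiles_def)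
  qed (use that in \<open>auto simp: tiles_def\<close>)
  show "w = None" if "(n, e, Some Lft, w) \<in> tiles"
    using that by (cases w) (auto simp: tiles_def)
  show "s = Some Lft" if "(Some Lft, e, s, w) \<in> tiles"
  proof (cases "(s, w)" rule: out.cases)
    case (2 q)
    with that show ?thesis by (auto simp: tiles_def split: sig.splits)
  next
    case (3 a b q)
    with that show ?thesis by (auto simp: tiles_def split: sig.splits if_splits)
  next
    case (4 X q)
    with that show ?thesis by (auto simp: tiles_def split: sig.splits if_splits instr.splits action.splits)
  next
    case (5 q)
    with that show ?thesis by (auto simp: tiles_def split: sig.splits instr.splits action.splits)
  qed (use that in \<open>auto simp: tiles_def split: if_splits\<close>)
qed

section \<open>The data part of a row: one counter operation per pass\<close>

abbreviation outx :: "sym option \<Rightarrow> sig option \<Rightarrow> (sym option \<times> sig option) set" where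
  "outx s w \<equiv> out s w \<union> (if s = None \<and> w = None then {(None, None)} else {})"

text \<open>The width m is only an upper bound of the counters: columns emptied by decrements stay
  as \<open>Dat {}\<close>.\<close>

definition drow :: "(ctr \<Rightarrow> nat) \<Rightarrow> nat \<Rightarrow> nat \<Rightarrow> sym option" where
  "drow v m j = (if j < m then Some (Dat {c. j < v c}) else if j = m then Some R else None)"

lemma drow_end:
  assumes t: "\<And>j. (w j, V (Suc j)) \<in> outx (drow v m j) (V j)" and V: "V k = Some K" and "k \<le> m"
  shows "k \<le> j \<Longrightarrow> w j = drow v m j"
proof -
  have 1: "V (k + i) = Some K" if "k + i \<le> m" for i
    using that
  proof (induction i)
    case (Suc i)
    with t[of "k + i"] show ?case by (simp add: drow_def)
  qed (simp add: V)
  then have K: "V j = Some K" if "k \<le> j" "j \<le> m" for j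
    using that by (metis le_add_diff_inverse)
  have 2: "V (Suc m + i) = None" for i
  proof (induction i)
    case 0
    show ?case using t[of m] K[OF \<open>k \<le> m\<close>] by (simp add: drow_def)
  next
    case (Suc i)
    then show ?case using t[of "Suc m + i"] by (simp add: drow_def)
  qed
  then have N: "V j = None" if "m < j" for j
    using that by (metis less_iff_Suc_add add_Suc_right add_Suc)
  show "k \<le> j \<Longrightarrow> w j = drow v m j"
    using t[of j] K[of j] N[of j]
    by (cases j m rule: linorder_cases) (auto simp: drow_def)
qed

lemma None_tail:
  assumes t: "\<And>j. (w j, V (Suc j)) \<in> outx (h j) (V j)" and V: "V k = None" and h: "\<And>j. k \<le> j \<Longrightarrow> h j = None"
  shows "k \<le> j \<Longrightarrow> w j = None"
proof -
  have "V (k + i) = None" for i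
  proof (induction i)
    case (Suc i)
    then show ?case using t[of "k + i"] h[of "k + i"] by simp
  qed (simp add: V)
  then have "V j = None" if "k \<le> j" for j using that by (metis le_add_diff_inverse)
  then show "k \<le> j \<Longrightarrow> w j = None" using t[of j] h[of j] by simp
qed

text \<open>\<open>Inc\<close> enters its counter into the first column without it. For
  \<open>Dec\<close> the last column with the counter must be guessed, as no signal comes back from
  the right; the signal of \<open>Chk\<close>, sent to the next column, verifies the guess.\<close>

lemma data_sound:
  assumes t: "\<And>j. (w j, V (Suc j)) \<in> outx (drow v m j) (V j)" and V: "V 0 = Some (Go (Op a))"
    and le: "\<And>c. v c \<le> m"
  shows "\<exists>v' m'. v' \<in> act a v \<and> (\<forall>c. v' c \<le> m') \<and> w = drow v' m'"
proof (cases a)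
  case (Inc c)
  have go: "V j = Some (Go (Op (Inc c)))" if "j \<le> v c" for j
    using that
  proof (induction j)
    case (Suc j)
    then show ?case using t[of j] le[of c] by (simp add: drow_def)
  qed (simp add: V Inc)
  have before: "w j = Some (Dat {c. j < v c})" if "j < v c" for j
    using that t[of j] go[of j] le[of c] by (simp add: drow_def)
  let ?v = "v(c := Suc (v c))"
  show ?thesis
  proof (cases "v c < m")
    case True
    have at: "w (v c) = Some (Dat (insert c {c'. v c < v c'}))" "V (Suc (v c)) = Some K"
      using t[of "v c"] go[of "v c"] True by (simp_all add: drow_def)
    have "w j = drow ?v m j" for j
    proof (cases j "v c" rule: linorder_cases)
      case less
      then show ?thesis using before[of j] le[of c] by (auto simp: drow_def)
    next
      case equal
      then show ?thesis using at True by (auto simp: drow_def)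
    next
      case greater
      then have "w j = drow v m j" using drow_end[OF t at(2)] True by simp
      then show ?thesis using greater by (auto simp: drow_def)
    qed
    then have "w = drow ?v m" by auto
    moreover have "?v c' \<le> m" for c' using True le[of c'] by simp
    ultimately show ?thesis using Inc by (intro exI[of _ ?v] exI[of _ m] conjI allI) simp_all
  next
    case False
    \<comment> \<open>The counter fills all m columns: \<open>R\<close> turns into a new column, and
      \<open>G\<close> sets the end marker after it.\<close>
    then have m: "v c = m" using le[of c] by simp
    then have at: "w m = Some (Dat {c})" "V (Suc m) = Some G"
      using t[of m] go[of m] by (simp_all add: drow_def)
    then have at': "w (Suc m) = Some R" "V (Suc (Suc m)) = None"
      using t[of "Suc m"] by (simp_all add: drow_def)
    have "w j = drow ?v (Suc m) j" for j
    proof -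
      consider "j < m" | "j = m" | "j = Suc m" | "Suc (Suc m) \<le> j" by linarith
      then show ?thesis
      proof cases
        case 1
        then show ?thesis using before[of j] m by (auto simp: drow_def)
      next
        case 2
        have "\<not> m < v c'" for c' using le[of c'] by simp
        then have "{c'. m < (v(c := Suc (v c))) c'} = {c}" using m by auto
        with 2 at show ?thesis by (simp add: drow_def)
      next
        case 3
        with at' show ?thesis by (simp add: drow_def)
      next
        case 4
        then have "w j = None" by (intro None_tail[where h = "drow v m", OF t at'(2)]) (auto simp: drow_def)
        with 4 show ?thesis by (simp add: drow_def)
      qed
    qed
    then have "w = drow ?v (Suc m)" by auto
    moreover have "?v c' \<le> Suc m" for c' using m le[of c'] by simp
    ultimately show ?thesis using Inc by (intro exI[of _ ?v] exI[of _ "Suc m"] conjI allI) simp_all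
  qed
next
  case (Dec c)
  let ?q = "Some (Go (Op (Dec c)))"
  \<comment> \<open>\<open>R\<close> has no tile for the signal of \<open>Dec\<close>, so the guess
    must have been made in some column.\<close>
  have "\<exists>k. V k \<noteq> ?q"
  proof (rule ccontr)
    assume "\<not> ?thesis"
    with t[of m] show False by (simp add: drow_def)
  qed
  then obtain k where k: "V k \<noteq> ?q" "\<And>j. j < k \<Longrightarrow> V j = ?q"
    using LeastI_ex[of "\<lambda>k. V k \<noteq> ?q"] not_less_Least by blast
  then obtain i where i: "k = Suc i" using V Dec by (cases k) auto
  have im: "i < m"
    using t[of i] k(2)[of i] i by (auto simp: drow_def split: if_splits)
  then have at: "i < v c" "w i = Some (Dat ({c. i < v c} - {c}))" "V (Suc i) = Some (Go (Op (Chk c)))"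
    using t[of i] k i by (auto simp: drow_def split: if_splits)
  \<comment> \<open>Either the next column has accepted the signal of \<open>Chk\<close>, or the
    guessed column is the last one of the data.\<close>
  have vc: "v c = Suc i"
  proof (cases "Suc i < m")
    case True
    then show ?thesis using t[of "Suc i"] at by (auto simp: drow_def split: if_splits)
  next
    case False
    then show ?thesis using le[of c] at(1) by linarith
  qed
  let ?v = "v(c := i)"
  have "w j = drow ?v m j" for j
  proof (cases j i rule: linorder_cases)
    case less
    then have "w j = Some (Dat {c. j < v c})"
      using t[of j] t[of "Suc j"] k(2)[of j] k(2)[of "Suc j"] i im vc by (auto simp: drow_def split: if_splits)
    then show ?thesis using less im vc by (auto simp: drow_def)
  next
    case equal
    then show ?thesis using at im by (auto simp: drow_def)
  next
    case greater
    have "w j = drow v m j"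
    proof (cases "Suc i < m")
      case True
      then have e: "V (Suc (Suc i)) = Some K" "w (Suc i) = drow v m (Suc i)"
        using t[of "Suc i"] at(3) vc by (simp_all add: drow_def)
      show ?thesis
      proof (cases "j = Suc i")
        case False
        then show ?thesis using drow_end[OF t e(1), of j] True greater by simp
      qed (simp add: e(2))
    next
      case False
      then have m: "m = Suc i" using im by simp
      then have e: "V (Suc (Suc i)) = None" "w (Suc i) = Some R"
        using t[of "Suc i"] at(3) by (simp_all add: drow_def)
      show ?thesis
      proof (cases "j = Suc i")
        case False
        then have "w j = None"
          using greater m by (intro None_tail[where h = "drow v m", OF t e(1)]) (auto simp: drow_def)
        with False greater m show ?thesis by (simp add: drow_def)
      qed (simp add: e(2) m drow_def)
    qed
    then show ?thesis using greater vc by (auto simp: drow_def)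
  qed
  then have "w = drow ?v m" by auto
  moreover have "?v c' \<le> m" for c' using le[of c'] im by simp
  ultimately show ?thesis using Dec vc by (intro exI[of _ ?v] exI[of _ m] conjI allI) simp_all
next
  case (Chk c)
  have 0: "v c = 0"
  proof (cases m)
    case 0
    then show ?thesis using le[of c] by simp
  next
    case (Suc k)
    then show ?thesis using t[of 0] V Chk by (auto simp: drow_def split: if_splits)
  qed
  have "w j = drow v m j" for j
  proof (cases "m = 0")
    case True
    then have e: "V (Suc 0) = None" "w 0 = Some R"
      using t[of 0] V Chk by (simp_all add: drow_def)
    show ?thesis
    proof (cases "j = 0")
      case False
      then have "w j = None" using True by (intro None_tail[where h = "drow v m", OF t e(1)]) (auto simp: drow_def)
      then show ?thesis using False True by (simp add: drow_def)
    qed (simp add: e True drow_def)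
  next
    case False
    then have e: "V (Suc 0) = Some K" "w 0 = drow v m 0"
      using t[of 0] V Chk 0 by (simp_all add: drow_def)
    show ?thesis
    proof (cases "j = 0")
      case False
      then show ?thesis using drow_end[OF t e(1), of j] \<open>m \<noteq> 0\<close> by simp
    qed (simp add: e)
  qed
  then have "w = drow v m" by auto
  then show ?thesis using Chk 0 le by auto
qed

text \<open>For each operation an explicit word of signals, the one that \<open>data_sound\<close>
  reconstructs.\<close>

lemma data_complete:
  assumes v': "v' \<in> act a v" and le: "\<And>c. v c \<le> m"
  shows "\<exists>V m'. V 0 = Some (Go (Op a)) \<and> (\<exists>M. \<forall>i\<ge>M. V i = None) \<and> (\<forall>c. v' c \<le> m') \<and>
    (\<forall>j. (drow v' m' j, V (Suc j)) \<in> outx (drow v m j) (V j))"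
proof (cases a)
  case (Inc c)
  then have v'c: "v' = v(c := Suc (v c))" using v' by simp
  show ?thesis
  proof (cases "v c < m")
    case True
    let ?V = "\<lambda>j. if j \<le> v c then Some (Go (Op a)) else if j \<le> m then Some K else None"
    have "(drow v' m j, ?V (Suc j)) \<in> outx (drow v m j) (?V j)" for j
      using True by (auto simp: drow_def Inc v'c)
    moreover have "v' c' \<le> m" for c' using True le[of c'] v'c by simp
    ultimately show ?thesis
      by (intro exI[of _ ?V] exI[of _ m] conjI exI[of _ "Suc m"]) (use True in auto)
  next
    case False
    then have m: "v c = m" using le[of c] by simp
    let ?V = "\<lambda>j. if j \<le> m then Some (Go (Op a)) else if j = Suc m then Some G else None"
    have "\<not> m < v c'" for c' using le[of c'] by simp
    then have "{c'. m < (v(c := Suc (v c))) c'} = {c}" using m by auto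
    then have "(drow v' (Suc m) j, ?V (Suc j)) \<in> outx (drow v m j) (?V j)" for j
      using m by (auto simp: drow_def Inc v'c)
    moreover have "v' c' \<le> Suc m" for c' using m le[of c'] v'c by simp
    ultimately show ?thesis
      by (intro exI[of _ ?V] exI[of _ "Suc m"] conjI exI[of _ "Suc (Suc m)"]) auto
  qed
next
  case (Dec c)
  then obtain i where i: "v c = Suc i" and v'c: "v' = v(c := i)"
    using v' by (cases "v c") auto
  let ?V = "\<lambda>j. if j \<le> i then Some (Go (Op a)) else if j = Suc i then Some (Go (Op (Chk c)))
    else if j \<le> m then Some K else None"
  have "i < m" using le[of c] i by simp
  then have "(drow v' m j, ?V (Suc j)) \<in> outx (drow v m j) (?V j)" for j
    using i by (auto simp: drow_def Dec v'c)
  moreover have "v' c' \<le> m" for c' using le[of c'] v'c \<open>i < m\<close> by simp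
  ultimately show ?thesis
    by (intro exI[of _ ?V] exI[of _ m] conjI exI[of _ "Suc (Suc m)"]) (use \<open>i < m\<close> in auto)
next
  case (Chk c)
  then have "v c = 0" and v'c: "v' = v" using v' by (auto split: if_splits)
  let ?V = "\<lambda>j. if j = 0 then Some (Go (Op a)) else if j \<le> m then Some K else None"
  have "(drow v' m j, ?V (Suc j)) \<in> outx (drow v m j) (?V j)" for j
    using \<open>v c = 0\<close> by (auto simp: drow_def Chk v'c)
  then show ?thesis
    by (intro exI[of _ ?V] exI[of _ m] conjI exI[of _ "Suc m"]) (use le v'c in auto)
qed

section \<open>Finiteness and numbering of the colors\<close>

instance dctr :: finite
proof
  have "(UNIV :: dctr set) \<subseteq> {RA, RB, RC}" by (auto intro: dctr.exhaust)
  then show "finite (UNIV :: dctr set)" by (rule finite_subset) simp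
qed

instance action :: (finite) finite
proof
  have "a \<in> range Inc \<union> range Dec \<union> range Chk" for a :: "'a action" by (cases a) auto
  then have "(UNIV :: 'a action set) \<subseteq> range Inc \<union> range Dec \<union> range Chk" by blast
  then show "finite (UNIV :: 'a action set)" by (rule finite_subset) simp
qed

instance instr :: finite
proof
  have "a \<in> range Op \<union> {Init, Halt}" for a by (cases a) auto
  then have "(UNIV :: instr set) \<subseteq> range Op \<union> {Init, Halt}" by blast
  then show "finite (UNIV :: instr set)" by (rule finite_subset) simp
qed

instance sym :: finite
proof
  have "s \<in> {Lft, Sep, R0, R} \<union> case_prod Cell ` UNIV \<union> range Dat" for s by (cases s) (auto simp: image_iff)
  then have "(UNIV :: sym set) \<subseteq> {Lft, Sep, R0, R} \<union> case_prod Cell ` UNIV \<union> range Dat" by blast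
  then show "finite (UNIV :: sym set)" by (rule finite_subset) simp
qed

instance sig :: finite
proof
  have "q \<in> {I, P, K, G, F, F'} \<union> range Mv \<union> range Go" for q by (cases q) auto
  then have "(UNIV :: sig set) \<subseteq> {I, P, K, G, F, F'} \<union> range Mv \<union> range Go" by blast
  then show "finite (UNIV :: sig set)" by (rule finite_subset) simp
qed

text \<open>Symbols and signals share their numbers. They do not interfere, since symbols lie on
  horizontal edges and signals on vertical ones.\<close>

definition col :: "'a::finite option \<Rightarrow> color" where
  "col x = (case x of None \<Rightarrow> 0 | Some a \<Rightarrow> Suc (to_nat a))"

lemma inj_col: "inj col"
  by (auto simp: inj_def col_def split: option.splits)

lemma col_None [simp]: "col None = 0"
  by (simp add: col_def)

interpretation sweeping tiles Lft col col
  by unfold_locales (auto simp: inj_col tiles_left(1) dest: tiles_left(2-4))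

lemma sweep_iff:
  "sweep H H' \<longleftrightarrow> (\<exists>V. V 0 = None \<and> (\<exists>M. \<forall>i\<ge>M. V i = None) \<and>
     (\<forall>i. (H' i, V (Suc i)) \<in> outx (H i) (V i)))"
proof -
  have "(n, e, s, w) \<in> tlx \<longleftrightarrow> (n, e) \<in> outx s w" for n e s w
    unfolding tlx_def by (cases s; cases w) (auto simp: tiles_def)
  then show ?thesis unfolding sweep_def by simp
qed

section \<open>The program part of a row: moving the star\<close>

definition is_cell :: "sym \<Rightarrow> bool" where
  "is_cell s \<longleftrightarrow> (\<exists>a. s = Cell a False)"

definition mark :: "bool \<Rightarrow> sym \<Rightarrow> sym" where
  "mark b s = (case s of Cell a _ \<Rightarrow> Cell a b | _ \<Rightarrow> s)"

lemma mark_simps [simp]: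
  "mark b (Cell a b') = Cell a b" "mark b Sep = Sep" "mark b Lft = Lft"
  by (simp_all add: mark_def)

locale program =
  fixes pr :: "sym list"
  assumes Lft: "pr ! 0 = Lft" and len: "1 < length pr" and last: "last pr = Sep"
    and cells: "\<And>i. 0 < i \<Longrightarrow> i < length pr \<Longrightarrow> pr ! i = Sep \<or> is_cell (pr ! i)"
begin

abbreviation "ln \<equiv> length pr"

text \<open>\<open>B\<close> is the set of starred positions. It may be any set, because a pass can
  also produce no star or several.\<close>

definition row :: "nat set \<Rightarrow> (nat \<Rightarrow> sym option) \<Rightarrow> nat \<Rightarrow> sym option" where
  "row B h i = (if i < ln then Some (mark (i \<in> B) (pr ! i)) else h (i - ln))"

text \<open>\<open>pr ! Suc p = Sep\<close> says that \<open>p\<close> ends its rule; the cells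
  behind a separator are the beginnings of rules.\<close>

definition nxt :: "nat \<Rightarrow> nat \<Rightarrow> bool" where
  "nxt p p' \<longleftrightarrow> p' < ln \<and> 0 < p' \<and> is_cell (pr ! p') \<and>
     (p' = Suc p \<or> pr ! Suc p = Sep \<and> pr ! (p' - 1) = Sep)"

definition cellset :: "nat set" where
  "cellset = {i. i < ln \<and> is_cell (pr ! i)}"

lemma cellset_pos: "p \<in> cellset \<Longrightarrow> 0 < p"
  using Lft by (auto simp: cellset_def is_cell_def intro!: gr0I)

lemma cellset_Suc: "p \<in> cellset \<Longrightarrow> Suc p < ln"
proof -
  assume p: "p \<in> cellset"
  have "pr \<noteq> []" using len by auto
  then have "pr ! (ln - 1) = Sep" using last by (simp add: last_conv_nth)
  then have "p \<noteq> ln - 1" using p by (auto simp: cellset_def is_cell_def)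
  with p show "Suc p < ln" by (auto simp: cellset_def)
qed

lemma cell_cases:
  assumes "i < ln"
  obtains "i = 0" "pr ! i = Lft" | "0 < i" "pr ! i = Sep" | a where "0 < i" "pr ! i = Cell a False" "i \<in> cellset"
  using cells[of i] Lft assms unfolding cellset_def is_cell_def by (cases "i = 0") auto

text \<open>The signal leaving the program tells the outcomes apart. Those of the first kind are
  refused by the data; \<open>Go\<close> and \<open>F'\<close> certify exactly one star. The set
  \<open>B'\<close> of new stars stays arbitrary: if it is no singleton, the next row is
  stuck.\<close>

lemma prog_run:
  assumes t: "\<And>i. i < ln \<Longrightarrow> (w i, V (Suc i)) \<in> out (Some (mark (i \<in> B) (pr ! i))) (V i)"
    and V: "V 0 = None" and B: "B \<subseteq> cellset"
  obtains "V ln \<in> {Some I, Some P, Some F} \<union> range (Some \<circ> Mv)"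
  | p a B' where "B = {p}" "pr ! p = Cell a False" "V ln = Some (Go a)" "B' \<subseteq> cellset"
      "\<And>i. i < ln \<Longrightarrow> w i = Some (mark (i \<in> B') (pr ! i))" "\<And>p'. B' = {p'} \<Longrightarrow> nxt p p'"
  | p where "B = {p}" "pr ! p = Cell Halt False" "V ln = Some F'" "\<And>i. i < ln \<Longrightarrow> w i = None"
proof -
  have 0: "(w 0, V 1) \<in> {(Some Lft, Some I), (None, Some F)}"
  proof -
    have "0 < ln" using len by linarith
    from t[OF this] show ?thesis using Lft V by simp
  qed
  have Bln: "B \<subseteq> {..<ln}" using B by (auto simp: cellset_def)
  show thesis
  proof (cases "V 1 = Some F")
    case True
    \<comment> \<open>\<open>F\<close> means that no star has been met up to column i,
      \<open>F'\<close> that exactly one has, and that it stands on \<open>Halt\<close>.\<close>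
    have inv: "(V (Suc i) = Some F \<and> (\<forall>j\<le>i. j \<notin> B)) \<or>
      (\<exists>p\<le>i. B \<inter> {..i} = {p} \<and> pr ! p = Cell Halt False \<and> V (Suc i) = Some F')" if "i < ln" for i
      using that
    proof (induction i)
      case 0
      then show ?case using True B cellset_pos by auto
    next
      case (Suc i)
      note tS = t[OF Suc.prems]
      have at: "{..Suc i} = insert (Suc i) {..i}" by auto
      from Suc.IH Suc.prems consider
        (1) "V (Suc i) = Some F" "\<forall>j\<le>i. j \<notin> B"
        | (2) p where "p \<le> i" "B \<inter> {..i} = {p}" "pr ! p = Cell Halt False" "V (Suc i) = Some F'"
        by auto
      then show ?case
      proof cases
        case 1
        from cell_cases[OF Suc.prems] show ?thesis
        proof cases
          case 2
          then have "Suc i \<notin> B" using B by (auto simp: cellset_def is_cell_def)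
          with 1 2 tS show ?thesis by (auto simp: le_Suc_eq)
        next
          case (3 a)
          show ?thesis
          proof (cases "Suc i \<in> B")
            case True
            then have "B \<inter> {..Suc i} = {Suc i}" using 1(2) by (auto simp: at)
            with 1 3 True tS show ?thesis by (auto split: if_splits)
          next
            case False
            with 1 3 tS show ?thesis by (auto simp: le_Suc_eq)
          qed
        qed simp
      next
        case (2 p)
        have "V (Suc (Suc i)) = Some F' \<and> Suc i \<notin> B"
          using cell_cases[OF Suc.prems]
        proof cases
          case 2
          then have "Suc i \<notin> B" using B by (auto simp: cellset_def is_cell_def)
          with 2 \<open>V (Suc i) = _\<close> tS show ?thesis by auto
        next
          case (3 a)
          with \<open>V (Suc i) = _\<close> tS show ?thesis by (auto split: if_splits)
        qed simp
        then have "B \<inter> {..Suc i} = {p}" using 2 by (auto simp: at)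
        with 2 \<open>V (Suc (Suc i)) = _ \<and> _\<close> show ?thesis by (intro disjI2 exI[of _ p]) auto
      qed
    qed
    obtain k where k: "ln = Suc k" using len by (cases ln) auto
    have at: "B \<inter> {..k} = B" using Bln k by auto
    have w: "w i = None" if "i < ln" for i
    proof (cases i)
      case 0
      with True \<open>(w 0, V 1) \<in> _\<close> show ?thesis by auto
    next
      case (Suc j)
      then have "V i = Some F \<or> V i = Some F'" using inv[of j] that by auto
      with cell_cases[OF that] t[OF that] show ?thesis
        by cases (auto simp: Suc split: if_splits)
    qed
    from inv[of k] k at that(1,3) w show thesis by auto
  next
    case False
    with 0 have V1: "V 1 = Some I" and w0: "w 0 = Some Lft" by auto
    \<comment> \<open>Again the signal counts the old stars met so far: none for \<open>I\<close>
      and \<open>P\<close>, exactly one for \<open>Go\<close> and \<open>Mv\<close>.\<close>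
    have inv: "(V (Suc i) \<in> {Some I, Some P} \<and> (\<forall>j\<le>i. j \<notin> B)) \<or>
      (\<exists>p a. p \<le> i \<and> B \<inter> {..i} = {p} \<and> pr ! p = Cell a False \<and> V (Suc i) \<in> {Some (Go a), Some (Mv a)})"
      if "i < ln" for i
      using that
    proof (induction i)
      case 0
      then show ?case using V1 B cellset_pos by auto
    next
      case (Suc i)
      note tS = t[OF Suc.prems]
      have at: "{..Suc i} = insert (Suc i) {..i}" by auto
      from Suc.IH Suc.prems consider
        (1) "V (Suc i) \<in> {Some I, Some P}" "\<forall>j\<le>i. j \<notin> B"
        | (2) p a where "p \<le> i" "B \<inter> {..i} = {p}" "pr ! p = Cell a False" "V (Suc i) \<in> {Some (Go a), Some (Mv a)}"
        by auto
      then show ?case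
      proof cases
        case 1
        from cell_cases[OF Suc.prems] show ?thesis
        proof cases
          case 2
          then have "Suc i \<notin> B" using B by (auto simp: cellset_def is_cell_def)
          with 1 2 tS show ?thesis by (auto simp: le_Suc_eq)
        next
          case (3 a)
          show ?thesis
          proof (cases "Suc i \<in> B")
            case True
            then have "B \<inter> {..Suc i} = {Suc i}" using 1(2) by (auto simp: at)
            with 1 3 True tS show ?thesis by (auto split: if_splits)
          next
            case False
            with 1 3 tS show ?thesis by (auto simp: le_Suc_eq)
          qed
        qed simp
      next
        case (2 p a)
        have "V (Suc (Suc i)) \<in> {Some (Go a), Some (Mv a)} \<and> Suc i \<notin> B"
          using cell_cases[OF Suc.prems]
        proof cases
          case 2
          then have "Suc i \<notin> B" using B by (auto simp: cellset_def is_cell_def)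
          with 2 \<open>V (Suc i) \<in> _\<close> tS show ?thesis by auto
        next
          case (3 a)
          with \<open>V (Suc i) \<in> _\<close> tS show ?thesis by (auto split: if_splits)
        qed simp
        then have "B \<inter> {..Suc i} = {p}" using 2 by (auto simp: at)
        with 2 \<open>V (Suc (Suc i)) \<in> _ \<and> _\<close> show ?thesis
          by (intro disjI2 exI[of _ p] exI[of _ a]) auto
      qed
    qed
    obtain k where k: "ln = Suc k" using len by (cases ln) auto
    have at: "B \<inter> {..k} = B" using Bln k by auto
    \<comment> \<open>A cell of the new row is starred exactly if \<open>P\<close> or some
      \<open>Mv\<close> enters it.\<close>
    define B' where "B' = {i \<in> cellset. V i = Some P \<or> (\<exists>a. V i = Some (Mv a))}"
    have w: "w i = Some (mark (i \<in> B') (pr ! i))" if "i < ln" for i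
      using cell_cases[OF that]
    proof cases
      case 1
      then show ?thesis using w0 by simp
    next
      case 2
      then obtain j where j: "i = Suc j" by (cases i) auto
      then have "V i \<in> {Some I, Some P} \<or> (\<exists>a. V i \<in> {Some (Go a), Some (Mv a)})"
        using inv[of j] that by auto
      with 2 t[OF that] show ?thesis by (auto split: if_splits)
    next
      case (3 a)
      then obtain j where j: "i = Suc j" by (cases i) auto
      then have "V i \<in> {Some I, Some P} \<or> (\<exists>a. V i \<in> {Some (Go a), Some (Mv a)})"
        using inv[of j] that by auto
      with 3 t[OF that] show ?thesis by (auto simp: B'_def split: if_splits)
    qed
    have src: "pr ! i = Sep \<or> i \<in> B" if "i < ln" "V (Suc i) = Some P \<or> (\<exists>a. V (Suc i) = Some (Mv a))" for i
      using cell_cases[OF that(1)]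
    proof cases
      case 1
      then show ?thesis using that(2) V1 by auto
    next
      case (3 a)
      then show ?thesis using that(2) t[OF that(1)] by (cases "V i") (auto split: if_splits sig.splits)
    qed simp
    have mv: "\<exists>a. V (Suc i) = Some (Mv a)" if "i \<in> B" for i
    proof -
      have c: "i < ln" "is_cell (pr ! i)" using that B by (auto simp: cellset_def)
      then obtain a where "pr ! i = Cell a False" by (auto simp: is_cell_def)
      moreover have "0 < i" using cellset_pos[of i] that B by auto
      then obtain j where j: "i = Suc j" by (cases i) auto
      moreover have "V i \<in> {Some I, Some P} \<or> (\<exists>a. V i \<in> {Some (Go a), Some (Mv a)})"
        using inv[of j] j c(1) by auto
      ultimately show ?thesis using t[OF c(1)] that by (auto split: if_splits)
    qed
    have nxt: "nxt p p'" if "B = {p}" "B' = {p'}" for p p'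
    proof -
      have p': "p' < ln" "is_cell (pr ! p')" "0 < p'" and Vp': "V p' = Some P \<or> (\<exists>a. V p' = Some (Mv a))"
        using that(2) cellset_pos unfolding B'_def cellset_def by auto
      then obtain q where q: "p' = Suc q" by (cases p') auto
      have p: "p \<in> cellset" using that(1) B by auto
      have "pr ! q = Sep \<or> q = p" using src[of q] Vp' q p'(1) that(1) by auto
      \<comment> \<open>The old star always sends \<open>Mv\<close> to the right, which stars the
        next cell unless the rule ends there; a star set elsewhere would then be the second
        one.\<close>
      moreover have "pr ! Suc p = Sep" if "q \<noteq> p"
      proof (rule ccontr)
        assume "pr ! Suc p \<noteq> Sep"
        then have "Suc p \<in> cellset" using cells[of "Suc p"] cellset_Suc[OF p] by (auto simp: cellset_def)
        then have "Suc p \<in> B'" using mv[of p] \<open>B = {p}\<close> by (auto simp: B'_def)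
        with \<open>B' = {p'}\<close> q that show False by simp
      qed
      ultimately show ?thesis using p' q by (auto simp: nxt_def)
    qed
    have "B' \<subseteq> cellset" by (auto simp: B'_def)
    from inv[of k] k at that(1,2) w nxt this show thesis by auto
  qed
qed

text \<open>The witness: a target at or before \<open>p\<close> is announced by \<open>P\<close>, a
  later one by \<open>Mv\<close>, and the old star itself is always left by
  \<open>Mv\<close>.\<close>

lemma prog_complete:
  assumes p: "pr ! p = Cell a False" "p < ln" and n: "nxt p p'"
  shows "\<exists>V. V 0 = None \<and> V ln = Some (Go a) \<and>
    (\<forall>i<ln. (Some (mark (i = p') (pr ! i)), V (Suc i)) \<in> out (Some (mark (i = p) (pr ! i))) (V i))"
proof -
  let ?V = "\<lambda>i. if i = 0 then None else if i \<le> p then (if i = p' then Some P else Some I)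
    else if i = Suc p \<or> i = p' then Some (Mv a) else Some (Go a)"
  have pc: "p \<in> cellset" using p by (simp add: cellset_def is_cell_def)
  have p': "p' < ln" "0 < p'" "is_cell (pr ! p')" using n by (auto simp: nxt_def)
  have "(Some (mark (i = p') (pr ! i)), ?V (Suc i)) \<in> out (Some (mark (i = p) (pr ! i))) (?V i)"
    if i: "i < ln" for i
    using cell_cases[OF i]
  proof cases
    case 1
    \<comment> \<open>Position 1 comes after \<open>Lft\<close>, not after \<open>Sep\<close>, so no
      jump leads there.\<close>
    have "p' \<noteq> Suc 0" if "p \<noteq> 0" using n that Lft by (auto simp: nxt_def)
    with 1 cellset_pos[OF pc] show ?thesis by auto
  next
    case 2
    then have "i \<noteq> p" "i \<noteq> p'" using p p' by (auto simp: is_cell_def)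
    with 2 show ?thesis by auto
  next
    case (3 b)
    show ?thesis
    proof (cases "i = p")
      case True
      with 3 p show ?thesis by auto
    next
      case False
      then have "p' \<noteq> Suc i" using n 3 by (auto simp: nxt_def)
      moreover have "p' = Suc p" if "i = Suc p" using n 3 that by (auto simp: nxt_def)
      ultimately show ?thesis using 3 False by auto
    qed
  qed
  moreover have "?V ln = Some (Go a)" using cellset_Suc[OF pc] p' by auto
  ultimately show ?thesis by (intro exI[of _ ?V]) auto
qed

inductive halts :: "nat \<Rightarrow> (ctr \<Rightarrow> nat) \<Rightarrow> bool" where
  halts_Halt: "pr ! p = Cell Halt False \<Longrightarrow> v None = 0 \<Longrightarrow> halts p v"
| halts_step: "pr ! p = Cell (Op a) False \<Longrightarrow> w \<in> act a v \<Longrightarrow> nxt p p' \<Longrightarrow> halts p' w \<Longrightarrow> halts p v"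

lemma row_0: "row B h 0 = Some Lft"
proof -
  have "0 < ln" using len by linarith
  then show ?thesis using Lft by (simp add: row_def)
qed

lemma sweep_row:
  assumes "sweep (row B (drow v m)) w" and le: "\<And>c. v c \<le> m" and B: "B \<subseteq> cellset"
  obtains p where "B = {p}" "pr ! p = Cell Halt False" "v None = 0" "w = (\<lambda>_. None)"
  | p a B' v' m' where "B = {p}" "pr ! p = Cell (Op a) False" "v' \<in> act a v" "\<And>c. v' c \<le> m'"
      "B' \<subseteq> cellset" "w = row B' (drow v' m')" "\<And>p'. B' = {p'} \<Longrightarrow> nxt p p'"
proof -
  obtain V where V: "V 0 = None" and t: "\<And>i. (w i, V (Suc i)) \<in> outx (row B (drow v m) i) (V i)"
    using assms(1) unfolding sweep_iff by blast
  have tp: "(w i, V (Suc i)) \<in> out (Some (mark (i \<in> B) (pr ! i))) (V i)" if "i < ln" for i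
    using t[of i] that by (simp add: row_def)
  define w' V' where "w' j = w (ln + j)" and "V' j = V (ln + j)" for j
  have td: "(w' j, V' (Suc j)) \<in> outx (drow v m j) (V' j)" for j
    using t[of "ln + j"] by (simp add: row_def w'_def V'_def)
  show thesis
  proof (rule prog_run[where w = w and V = V and B = B])
    show "\<And>i. i < ln \<Longrightarrow> (w i, V (Suc i)) \<in> out (Some (mark (i \<in> B) (pr ! i))) (V i)" by (rule tp)
    show "V 0 = None" "B \<subseteq> cellset" by fact+
  next
    assume "V ln \<in> {Some I, Some P, Some F} \<union> range (Some \<circ> Mv)"
    then show thesis using td[of 0] by (auto simp: V'_def drow_def split: if_splits)
  next
    fix p a B'
    assume *: "B = {p}" "pr ! p = Cell a False" "V ln = Some (Go a)" "B' \<subseteq> cellset"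
      "\<And>i. i < ln \<Longrightarrow> w i = Some (mark (i \<in> B') (pr ! i))" "\<And>p'. B' = {p'} \<Longrightarrow> nxt p p'"
    obtain b where b: "a = Op b"
      using td[of 0] *(3) by (cases a) (auto simp: V'_def drow_def split: if_splits)
    have "V' 0 = Some (Go (Op b))" using *(3) b by (simp add: V'_def)
    from data_sound[OF td this le] obtain v' m' where
      v': "v' \<in> act b v" "\<And>c. v' c \<le> m'" "w' = drow v' m'" by blast
    have "w i = row B' (drow v' m') i" for i
    proof (cases "i < ln")
      case False
      then have "w i = w' (i - ln)" by (simp add: w'_def)
      with v'(3) False show ?thesis by (simp add: row_def)
    qed (simp add: row_def *(5))
    then have "w = row B' (drow v' m')" by auto
    with * b v' show thesis by (intro that(2)) auto
  next
    fix p
    assume *: "B = {p}" "pr ! p = Cell Halt False" "V ln = Some F'" "\<And>i. i < ln \<Longrightarrow> w i = None"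
    have V'm: "V' j = Some F'" if "j \<le> m" for j
      using that
    proof (induction j)
      case (Suc j)
      then show ?case using td[of j] by (simp add: drow_def split: if_splits)
    qed (simp add: V'_def *(3))
    have w'm: "w' j = None" if "j \<le> m" for j
      using td[of j] V'm[OF that] that by (auto simp: drow_def split: if_splits)
    have e: "V' (Suc m) = None" using td[of m] V'm[of m] by (simp add: drow_def)
    have "w' j = None" for j
    proof (cases "j \<le> m")
      case False
      then show ?thesis by (intro None_tail[where h = "drow v m", OF td e]) (auto simp: drow_def)
    qed (rule w'm)
    then have "w i = None" for i
      using *(4)[of i] unfolding w'_def by (metis add_diff_inverse_nat)
    then have "w = (\<lambda>_. None)" by auto
    moreover have "v None = 0"
    proof (rule ccontr)
      assume "v None \<noteq> 0"
      then have "0 < m" using le[of None] by simp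
      then show False using td[of 0] V'm[of 0] \<open>v None \<noteq> 0\<close> by (simp add: drow_def)
    qed
    ultimately show thesis using * by (intro that(1)) auto
  qed
qed

text \<open>That \<open>B\<close> is a singleton is part of the conclusion: a row without exactly
  one star has no successor, and because of \<open>Lft\<close> it is not the empty row either. This
  disposes of all wrong guesses.\<close>

lemma halts_of_sweeps:
  assumes "sweep\<^sup>*\<^sup>* (row B (drow v m)) (\<lambda>_. None)" "\<And>c. v c \<le> m" "B \<subseteq> cellset"
  shows "\<exists>p. B = {p} \<and> halts p v"
proof -
  have "\<exists>p. B = {p} \<and> halts p v"
    if "sweep\<^sup>*\<^sup>* H (\<lambda>_. None)" "H = row B (drow v m)" "\<And>c. v c \<le> m" "B \<subseteq> cellset" for H
    using that
  proof (induction arbitrary: B v m rule: converse_rtranclp_induct)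
    case base
    then show ?case using row_0[of B "drow v m"] by (metis option.distinct(1))
  next
    case (step H w)
    from step.hyps(1)[unfolded step.prems(1)] step.prems(2,3) show ?case
    proof (cases rule: sweep_row)
      case (1 p)
      then show ?thesis by (auto intro: halts_Halt)
    next
      case (2 p a B' v' m')
      from step.IH[OF 2(6,4,5)] obtain p' where "B' = {p'}" "halts p' v'" by blast
      with 2 show ?thesis by (auto intro: halts_step)
    qed
  qed
  from this[OF assms(1) refl assms(2,3)] show ?thesis .
qed

text \<open>Program and data interact only through the signal on the edge between them.\<close>

lemma glue:
  assumes V1: "V1 0 = None" "V1 ln = V2 0"
    "\<And>i. i < ln \<Longrightarrow> (w1 i, V1 (Suc i)) \<in> out (Some (mark (i \<in> B) (pr ! i))) (V1 i)"
    and V2: "\<exists>M. \<forall>i\<ge>M. V2 i = None" "\<And>j. (w2 j, V2 (Suc j)) \<in> outx (h j) (V2 j)"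
  shows "sweep (row B h) (\<lambda>i. if i < ln then w1 i else w2 (i - ln))"
proof -
  obtain M where M: "\<And>i. M \<le> i \<Longrightarrow> V2 i = None" using V2(1) by blast
  let ?V = "\<lambda>i. if i \<le> ln then V1 i else V2 (i - ln)"
  have "((if i < ln then w1 i else w2 (i - ln)), ?V (Suc i)) \<in> outx (row B h i) (?V i)" for i
  proof (cases "i < ln")
    case True
    then show ?thesis using V1(3)[of i] by (simp add: row_def)
  next
    case False
    then have "?V i = V2 (i - ln)" "?V (Suc i) = V2 (Suc (i - ln))"
      using V1(2) by (auto simp: Suc_diff_le)
    then show ?thesis using V2(2)[of "i - ln"] False by (simp add: row_def)
  qed
  moreover have "?V i = None" if "ln + M + 1 \<le> i" for i using that M[of "i - ln"] by simp
  ultimately show ?thesis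
    unfolding sweep_iff
    by (intro exI[of _ ?V] conjI exI[of _ "ln + M + 1"] allI impI) (simp_all add: V1(1))
qed

lemma nxt_less: "nxt p p' \<Longrightarrow> p' < ln"
  by (simp add: nxt_def)

lemma final_sweep:
  assumes p: "pr ! p = Cell Halt False" "p < ln" and v: "v None = 0" and le: "\<And>c. v c \<le> m"
  shows "sweep (row {p} (drow v m)) (\<lambda>_. None)"
proof -
  let ?V1 = "\<lambda>i. if i = 0 then None else if i \<le> p then Some F else Some F'"
  let ?V2 = "\<lambda>j. if j \<le> m then Some F' else None"
  have pc: "p \<in> cellset" using p by (simp add: cellset_def is_cell_def)
  have "sweep (row {p} (drow v m)) (\<lambda>i. if i < ln then None else None)"
  proof (rule glue[where ?V1.0 = ?V1 and ?V2.0 = ?V2])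
    fix i assume i: "i < ln"
    show "(None, ?V1 (Suc i)) \<in> out (Some (mark (i \<in> {p}) (pr ! i))) (?V1 i)"
    proof (cases "i = p")
      case True
      then show ?thesis using p cellset_pos[OF pc] by simp
    next
      case False
      from cell_cases[OF i] show ?thesis by cases (use False cellset_pos[OF pc] in auto)
    qed
  next
    show "\<exists>M. \<forall>i\<ge>M. ?V2 i = None" by (intro exI[of _ "Suc m"]) auto
    show "(None, ?V2 (Suc j)) \<in> outx (drow v m j) (?V2 j)" for j
      using v by (auto simp: drow_def)
  qed (use p len in auto)
  then show ?thesis by simp
qed

lemma op_sweep:
  assumes p: "pr ! p = Cell (Op a) False" "p < ln" and n: "nxt p p'" and w: "w \<in> act a v"
    and le: "\<And>c. v c \<le> m"
  obtains m' where "sweep (row {p} (drow v m)) (row {p'} (drow w m'))" "\<And>c. w c \<le> m'"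
proof -
  obtain V1 where V1: "V1 0 = None" "V1 ln = Some (Go (Op a))"
    "\<And>i. i < ln \<Longrightarrow> (Some (mark (i = p') (pr ! i)), V1 (Suc i)) \<in> out (Some (mark (i = p) (pr ! i))) (V1 i)"
    using prog_complete[OF p n] by blast
  obtain V2 m' where V2: "V2 0 = Some (Go (Op a))" "\<exists>M. \<forall>i\<ge>M. V2 i = None" "\<And>c. w c \<le> m'"
    "\<And>j. (drow w m' j, V2 (Suc j)) \<in> outx (drow v m j) (V2 j)"
    using data_complete[OF w le] by blast
  have "sweep (row {p} (drow v m)) (\<lambda>i. if i < ln then Some (mark (i = p') (pr ! i)) else drow w m' (i - ln))"
    by (rule glue[where ?V1.0 = V1 and ?V2.0 = V2]) (use V1 V2 in auto)
  also have "(\<lambda>i. if i < ln then Some (mark (i = p') (pr ! i)) else drow w m' (i - ln)) = row {p'} (drow w m')"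
    by (auto simp: row_def)
  finally show thesis using V2(3) that by blast
qed

lemma sweeps_of_halts:
  assumes "halts p v" "p < ln" "\<And>c. v c \<le> m"
  shows "sweep\<^sup>*\<^sup>* (row {p} (drow v m)) (\<lambda>_. None)"
  using assms
proof (induction arbitrary: m)
  case (halts_Halt p v)
  then show ?case by (intro r_into_rtranclp final_sweep)
next
  case (halts_step p a w v p')
  from op_sweep[OF halts_step.hyps(1) halts_step.prems(1) halts_step.hyps(3,2) halts_step.prems(2)]
  obtain m' where m': "sweep (row {p} (drow v m)) (row {p'} (drow w m'))" "\<And>c. w c \<le> m'" by blast
  have "sweep\<^sup>*\<^sup>* (row {p'} (drow w m')) (\<lambda>_. None)"
    using nxt_less[OF halts_step.hyps(3)] m'(2) by (rule halts_step.IH)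
  with m'(1) show ?case by (rule converse_rtranclp_into_rtranclp)
qed

section \<open>Loading the input\<close>

definition irow :: "nat \<Rightarrow> nat \<Rightarrow> sym option" where
  "irow n j = (if j = n then Some R0 else None)"

definition input :: "nat \<Rightarrow> ctr \<Rightarrow> nat" where
  "input n = (\<lambda>_. 0)(Some RC := n)"

lemma drow_input: "drow (input n) n j = (if j < n then Some (Dat {Some RC}) else if j = n then Some R else None)"
  by (auto simp: drow_def input_def)

lemma input_le: "input n c \<le> n"
  by (simp add: input_def)

text \<open>The star stands on \<open>Init\<close>, and only the signal of \<open>Init\<close> can
  pass the blank columns and \<open>R0\<close>. So the first pass must load n into
  \<open>RC\<close>, and it chooses the next position as any other pass does.\<close>

lemma init_sweep:
  assumes "pr ! 1 = Cell Init False"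
  shows "sweep\<^sup>*\<^sup>* (row {1} (irow n)) (\<lambda>_. None) \<longleftrightarrow> (\<exists>p. nxt 1 p \<and> halts p (input n))"
proof
  have c1: "{1} \<subseteq> cellset" using assms len by (simp add: cellset_def is_cell_def)
  assume "sweep\<^sup>*\<^sup>* (row {1} (irow n)) (\<lambda>_. None)"
  then obtain w where w: "sweep (row {1} (irow n)) w" "sweep\<^sup>*\<^sup>* w (\<lambda>_. None)"
    using row_0[of "{1}" "irow n"] by (metis converse_rtranclpE option.distinct(1))
  obtain V where V: "V 0 = None" and t: "\<And>i. (w i, V (Suc i)) \<in> outx (row {1} (irow n) i) (V i)"
    using w(1) unfolding sweep_iff by blast
  have tp: "(w i, V (Suc i)) \<in> out (Some (mark (i \<in> {1}) (pr ! i))) (V i)" if "i < ln" for i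
    using t[of i] that by (simp add: row_def)
  define w' V' where "w' j = w (ln + j)" and "V' j = V (ln + j)" for j
  have td: "(w' j, V' (Suc j)) \<in> outx (irow n j) (V' j)" for j
    using t[of "ln + j"] by (simp add: row_def w'_def V'_def)
  show "\<exists>p. nxt 1 p \<and> halts p (input n)"
  proof (rule prog_run[where w = w and V = V and B = "{1}"])
    show "\<And>i. i < ln \<Longrightarrow> (w i, V (Suc i)) \<in> out (Some (mark (i \<in> {1}) (pr ! i))) (V i)" by (rule tp)
    show "V 0 = None" "{1} \<subseteq> cellset" by fact+
  next
    assume "V ln \<in> {Some I, Some P, Some F} \<union> range (Some \<circ> Mv)"
    then show ?thesis using td[of 0] by (auto simp: V'_def irow_def split: if_splits)
  next
    fix p a B'
    assume *: "{1} = {p}" "pr ! p = Cell a False" "V ln = Some (Go a)" "B' \<subseteq> cellset"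
      "\<And>i. i < ln \<Longrightarrow> w i = Some (mark (i \<in> B') (pr ! i))" "\<And>p'. B' = {p'} \<Longrightarrow> nxt p p'"
    then have p: "p = 1" "a = Init" using assms by auto
    have V'n: "V' j = Some (Go Init)" if "j \<le> n" for j
      using that
    proof (induction j)
      case (Suc j)
      then show ?case using td[of j] by (simp add: irow_def)
    qed (simp add: V'_def *(3) p)
    have e: "V' (Suc n) = None" using td[of n] V'n[of n] by (simp add: irow_def)
    have "w' j = drow (input n) n j" for j
    proof (cases "j \<le> n")
      case True
      then show ?thesis using td[of j] V'n[OF True] by (auto simp: drow_input irow_def split: if_splits)
    next
      case False
      then have "w' j = None" by (intro None_tail[where h = "irow n", OF td e]) (auto simp: irow_def)
      with False show ?thesis by (simp add: drow_input)
    qed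
    then have w': "w' = drow (input n) n" by auto
    have "w i = row B' (drow (input n) n) i" for i
    proof (cases "i < ln")
      case False
      then have "w i = w' (i - ln)" by (simp add: w'_def)
      with w' False show ?thesis by (simp add: row_def)
    qed (simp add: row_def *(5))
    then have "w = row B' (drow (input n) n)" by auto
    then obtain p' where "B' = {p'}" "halts p' (input n)"
      using halts_of_sweeps[of B' "input n" n] w(2) input_le *(4) by blast
    with *(6) p show ?thesis by blast
  next
    fix p
    assume "{1} = {p}" "pr ! p = Cell Halt False"
    with assms show ?thesis by auto
  qed
next
  assume "\<exists>p. nxt 1 p \<and> halts p (input n)"
  then obtain p where p: "nxt 1 p" "halts p (input n)" by blast
  obtain V1 where V1: "V1 0 = None" "V1 ln = Some (Go Init)"
    "\<And>i. i < ln \<Longrightarrow> (Some (mark (i = p) (pr ! i)), V1 (Suc i)) \<in> out (Some (mark (i = 1) (pr ! i))) (V1 i)"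
    using prog_complete[OF assms len p(1)] by blast
  let ?V2 = "\<lambda>j. if j \<le> n then Some (Go Init) else None"
  have "(drow (input n) n j, ?V2 (Suc j)) \<in> outx (irow n j) (?V2 j)" for j
    by (auto simp: drow_input irow_def)
  moreover have "\<exists>M. \<forall>i\<ge>M. ?V2 i = None" by (intro exI[of _ "Suc n"]) auto
  ultimately have "sweep (row {1} (irow n)) (\<lambda>i. if i < ln then Some (mark (i = p) (pr ! i)) else drow (input n) n (i - ln))"
    by (intro glue[where ?V1.0 = V1 and ?V2.0 = ?V2]) (use V1 in auto)
  also have "(\<lambda>i. if i < ln then Some (mark (i = p) (pr ! i)) else drow (input n) n (i - ln)) = row {p} (drow (input n) n)"
    by (auto simp: row_def)
  finally have "sweep (row {1} (irow n)) (row {p} (drow (input n) n))" .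
  moreover have "sweep\<^sup>*\<^sup>* (row {p} (drow (input n) n)) (\<lambda>_. None)"
    using p(2) nxt_less[OF p(1)] input_le by (rule sweeps_of_halts)
  ultimately show "sweep\<^sup>*\<^sup>* (row {1} (irow n)) (\<lambda>_. None)"
    by (rule converse_rtranclp_into_rtranclp)
qed

end

section \<open>The reduction\<close>

definition cellw :: "instr list \<Rightarrow> sym list" where
  "cellw r = map (\<lambda>a. Cell a False) r"

definition blocks :: "instr list list \<Rightarrow> sym list" where
  "blocks rs = concat (map (\<lambda>r. cellw r @ [Sep]) rs)"

lemma Sep_cellw [simp]: "Sep \<notin> set (cellw r)"
  by (auto simp: cellw_def)

lemma takeWhile_cellw [simp]: "takeWhile (\<lambda>s. s \<noteq> Sep) (cellw r @ Sep # ys) = cellw r"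
  by (subst takeWhile_append2) (auto simp: cellw_def)

lemma blocks_Nil [simp]: "blocks [] = []"
  by (simp add: blocks_def)

lemma blocks_Cons: "blocks (r # rs) = cellw r @ Sep # blocks rs"
  by (simp add: blocks_def)

lemma blocks_append: "blocks (rs @ ss) = blocks rs @ blocks ss"
  by (simp add: blocks_def)

text \<open>Each \<open>Sep\<close> but the last is followed by a whole rule. The prefix
  \<open>zs\<close> without \<open>Sep\<close> is the block already passed, which makes the
  induction over the blocks go through.\<close>

lemma blocks_site:
  assumes "xs @ Sep # ys = zs @ Sep # blocks rs" "Sep \<notin> set zs" "ys \<noteq> []"
  shows "\<exists>r\<in>set rs. takeWhile (\<lambda>s. s \<noteq> Sep) ys = cellw r"
  using assms
proof (induction rs arbitrary: xs zs)
  case Nil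
  from Nil.prems(3) obtain ys' y where "ys = ys' @ [y]" by (meson rev_exhaust)
  with Nil.prems(1) have "zs = xs @ Sep # ys'" by auto
  with Nil.prems(2) show ?case by simp
next
  case (Cons r rs)
  from Cons.prems(1) obtain us where
    "xs = zs @ us \<and> us @ Sep # ys = Sep # blocks (r # rs) \<or> xs @ us = zs \<and> Sep # ys = us @ Sep # blocks (r # rs)"
    unfolding append_eq_append_conv2 by blast
  then show ?case
  proof (elim disjE conjE)
    assume us: "us @ Sep # ys = Sep # blocks (r # rs)"
    show ?thesis
    proof (cases us)
      case Nil
      with us show ?thesis by (simp add: blocks_Cons)
    next
      case (Cons u vs)
      with us have "vs @ Sep # ys = cellw r @ Sep # blocks rs" by (simp add: blocks_Cons)
      from Cons.IH[OF this] Cons.prems(3) show ?thesis by simp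
    qed
  next
    assume us: "xs @ us = zs" "Sep # ys = us @ Sep # blocks (r # rs)"
    then show ?thesis using Cons.prems(2) by (cases us) (auto simp: blocks_Cons)
  qed
qed

text \<open>The leading block puts the number q of the initial state into the counter
  \<open>None\<close>. It follows \<open>Lft\<close> and not a \<open>Sep\<close>, so no jump leads
  back to its beginning.\<close>

definition prog :: "nat \<Rightarrow> instr list list \<Rightarrow> sym list" where
  "prog q rs = Lft # Cell Init False # cellw (replicate q (Op (Inc None))) @ Sep # blocks rs"

lemma program_prog: "program (prog q rs)"
proof
  show "prog q rs ! 0 = Lft" "1 < length (prog q rs)" by (simp_all add: prog_def)
  have "last (Sep # blocks rs) = Sep"
    by (cases rs rule: rev_cases) (simp_all add: blocks_append blocks_Cons)
  then show "last (prog q rs) = Sep" by (simp add: prog_def)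
  have *: "\<forall>s\<in>set (tl (prog q rs)). s = Sep \<or> is_cell s"
    by (auto simp: prog_def blocks_def cellw_def is_cell_def)
  show "prog q rs ! i = Sep \<or> is_cell (prog q rs ! i)" if "0 < i" "i < length (prog q rs)" for i
  proof -
    have "prog q rs ! i = tl (prog q rs) ! (i - 1)" "i - 1 < length (tl (prog q rs))"
      using that by (auto simp: nth_tl)
    with * show ?thesis by (metis nth_mem)
  qed
qed

section \<open>Positions in the program and rests of rules\<close>

context program
begin

text \<open>The default \<open>Halt\<close> can only come from \<open>Lft\<close>, that is, from
  \<open>p = 0\<close>.\<close>

definition remaining :: "nat \<Rightarrow> instr list" where
  "remaining p = map (\<lambda>s. case s of Cell a _ \<Rightarrow> a | _ \<Rightarrow> Halt) (takeWhile (\<lambda>s. s \<noteq> Sep) (drop p pr))"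

lemma remaining_Cell: "p < ln \<Longrightarrow> pr ! p = Cell a False \<Longrightarrow> remaining p = a # remaining (Suc p)"
  by (simp add: remaining_def Cons_nth_drop_Suc[symmetric])

lemma remaining_Sep: "p < ln \<Longrightarrow> pr ! p = Sep \<Longrightarrow> remaining p = []"
  by (simp add: remaining_def Cons_nth_drop_Suc[symmetric])

lemma cellsetE:
  assumes "p \<in> cellset" obtains a where "p < ln" "pr ! p = Cell a False" "remaining p = a # remaining (Suc p)"
  using assms remaining_Cell by (auto simp: cellset_def is_cell_def)

lemma nxt_cellset: "nxt p p' \<Longrightarrow> p' \<in> cellset"
  by (simp add: nxt_def cellset_def)

text \<open>\<open>R\<close> abstracts from the word: every place behind a separator inside the word
  carries a rule of \<open>R\<close>, and every rule of \<open>R\<close> has such a place, with a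
  cell on which the star can be put.\<close>

context
  fixes R
  assumes site_rule: "\<And>k. Suc k < ln \<Longrightarrow> pr ! k = Sep \<Longrightarrow> remaining (Suc k) \<in> R"
    and rule_site: "\<And>r. r \<in> R \<Longrightarrow> \<exists>k. Suc k \<in> cellset \<and> pr ! k = Sep \<and> remaining (Suc k) = r"
begin

lemma acc_of_halts: "halts p v \<Longrightarrow> p \<in> cellset \<Longrightarrow> accepts R (remaining p) v"
proof (induction rule: halts.induct)
  case (halts_Halt p v)
  then show ?case by (auto simp: remaining_Cell cellset_def intro: acc_Halt)
next
  case (halts_step p a w v p')
  have accepts: "accepts R (remaining p') w" using halts_step.IH nxt_cellset[OF halts_step.hyps(3)] by blast
  have p: "p < ln" using halts_step.prems by (simp add: cellset_def)
  have "accepts R (remaining (Suc p)) w"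
  proof (cases "p' = Suc p")
    case False
    with halts_step.hyps(3) have n: "pr ! Suc p = Sep" "pr ! (p' - 1) = Sep" "0 < p'" "p' < ln"
      by (auto simp: nxt_def)
    then have "remaining p' \<in> R" using site_rule[of "p' - 1"] by simp
    then have "accepts R [] w" using accepts by (rule acc_Nil)
    then show ?thesis using n(1) cellset_Suc[OF halts_step.prems] by (simp add: remaining_Sep)
  qed (use accepts in simp)
  with halts_step.hyps(1,2) p show ?case by (auto simp: remaining_Cell intro: acc_Op)
qed

text \<open>The second claim covers an empty rest, which is the rest at no cell: it speaks of the
  place after a cell \<open>p\<close>, from where a jump can lead to a cell again.\<close>

lemma halts_of_acc:
  "accepts R l v \<Longrightarrow> (\<forall>p\<in>cellset. remaining p = l \<longrightarrow> halts p v) \<and>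
    (\<forall>p\<in>cellset. remaining (Suc p) = l \<longrightarrow> (\<exists>p'. nxt p p' \<and> halts p' v))"
proof (induction rule: accepts.induct)
  case (acc_Halt v l)
  have *: "halts p v" if "p \<in> cellset" "remaining p = Halt # l" for p
    using that acc_Halt by (auto elim!: cellsetE intro: halts_Halt)
  have "nxt p (Suc p) \<and> Suc p \<in> cellset" if "p \<in> cellset" "remaining (Suc p) = Halt # l" for p
    using that cellset_Suc[of p] cells[of "Suc p"] remaining_Sep[of "Suc p"] by (auto simp: nxt_def cellset_def)
  with * show ?case by blast
next
  case (acc_Op w a v l)
  have *: "halts p v" if p: "p \<in> cellset" "remaining p = Op a # l" for p
  proof -
    from p(1) obtain b where b: "pr ! p = Cell b False" "remaining p = b # remaining (Suc p)" by (rule cellsetE)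
    with p(2) have "b = Op a" "remaining (Suc p) = l" by auto
    moreover from this(2) acc_Op.IH p(1) obtain p' where "nxt p p'" "halts p' w" by blast
    ultimately show ?thesis using b(1) acc_Op.hyps(1) by (auto intro: halts_step)
  qed
  have "nxt p (Suc p) \<and> Suc p \<in> cellset" if "p \<in> cellset" "remaining (Suc p) = Op a # l" for p
    using that cellset_Suc[of p] cells[of "Suc p"] remaining_Sep[of "Suc p"] by (auto simp: nxt_def cellset_def)
  with * show ?case by blast
next
  case (acc_Nil r v)
  obtain k where k: "Suc k \<in> cellset" "pr ! k = Sep" "remaining (Suc k) = r"
    using rule_site[OF acc_Nil.hyps(1)] by blast
  have "nxt p (Suc k) \<and> halts (Suc k) v" if "p \<in> cellset" "remaining (Suc p) = []" for p
  proof -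
    have "pr ! Suc p = Sep"
      using that cellset_Suc[of p] cells[of "Suc p"] by (auto simp: is_cell_def remaining_Cell)
    with k acc_Nil.IH show ?thesis by (auto simp: nxt_def cellset_def)
  qed
  moreover have "remaining p \<noteq> []" if "p \<in> cellset" for p using that by (auto elim: cellsetE)
  ultimately show ?case by blast
qed

lemma halts_iff_acc:
  assumes "p \<in> cellset"
  shows "(\<exists>p'. nxt p p' \<and> halts p' v) \<longleftrightarrow> accepts R (remaining (Suc p)) v"
proof
  assume "\<exists>p'. nxt p p' \<and> halts p' v"
  then obtain p' where n: "nxt p p'" and h: "halts p' v" by blast
  have a: "accepts R (remaining p') v" using h nxt_cellset[OF n] by (rule acc_of_halts)
  show "accepts R (remaining (Suc p)) v"
  proof (cases "p' = Suc p")
    case False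
    with n have s: "pr ! Suc p = Sep" "pr ! (p' - 1) = Sep" "0 < p'" "p' < ln"
      by (auto simp: nxt_def)
    then have "remaining p' \<in> R" using site_rule[of "p' - 1"] by simp
    then have "accepts R [] v" using a by (rule acc_Nil)
    then show ?thesis using s(1) cellset_Suc[OF assms] by (simp add: remaining_Sep)
  qed (use a in simp)
qed (use halts_of_acc assms in blast)

end

end

lemma remaining_prog:
  assumes "drop p (prog q rs) = cellw r @ Sep # ys"
  shows "program.remaining (prog q rs) p = r"
  using assms by (simp add: program.remaining_def[OF program_prog]) (simp add: cellw_def o_def)

text \<open>The one semantics names positions, the other rests of rules. An empty rule would offer
  no cell for the star, hence \<open>ne\<close>.\<close>

lemma prog_halts_iff:
  assumes ne: "[] \<notin> set rs"
  shows "(\<exists>p. program.nxt (prog q rs) 1 p \<and> program.halts (prog q rs) p v)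
    \<longleftrightarrow> accepts (set rs) (replicate q (Op (Inc None))) v"
proof -
  interpret program "prog q rs" by (rule program_prog)
  let ?z = "Lft # Cell Init False # cellw (replicate q (Op (Inc None)))"
  have p: "prog q rs = ?z @ Sep # blocks rs" by (simp add: prog_def)
  have "remaining (Suc k) \<in> set rs" if "Suc k < ln" "prog q rs ! k = Sep" for k
  proof -
    have "take k (prog q rs) @ Sep # drop (Suc k) (prog q rs) = ?z @ Sep # blocks rs"
      using that p by (metis Suc_lessD id_take_nth_drop)
    moreover have "Sep \<notin> set ?z" by simp
    moreover have "drop (Suc k) (prog q rs) \<noteq> []" using that(1) by simp
    ultimately obtain r where "r \<in> set rs" "takeWhile (\<lambda>s. s \<noteq> Sep) (drop (Suc k) (prog q rs)) = cellw r"
      using blocks_site by blast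
    then show ?thesis by (simp add: remaining_def) (simp add: cellw_def o_def)
  qed
  moreover have "\<exists>k. Suc k \<in> cellset \<and> prog q rs ! k = Sep \<and> remaining (Suc k) = r" if rin: "r \<in> set rs" for r
  proof -
    obtain as bs where rs: "rs = as @ r # bs" using rin by (meson split_list)
    \<comment> \<open>The separator in front of the block of \<open>r\<close> ends either the
      preceding rule or the leading block; \<open>ss\<close> is what stands between the leading
      cells and this separator.\<close>
    obtain ss where ss: "Sep # blocks as = ss @ [Sep]"
      by (cases as rule: rev_cases) (auto simp: blocks_append blocks_Cons)
    have "prog q rs = ?z @ (Sep # blocks as) @ cellw r @ Sep # blocks bs"
      unfolding p unfolding rs by (simp add: blocks_append blocks_Cons)
    then have eq: "prog q rs = (?z @ ss) @ Sep # cellw r @ Sep # blocks bs"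
      unfolding ss by simp
    let ?k = "length (?z @ ss)"
    have 1: "prog q rs ! ?k = Sep" unfolding eq by (rule nth_append_length)
    have 2: "drop (Suc ?k) (prog q rs) = cellw r @ Sep # blocks bs" unfolding eq by simp
    obtain a r' where r: "r = a # r'" using ne rin by (cases r) auto
    have 3: "Suc ?k < ln" unfolding eq by simp
    have "prog q rs ! Suc ?k = hd (drop (Suc ?k) (prog q rs))" using 3 by (simp add: hd_drop_conv_nth)
    also have "\<dots> = Cell a False" unfolding 2 by (simp add: r cellw_def)
    finally have "Suc ?k \<in> cellset" using 3 by (simp add: cellset_def is_cell_def)
    with 1 remaining_prog[OF 2] show ?thesis by blast
  qed
  moreover have "prog q rs ! 1 = Cell Init False" "1 < ln" by (simp_all add: prog_def)
  then have "1 \<in> cellset" unfolding cellset_def is_cell_def by blast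
  moreover have "remaining (Suc 1) = replicate q (Op (Inc None))"
    by (rule remaining_prog[of _ _ _ _ "blocks rs"]) (simp add: prog_def)
  ultimately show ?thesis using halts_iff_acc[of "set rs" 1 v] by simp
qed

text \<open>Register 0 receives the argument and register 1 the value; the final \<open>dec\<close>
  and \<open>chk\<close> let only the value 1 pass.\<close>

lemma recf_regex:
  fixes h :: recf
  obtains e :: "dctr action rx"
  where "\<And>n. run act e ((\<lambda>_. 0)(RC := n)) \<noteq> {} \<longleftrightarrow> eval h [n] 1"
proof -
  define g :: "nat action rx" where "g = Seq (compile h [0] 1 2) (Seq (dec 1) (chk 1))"
  have "finite (\<Union>a\<in>set_rx g. set_action a)"
  proof -
    have "finite (set_rx (x :: 'a rx))" for x by (induction x) auto
    moreover have "finite (set_action (a :: 'b action))" for a by (cases a) auto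
    ultimately show ?thesis by blast
  qed
  then obtain k where k: "(\<Union>a\<in>set_rx g. set_action a) \<subseteq> {..<k}"
    by (meson finite_nat_iff_bounded)
  have "run act (Seq (inc RA) (rsubst gact g)) ((\<lambda>_. 0)(RC := n)) \<noteq> {} \<longleftrightarrow> eval h [n] 1" for n
  proof -
    let ?v = "(\<lambda>_. 0)(0 := n) :: nat \<Rightarrow> nat"
    \<comment> \<open>The registers other than 0 start empty, so their Goedel number is 1, which the
      single \<open>inc RA\<close> provides.\<close>
    have "godel k ?v = 1" by (simp only: godel_upd0) (simp add: godel_def)
    then have "((\<lambda>_. 0)(RC := n))(RA := 1) = genc k ?v"
      by (auto simp: genc_def fun_eq_iff split: dctr.split)
    then have "run act (Seq (inc RA) (rsubst gact g)) ((\<lambda>_. 0)(RC := n)) = run act (rsubst gact g) (genc k ?v)"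
      by simp
    also have "\<dots> = genc k ` run act g ?v"
      using k by (intro run_rsubst run_gact) auto
    finally have "run act (Seq (inc RA) (rsubst gact g)) ((\<lambda>_. 0)(RC := n)) \<noteq> {} \<longleftrightarrow> run act g ?v \<noteq> {}"
      by simp
    also have "run act g ?v = (\<Union>y\<in>{y. eval h [n] y}. run act (Seq (dec 1) (chk 1)) (?v(1 := y)))"
    proof -
      have "run act (compile h [0] 1 2) ?v = (\<lambda>y. ?v(1 := y)) ` {y. eval h (map ?v [0]) y}"
        by (rule comp_correctD[OF comp_correct]) auto
      then show ?thesis by (simp add: g_def image_image)
    qed
    also have "\<dots> = (\<Union>y\<in>{y. eval h [n] y}. if y = 1 then {?v(1 := 0)} else {})"
      by (intro SUP_cong) (auto simp: fun_eq_iff)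
    also have "\<dots> \<noteq> {} \<longleftrightarrow> eval h [n] 1" by auto
    finally show ?thesis .
  qed
  then show thesis by (rule that)
qed

text \<open>The argument \<open>n\<close> enters an instance only through the position of this token.\<close>

definition input_entry :: "nat \<Rightarrow> entry" where
  "input_entry n = ((int n, 0, int n + 1, 0), col (Some R0), 1)"

text \<open>The program lies to the left of column 0, so that the data begin at column 0 and the
  place of the input token does not depend on the length of the program. The initial star is the one
  on \<open>Init\<close>, at index 1.\<close>

definition prog_entries :: "sym list \<Rightarrow> entry list" where
  "prog_entries pr = map (\<lambda>i. let x = int i - int (length pr) in
     ((x, 0, x + 1, 0), col (Some (mark (i = 1) (pr ! i))), 1)) [0..<length pr]"

lemma col_Some_neq_0: "col (Some a) \<noteq> 0"
  by (simp add: col_def)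

lemma instance_map_program:
  assumes "program pr"
  shows "instance_map (input_entry n # prog_entries pr)
    = rowsum (- int (length pr)) 0 (program.row pr {1} (program.irow n)) (length pr + Suc n)"
proof (intro ext)
  fix e c
  interpret program pr by (rule assms)
  let ?h = "\<lambda>i. hmap (int i - int ln) 0 (col (row {1} (irow n) i)) e c"
  define con :: "entry \<Rightarrow> int" where
    "con = (\<lambda>((p, q, r, s), c', v). if e = {(p, q), (r, s)} \<and> c = c' then v else 0)"
  have con: "con ((x, 0, x + 1, 0), k, 1) = hmap x 0 k e c" if "k \<noteq> 0" for x k
    using that by (simp add: con_def hmap_def)
  have "sum_list (map con (prog_entries pr))
    = (\<Sum>i<ln. con ((int i - int ln, 0, int i - int ln + 1, 0), col (Some (mark (i = 1) (pr ! i))), 1))"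
    by (simp add: prog_entries_def o_def Let_def interv_sum_list_conv_sum_set_nat atLeast0LessThan)
  also have "\<dots> = (\<Sum>i<ln. ?h i)"
    by (intro sum.cong) (simp_all add: con col_Some_neq_0 row_def)
  finally have "sum_list (map con (prog_entries pr)) = (\<Sum>i<ln. ?h i)" .
  moreover have "con (input_entry n) = (\<Sum>i\<in>{ln..<ln + Suc n}. ?h i)"
  proof -
    \<comment> \<open>Behind the program all columns are blank except that of
      \<open>R0\<close>.\<close>
    have "(\<Sum>i\<in>{ln..<ln + Suc n}. ?h i) = (\<Sum>i\<in>{ln + n}. ?h i)"
      by (intro sum.mono_neutral_right) (auto simp: row_def irow_def)
    then show ?thesis by (simp add: row_def irow_def input_entry_def con col_Some_neq_0)
  qed
  moreover have "(\<Sum>i<ln + Suc n. ?h i) = (\<Sum>i<ln. ?h i) + (\<Sum>i\<in>{ln..<ln + Suc n}. ?h i)"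
    unfolding lessThan_atLeast0 by (intro sum.atLeastLessThan_concat[symmetric]) auto
  ultimately show "instance_map (input_entry n # prog_entries pr) e c
    = rowsum (- int ln) 0 (row {1} (irow n)) (ln + Suc n) e c"
    by (simp add: instance_map_def con_def[symmetric] rowsum_def)
qed

lemma solvable_iff_halts:
  assumes "program pr" "pr ! 1 = Cell Init False"
  shows "(\<exists>f. is_tiling_sum 0 tile_set f \<and> (\<lambda>e c. instance_map (input_entry n # prog_entries pr) e c + f e c) = (\<lambda>e c. 0))
    \<longleftrightarrow> (\<exists>p. program.nxt pr 1 p \<and> program.halts pr p (program.input n))"
proof -
  interpret program pr by (rule assms(1))
  have left: "row {1} (irow n) i = Some Lft \<Longrightarrow> i = 0" for i
    using cells[of i] by (cases "i = 0") (auto simp: row_def irow_def is_cell_def split: if_splits)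
  have right: "ln + Suc n \<le> i \<Longrightarrow> row {1} (irow n) i = None" for i
    by (simp add: row_def irow_def)
  show ?thesis
    unfolding instance_map_program[OF assms(1)]
    unfolding init_sweep[OF assms(2), symmetric]
    by (rule tiling_iff_sweeps[OF right left])
qed

definition colors :: "color set" where
  "colors = range (col :: sym option \<Rightarrow> color) \<union> range (col :: sig option \<Rightarrow> color)"

lemma valid_program: "valid_instance colors (input_entry n # prog_entries pr)"
  by (auto simp: valid_instance_def input_entry_def prog_entries_def colors_def Let_def)

text \<open>The list \<open>xs\<close> is chosen before n; the diagonal argument rests on this order
  of quantifiers.\<close>

lemma instance_of_recf:
  obtains xs where "\<And>n. valid_instance colors (input_entry n # xs)"
    "\<And>n. (\<exists>f. is_tiling_sum 0 tile_set f \<and> (\<lambda>e c. instance_map (input_entry n # xs) e c + f e c) = (\<lambda>e c. 0))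
      \<longleftrightarrow> eval h [n] 1"
proof -
  obtain e :: "dctr action rx" where e: "\<And>n. run act e ((\<lambda>_. 0)(RC := n)) \<noteq> {} \<longleftrightarrow> eval h [n] 1"
    using recf_regex[of h] by blast
  let ?R = "insert [Halt] (map Op ` rule_of ` transitions e [])"
  have "finite ?R" by (simp add: finite_trans)
  then obtain rs where rs: "set rs = ?R" using finite_list by blast
  have ne: "[] \<notin> set rs" unfolding rs by auto
  define pr where "pr = prog (state_no [e]) rs"
  have pr: "program pr" "pr ! 1 = Cell Init False"
    unfolding pr_def by (rule program_prog) (simp add: prog_def)
  have input: "program.input n = case_option 0 ((\<lambda>_. 0)(RC := n))" for n
    by (auto simp: program.input_def[OF pr(1)] fun_eq_iff split: option.split)
  have "(\<exists>p. program.nxt pr 1 p \<and> program.halts pr p (program.input n)) \<longleftrightarrow> eval h [n] 1" for n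
  proof -
    have "(\<exists>p. program.nxt pr 1 p \<and> program.halts pr p (program.input n))
      \<longleftrightarrow> accepts ?R (map Op (replicate (state_no [e]) (Inc None))) (program.input n)"
      unfolding pr_def prog_halts_iff[OF ne] rs by simp
    also have "\<dots> \<longleftrightarrow> accepts ?R [] (case_option (state_no [e]) ((\<lambda>_. 0)(RC := n)))"
      unfolding acc_map_Op acts_replicate_Inc input by (simp add: case_option_upd_None)
    also have "\<dots> \<longleftrightarrow> eval h [n] 1" unfolding acc_rules_iff e ..
    finally show ?thesis .
  qed
  with solvable_iff_halts[OF pr] valid_program show thesis by (intro that[of "prog_entries pr"]) auto
qed

section \<open>The diagonal argument\<close>

lemma inj_encode_instance: "inj encode_instance"
proof -
  have "inj encode_entry"
    by (auto simp: inj_def encode_entry_def prod_encode_eq int_encode_eq)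
  then show ?thesis
    by (auto simp: inj_def encode_instance_def list_encode_eq dest: map_inj_on inj_on_subset)
qed

text \<open>\<open>list_encode\<close> maps a nonempty list to the successor of a pair of codes.
  Here N serves twice: as the argument placed in front and as the code of the tail.\<close>

lemma computable_cons_input:
  "computable1 (\<lambda>N. Suc (prod_encode (encode_entry (input_entry N), N)))"
proof -
  note pair = computable1_comp2[OF computable2_prod_encode]
  have "computable1 (\<lambda>N. int_encode (int (Suc N)))"
    by (rule computable1_comp[OF computable1_int_encode computable1_Suc])
  then have "computable1 (\<lambda>N. int_encode (int N + 1))" by (simp add: add.commute)
  then show ?thesis
    unfolding encode_entry_def input_entry_def prod.case
    by (intro computable1_comp[OF computable1_Suc] pair computable1_int_encode computable1_const computable1_id)
qed

theorem theorem3: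
  shows "\<exists>(C :: color set) (c0 :: color) (T :: tile set).
           finite C \<and> c0 \<in> C \<and> T \<subseteq> C \<times> C \<times> C \<times> C \<and>
           \<not> decidable (zero_tiling_sum_problem C c0 T)"
proof (intro exI conjI notI)
  show "finite colors" by (simp add: colors_def)
  show "0 \<in> colors" unfolding colors_def by (metis UnI1 col_None rangeI)
  show "tile_set \<subseteq> colors \<times> colors \<times> colors \<times> colors" by (auto simp: tile_set_def colors_def enc_tile_def)
next
  let ?A = "zero_tiling_sum_problem colors 0 tile_set"
  let ?r = "\<lambda>N. Suc (prod_encode (encode_entry (input_entry N), N))"
  assume "decidable ?A"
  then obtain f where f: "\<And>n. eval f [n] (if n \<in> ?A then 0 else 1)" unfolding decidable_def by blast
  then have "computable1 (\<lambda>n. if n \<in> ?A then 0 else 1)" unfolding computable1_def by blast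
  from computable1_comp[OF this computable_cons_input]
  obtain h where h: "\<And>N. eval h [N] (if ?r N \<in> ?A then 0 else 1)" unfolding computable1_def by blast
  obtain xs where valid: "\<And>n. valid_instance colors (input_entry n # xs)"
    and xs: "\<And>n. (\<exists>f. is_tiling_sum 0 tile_set f \<and> (\<lambda>e c. instance_map (input_entry n # xs) e c + f e c) = (\<lambda>e c. 0))
      \<longleftrightarrow> eval h [n] 1"
    using instance_of_recf[of h] by blast
  \<comment> \<open>The diagonal choice: the instance built from \<open>h\<close> receives the code
    of its own tail as argument, so it is solvable exactly if the assumed decision procedure calls
    it unsolvable.\<close>
  define N where "N = encode_instance xs"
  have rN: "?r N = encode_instance (input_entry N # xs)" by (simp add: encode_instance_def N_def)
  have "?r N \<in> ?A \<longleftrightarrow> eval h [N] 1"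
    unfolding rN xs[symmetric] zero_tiling_sum_problem_def
    using valid[of N] inj_encode_instance by (auto dest: injD)
  moreover have "eval h [N] 1 \<longleftrightarrow> ?r N \<notin> ?A"
    using h[of N] eval_deterministic[of h "[N]" 0 1] by (auto split: if_splits)
  ultimately show False by blast
qed

end
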